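(* Let $\eta$ be the standard Gaussian measure on $\mathbb{R}^d$ and let $F,G:\mathbb{R}^d\to\mathbb{R}^d$. Suppose: (C1) $F,G\in H^1_\eta(\mathbb{R}^d;\mathbb{R}^d)$ and $F,G\in W^{1,2(d-1)}_\eta(\mathbb{R}^d;\mathbb{R}^d)$; (C2) $F,G$ are invertible and $F^{-1},G^{-1}$ are both Borel-measurable; (C3) there exists a constant $c>0$ such that $|\det(J_F)|,|\det(J_G)|\ge c>0$ $\eta$-a.e. in $\mathbb{R}^d$; (C4) there exists a constant $c_F<\infty$ such that $p_{F^\sharp\eta}(x)\le c_F\,p_\eta(x)$ for all $x\in\mathbb{R}^d$. Then $$\mathrm{KL}(F^\sharp\eta\,\|\,G^\sharp\eta)\le C\,\|F-G\|_{H^1_\eta(\mathbb{R}^d;\mathbb{R}^d)},$$ where the constant $C>0$ depends on $d$, $c$, $c_F$, $\|F+G\|_{L^2_\eta}$, $\|F\|_{W^{1,2(d-1)}_\eta}$, and $\|G\|_{W^{1,2(d-1)}_\eta}$.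
   Context: $J_F$ is the Jacobian matrix of $F$. $F^\sharp\eta:=(F^{-1})_\sharp\eta$ is the pullback of $\eta$ by $F$, where $T_\sharp\eta(A)=\eta(T^{-1}(A))$; $p_\mu$ denotes the Lebesgue density of $\mu$. For absolutely continuous probability measures, $\mathrm{KL}(\mu\|\mu')=\int\log\big(p_\mu(x)/p_{\mu'}(x)\big)\,p_\mu(x)\,dx$. The weighted Sobolev norm is $\|f\|_{W^{k,p}_\eta}=\big(\sum_{\|\mathbf{j}\|_1\le k}\|D^{\mathbf{j}}f\|^p_{L^p_\eta}\big)^{1/p}$ (sum over multi-indices), with $\|f\|_{L^p_\eta}=(\int|f|^p\,d\eta)^{1/p}$, and $H^k_\eta=W^{k,2}_\eta$. *)

theory Defs
  imports "HOL-Probability.Probability"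
begin

section \<open>Smooth test functions and weak derivatives\<close>

definition partial :: "'n \<Rightarrow> (real^'n \<Rightarrow> real) \<Rightarrow> real^'n \<Rightarrow> real" where
  "partial i \<phi> x = frechet_derivative \<phi> (at x) (axis i 1)"

fun iterated_partial :: "'n list \<Rightarrow> (real^'n \<Rightarrow> real) \<Rightarrow> real^'n \<Rightarrow> real" where
  "iterated_partial [] \<phi> = \<phi>"
| "iterated_partial (i # is) \<phi> = partial i (iterated_partial is \<phi>)"

definition test_function :: "(real^'n \<Rightarrow> real) \<Rightarrow> bool" where
  "test_function \<phi> \<longleftrightarrow>
     (\<forall>is x. iterated_partial is \<phi> differentiable (at x)) \<and>
     compact (closure {x. \<phi> x \<noteq> 0})"

definition locally_integrable ::
  "('a::euclidean_space \<Rightarrow> 'b::euclidean_space) \<Rightarrow> bool" where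
  "locally_integrable f \<longleftrightarrow>
     f \<in> borel_measurable borel \<and> (\<forall>K. compact K \<longrightarrow> set_integrable lborel K f)"

text \<open>
  A multi-index is a function \<open>j :: 'n \<Rightarrow> nat\<close>. Its classical derivative of a smooth function
  is the iterated partial derivative along any list of directions containing each \<open>i\<close>
  exactly \<open>j i\<close> times; the order does not matter for smooth functions.
\<close>

definition has_weak_deriv ::
  "('n \<Rightarrow> nat) \<Rightarrow> (real^'n \<Rightarrow> 'b::euclidean_space) \<Rightarrow> (real^'n \<Rightarrow> 'b) \<Rightarrow> bool" where
  "has_weak_deriv j f g \<longleftrightarrow>
     locally_integrable f \<and> locally_integrable g \<and>
     (\<forall>\<phi> is. test_function \<phi> \<and> (\<forall>i. count_list is i = j i) \<longrightarrow>
        (\<integral>x. iterated_partial is \<phi> x *\<^sub>R f x \<partial>lborel)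
          = (- 1) ^ (\<Sum>i\<in>UNIV. j i) *\<^sub>R (\<integral>x. \<phi> x *\<^sub>R g x \<partial>lborel))"

text \<open>
  The weak derivative is unique up to Lebesgue null sets, so the choice of representative is
  irrelevant below; for \<open>j = 0\<close> it agrees with \<open>f\<close> almost everywhere.
\<close>

definition weak_deriv ::
  "('n \<Rightarrow> nat) \<Rightarrow> (real^'n \<Rightarrow> 'b::euclidean_space) \<Rightarrow> real^'n \<Rightarrow> 'b" where
  "weak_deriv j f = (SOME g. has_weak_deriv j f g)"

definition weak_jacobian :: "(real^'n \<Rightarrow> real^'n) \<Rightarrow> real^'n \<Rightarrow> real^'n^'n" where
  "weak_jacobian F x = (\<chi> a b. weak_deriv (\<lambda>i. if i = b then 1 else 0) F x $ a)"


section \<open>Weighted Lebesgue and Sobolev spaces\<close>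

text \<open>
  The exponent \<open>p\<close> is an arbitrary real. For \<open>p = 0\<close> and a finite measure,
  \<open>Lp_space\<close> only asks for measurability.
\<close>

definition Lp_space ::
  "'a::euclidean_space measure \<Rightarrow> real \<Rightarrow> ('a \<Rightarrow> 'b::euclidean_space) \<Rightarrow> bool" where
  "Lp_space M p f \<longleftrightarrow>
     f \<in> borel_measurable M \<and> integrable M (\<lambda>x. norm (f x) powr p)"

definition Lp_norm ::
  "'a::euclidean_space measure \<Rightarrow> real \<Rightarrow> ('a \<Rightarrow> 'b::euclidean_space) \<Rightarrow> real" where
  "Lp_norm M p f = (\<integral>x. norm (f x) powr p \<partial>M) powr (1 / p)"

definition sobolev_space ::
  "(real^'n) measure \<Rightarrow> nat \<Rightarrow> real \<Rightarrow> (real^'n \<Rightarrow> 'b::euclidean_space) \<Rightarrow> bool" where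
  "sobolev_space M k p f \<longleftrightarrow>
     (\<forall>j. (\<Sum>i\<in>UNIV. j i) \<le> k \<longrightarrow> (\<exists>g. has_weak_deriv j f g \<and> Lp_space M p g))"

definition sobolev_norm ::
  "(real^'n) measure \<Rightarrow> nat \<Rightarrow> real \<Rightarrow> (real^'n \<Rightarrow> 'b::euclidean_space) \<Rightarrow> real" where
  "sobolev_norm M k p f =
     (\<Sum>j | (\<Sum>i\<in>UNIV. j i) \<le> k. Lp_norm M p (weak_deriv j f) powr p) powr (1 / p)"


section \<open>Gaussian measure, pullback and Kullback--Leibler divergence\<close>

definition std_gaussian_density :: "real^'n \<Rightarrow> real" where
  "std_gaussian_density x = (\<Prod>i\<in>UNIV. std_normal_density (x $ i))"

definition std_gaussian :: "(real^'n) measure" where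
  "std_gaussian = density lborel (\<lambda>x. ennreal (std_gaussian_density x))"

definition pullback :: "('a::euclidean_space \<Rightarrow> 'a) \<Rightarrow> 'a measure \<Rightarrow> 'a measure" where
  "pullback F M = distr M borel (inv F)"

text \<open>
  For an absolutely continuous probability measure; determined up to Lebesgue null sets.
\<close>

definition lebesgue_density :: "'a::euclidean_space measure \<Rightarrow> 'a \<Rightarrow> real" where
  "lebesgue_density M x = enn2real (RN_deriv lborel M x)"

text \<open>
  The divergence is extended-valued, because the library constant \<open>KL_divergence\<close>, being a
  Bochner integral, is \<open>0\<close> when the integral diverges. The integral of the negative part is at
  most the total mass of the second measure, so the difference below is never of the form
  \<open>\<infinity> - \<infinity>\<close> for absolutely continuous probability measures.
\<close>

definition KL_integrand :: "real \<Rightarrow> real \<Rightarrow> ereal" where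
  "KL_integrand p q = (if p = 0 then 0 else if q = 0 then \<infinity> else ereal (ln (p / q) * p))"

definition KL :: "'a::euclidean_space measure \<Rightarrow> 'a measure \<Rightarrow> ereal" where
  "KL M N =
     (let h = (\<lambda>x. KL_integrand (lebesgue_density M x) (lebesgue_density N x))
      in enn2ereal (\<integral>\<^sup>+x. e2ennreal (h x) \<partial>lborel)
         - enn2ereal (\<integral>\<^sup>+x. e2ennreal (- h x) \<partial>lborel))"

end

theory Submission
  imports Defs "HOL-Computational_Algebra.Polynomial"
begin

text \<open>
  Write \<open>\<phi>\<close> for the Gaussian density. The whole estimate rests on the formula
  \<open>\<bar>det J\<^sub>F(x)\<bar> \<phi>(F x)\<close> for the Lebesgue density of the pullback by \<open>F\<close>, and likewise for \<open>G\<close>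
  (\<open>lebesgue_density_pullback_std_gaussian\<close>). Given this formula, the logarithm of the quotient of
  the two densities is \<open>(\<parallel>G\<parallel>\<^sup>2 - \<parallel>F\<parallel>\<^sup>2) / 2 + ln \<bar>det J\<^sub>F\<bar> - ln \<bar>det J\<^sub>G\<bar>\<close>. The first summand is at
  most \<open>\<parallel>F - G\<parallel> \<parallel>F + G\<parallel> / 2\<close>. The second is at most \<open>\<bar>\<bar>det J\<^sub>F\<bar> - \<bar>det J\<^sub>G\<bar>\<bar> / c\<close>, because \<open>ln\<close> has slope at
  most \<open>1 / c\<close> beyond \<open>c\<close>; as a polynomial of degree \<open>d\<close>, the determinant changes by at most a constant
  times \<open>\<parallel>J\<^sub>F - J\<^sub>G\<parallel>\<close> times the \<open>(d - 1)\<close>-st power of the size of the entries. The bound of the first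
  density by \<open>c\<^sub>F \<phi>\<close> turns the divergence into an integral against the Gaussian measure, and the
  Cauchy--Schwarz inequality separates the factors \<open>F - G\<close>, \<open>J\<^sub>F - J\<^sub>G\<close> from \<open>F + G\<close> and from the
  \<open>2(d - 1)\<close>-th moments of the Jacobians (\<open>KL_pullback_std_gaussian_le\<close>).

  The density formula is a change of variables for a map that is merely weakly differentiable and
  possibly discontinuous. It is reduced to the classical formula by a theorem of Lusin type
  (\<open>weak_gradient_cover\<close>): up to a null set, space is covered by countably many Borel sets \<open>S\<close>
  such that \<open>F\<close> is differentiable relative to \<open>S\<close>, with the weak Jacobian as derivative. On the pieces
  the injective change of variables applies; the remaining null set does not matter because the
  pullback measure is absolutely continuous, which amounts to \<open>F\<close> mapping Lebesgue null sets to null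
  sets.

  For the covering theorem, let \<open>u\<^sub>k\<close> be mollifications of \<open>f\<close>; they are smooth, and their gradients are the
  mollified weak gradient. Along a fast sequence of scales, some integrable function \<open>H\<close> satisfies, on a given ball,
  \<open>\<bar>u\<^sub>k - f\<bar> + \<bar>\<nabla>u\<^sub>k - g\<bar> \<le> 2\<^sup>-\<^sup>k H\<close> for all \<open>k\<close>. On the set where the maximal function of \<open>H\<close>
  is at most \<open>m\<close>, the pointwise inequality \<open>norm_diff_le_maximal\<close> makes \<open>f - u\<^sub>k\<close> Lipschitz with a constant
  of order \<open>2\<^sup>-\<^sup>k m\<close>, so that \<open>f\<close> inherits differentiability from the \<open>u\<^sub>k\<close>. By Vitali's covering lemma these
  sets exhaust space up to a null set as \<open>m\<close> grows.
\<close>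

section \<open>Change of variables for arbitrary finite coordinate types\<close>

text \<open>
  A well-ordered type with as many elements as \<open>'n\<close>. The classical change of variables
  \<open>has_absolute_integral_change_of_variables\<close> speaks about coordinates indexed by a well-ordered finite
  type; renaming coordinates along a bijection with this type carries it over to any finite index type.
\<close>

typedef ('n::finite) ordinal_index = "{..<CARD('n)}"
  by (rule exI[of _ 0]) simp

instantiation ordinal_index :: (finite) linorder
begin
definition "x \<le> y \<longleftrightarrow> Rep_ordinal_index x \<le> Rep_ordinal_index y"
definition "x < y \<longleftrightarrow> Rep_ordinal_index x < Rep_ordinal_index y"
instance
  by standard (auto simp: less_eq_ordinal_index_def less_ordinal_index_def Rep_ordinal_index_inject)
end

lemma bij_betw_Rep_ordinal_index:
  "bij_betw (Rep_ordinal_index :: 'n::finite ordinal_index \<Rightarrow> nat) UNIV {..<CARD('n)}"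
  using type_definition.Rep_range[OF type_definition_ordinal_index]
  by (auto simp: bij_betw_def inj_on_def Rep_ordinal_index_inject)

instance ordinal_index :: (finite) finite
  by standard (metis bij_betw_Rep_ordinal_index bij_betw_finite finite_lessThan)

instance ordinal_index :: (finite) wellorder
  by (rule wf_wellorderI)
     (auto simp: less_ordinal_index_def intro: wf_subset[OF wf_measure[of Rep_ordinal_index]], intro_classes)

lemma ex_bij_ordinal_index: "\<exists>\<pi> :: 'n::finite ordinal_index \<Rightarrow> 'n. bij \<pi>"
proof -
  have "card (UNIV :: 'n ordinal_index set) = card (UNIV :: 'n set)"
    using bij_betw_same_card[OF bij_betw_Rep_ordinal_index] by simp
  then show ?thesis
    by (auto intro: finite_same_card_bij)
qed

text \<open>
  Conjugation with \<open>\<pi>\<close> is a sign-preserving bijection between the permutations of the two index types.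
\<close>

lemma det_reindex:
  fixes A :: "real^'n^'n" and \<pi> :: "'m::finite \<Rightarrow> 'n::finite"
  assumes "bij \<pi>"
  shows "det (\<chi> i j. A $ \<pi> i $ \<pi> j) = det A"
proof -
  let ?c = "map_permutation UNIV \<pi>"
  have inj: "inj \<pi>" and surj: "surj \<pi>" using assms by (auto simp: bij_def)
  have "bij_betw ?c {p. p permutes UNIV} {p. p permutes (UNIV :: 'n set)}"
  proof (rule bij_betwI[where g = "map_permutation UNIV (inv \<pi>)"])
    show "?c \<in> {p. p permutes UNIV} \<rightarrow> {p. p permutes UNIV}"
      using assms by (auto intro: map_permutation_permutes)
    show "map_permutation UNIV (inv \<pi>) \<in> {p. p permutes UNIV} \<rightarrow> {p. p permutes UNIV}"
      using assms by (auto intro: map_permutation_permutes bij_imp_bij_inv)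
    show "map_permutation UNIV (inv \<pi>) (?c p) = p" if "p \<in> {p. p permutes UNIV}" for p
      using that assms map_permutation_compose_inv[of \<pi> UNIV UNIV p "inv \<pi>"] by (auto simp: inj)
    show "?c (map_permutation UNIV (inv \<pi>) p) = p" if "p \<in> {p. p permutes UNIV}" for p
      using that assms map_permutation_compose_inv[of "inv \<pi>" UNIV UNIV p "\<pi>"] 
      by (auto simp: bij_imp_bij_inv surj_f_inv_f surj)
  qed
  note bb = this
  have "det A = (\<Sum>p | p permutes UNIV. of_int (sign (?c p)) * (\<Prod>i\<in>UNIV. A $ i $ ?c p i))"
    unfolding det_def by (rule sum.reindex_bij_betw[OF bb, symmetric])
  also have "\<dots> = det (\<chi> i j. A $ \<pi> i $ \<pi> j)"
    unfolding det_def
  proof (rule sum.cong[OF refl], goal_cases)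
    case (1 p)
    then have p: "p permutes UNIV" by simp
    have "sign (?c p) = sign p" using p inj by (simp add: sign_map_permutation)
    moreover have "(\<Prod>i\<in>UNIV. A $ i $ ?c p i) = (\<Prod>i\<in>UNIV. A $ \<pi> i $ ?c p (\<pi> i))"
      by (rule prod.reindex_bij_betw[OF assms, symmetric])
    ultimately show ?case using inj by (simp add: map_permutation_apply)
  qed
  finally show ?thesis ..
qed

definition reindex :: "('m \<Rightarrow> 'n) \<Rightarrow> real^'n \<Rightarrow> real^'m" where
  "reindex \<pi> x = (\<chi> i. x $ \<pi> i)"

lemma reindex_nth [simp]: "reindex \<pi> x $ i = x $ \<pi> i"
  by (simp add: reindex_def)

lemma linear_reindex: "linear (reindex (\<pi> :: 'm::finite \<Rightarrow> 'n::finite))"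
  by (auto intro!: linearI simp: vec_eq_iff)

lemma reindex_reindex_inv:
  assumes "bij \<pi>"
  shows "reindex \<pi> (reindex (inv \<pi>) x) = x" "reindex (inv \<pi>) (reindex \<pi> y) = y"
  using assms by (auto simp: vec_eq_iff bij_is_inj inv_f_f surj_f_inv_f[OF bij_is_surj])

lemma measurable_reindex [measurable]:
  "reindex (\<pi> :: 'm::finite \<Rightarrow> 'n::finite) \<in> borel \<rightarrow>\<^sub>M borel"
  by (intro borel_measurable_continuous_onI linear_continuous_on linear_conv_bounded_linear[THEN iffD1] linear_reindex)

lemma prod_Basis_vec: "(\<Prod>b\<in>Basis. f (x \<bullet> b)) = (\<Prod>i\<in>UNIV. f (x $ i))" for x :: "real^'n"
proof -
  have "bij_betw (\<lambda>i. axis i 1) (UNIV :: 'n set) (Basis :: (real^'n) set)"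
    by (auto simp: bij_betw_def inj_on_def axis_eq_axis Basis_vec_def)
  from prod.reindex_bij_betw[OF this, of "\<lambda>b. f (x \<bullet> b)"] show ?thesis
    by (simp add: inner_axis)
qed

text \<open>
  Renaming coordinates maps boxes to boxes with the same side lengths.
\<close>

lemma lborel_distr_reindex:
  fixes \<pi> :: "'m::finite \<Rightarrow> 'n::finite"
  assumes "bij \<pi>"
  shows "distr lborel borel (reindex \<pi>) = lborel"
proof (rule lborel_eqI[symmetric])
  fix l u :: "real^'m"
  assume le: "\<And>b. b \<in> Basis \<Longrightarrow> l \<bullet> b \<le> u \<bullet> b"
  have le': "l $ i \<le> u $ i" for i
    using le[of "axis i 1"] by (simp add: inner_axis)
  have pre: "reindex \<pi> -` box l u = box (reindex (inv \<pi>) l) (reindex (inv \<pi>) u)"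
    using assms
    by (auto simp: mem_box_cart) (metis bij_is_inj inv_f_f bij_is_surj surj_f_inv_f)+
  have "emeasure (distr lborel borel (reindex \<pi>)) (box l u)
      = emeasure lborel (box (reindex (inv \<pi>) l) (reindex (inv \<pi>) u))"
    by (simp add: emeasure_distr pre)
  also have "\<dots> = (\<Prod>b\<in>Basis. (reindex (inv \<pi>) u - reindex (inv \<pi>) l) \<bullet> b)"
    by (rule emeasure_lborel_box) (auto simp: Basis_vec_def inner_axis le')
  also have "\<dots> = (\<Prod>i\<in>UNIV. (u - l) $ inv \<pi> i)"
    by (simp add: prod_Basis_vec[of "\<lambda>t. t"])
  also have "\<dots> = (\<Prod>i\<in>UNIV. (u - l) $ i)"
    by (rule arg_cong[OF prod.reindex_bij_betw[OF bij_imp_bij_inv[OF assms]]])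
  finally show "emeasure (distr lborel borel (reindex \<pi>)) (box l u) = (\<Prod>b\<in>Basis. (u - l) \<bullet> b)"
    by (simp add: prod_Basis_vec[of "\<lambda>t. t"])
qed simp

text \<open>
  The integrand is lifted to \<open>real^1\<close>, the form in which the vector-valued library theorem applies, and
  the Henstock--Kurzweil integrals are turned into Lebesgue integrals of nonnegative functions.
\<close>

lemma nn_integral_change_of_variables_wellorder:
  fixes f :: "real^'m::{finite,wellorder} \<Rightarrow> real" and g :: "real^'m::_ \<Rightarrow> real^'m::_"
  assumes S: "S \<in> sets borel" and gS: "g ` S \<in> sets borel"
    and der: "\<And>x. x \<in> S \<Longrightarrow> (g has_derivative g' x) (at x within S)"
    and inj: "inj_on g S"
    and f: "integrable lborel f" "\<And>y. 0 \<le> f y"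
    and meas: "(\<lambda>x. \<bar>det (matrix (g' x))\<bar> * f (g x)) \<in> borel_measurable borel"
  shows "(\<integral>\<^sup>+x\<in>S. ennreal (\<bar>det (matrix (g' x))\<bar> * f (g x)) \<partial>lborel) = (\<integral>\<^sup>+y\<in>g ` S. ennreal (f y) \<partial>lborel)"
proof -
  let ?D = "\<lambda>x. \<bar>det (matrix (g' x))\<bar> * f (g x)"
  have "integrable lborel (\<lambda>x. indicator (g ` S) x *\<^sub>R f x)"
    using f gS by (intro integrable_mult_indicator) auto
  then have i1: "f absolutely_integrable_on (g ` S)"
    unfolding set_integrable_def by (simp add: integrable_completion)
  have "(\<lambda>x. \<bar>det (matrix (g' x))\<bar> *\<^sub>R vec (f (g x)) :: real^1) absolutely_integrable_on S \<and>
        integral S (\<lambda>x. \<bar>det (matrix (g' x))\<bar> *\<^sub>R vec (f (g x))) = (vec (integral (g ` S) f) :: real^1)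
    \<longleftrightarrow> (\<lambda>y. vec (f y) :: real^1) absolutely_integrable_on (g ` S) \<and>
        integral (g ` S) (\<lambda>y. vec (f y)) = (vec (integral (g ` S) f) :: real^1)"
    using S by (intro has_absolute_integral_change_of_variables[OF _ der inj]) auto
  then have i3: "?D absolutely_integrable_on S" and eq': "integral S ?D = integral (g ` S) f"
    using i1 by (auto simp: absolutely_integrable_on_1_iff integral_on_1_eq)
  have conv: "(\<integral>\<^sup>+x\<in>A. ennreal (h x) \<partial>lborel) = ennreal (integral A h)"
    if "h absolutely_integrable_on A" "\<And>x. 0 \<le> h x" "h \<in> borel_measurable borel" "A \<in> sets borel" for h A
  proof -
    have "(\<integral>\<^sup>+x\<in>A. ennreal (h x) \<partial>lborel) = (\<integral>\<^sup>+x. ennreal (indicator A x *\<^sub>R h x) \<partial>lborel)"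
      by (auto intro!: nn_integral_cong simp: indicator_def)
    also have "\<dots> = (\<integral>\<^sup>+x. ennreal (indicator A x *\<^sub>R h x) \<partial>lebesgue)"
      by (simp add: nn_integral_completion)
    also have "\<dots> = ennreal (LINT x:A|lebesgue. h x)"
      unfolding set_lebesgue_integral_def using that
      by (intro nn_integral_eq_integral) (auto simp: set_integrable_def)
    finally show ?thesis using that by (simp add: set_lebesgue_integral_eq_integral)
  qed
  show ?thesis
    using conv[OF i3 _ meas S] conv[OF i1 _ _ gS] f eq' by auto
qed

text \<open>
  With \<open>T\<close> the renaming of coordinates, \<open>T \<circ> g \<circ> T\<^sup>-\<^sup>1\<close> is a map between spaces with well-ordered
  coordinates; \<open>T\<close> preserves Lebesgue measure, and the Jacobian determinants agree by \<open>det_reindex\<close>.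
\<close>

theorem nn_integral_change_of_variables:
  fixes f :: "real^'n \<Rightarrow> real" and g :: "real^'n \<Rightarrow> real^'n"
  assumes S: "S \<in> sets borel" and gS: "g ` S \<in> sets borel"
    and der: "\<And>x. x \<in> S \<Longrightarrow> (g has_derivative g' x) (at x within S)"
    and inj: "inj_on g S"
    and f: "integrable lborel f" "\<And>y. 0 \<le> f y"
    and meas: "(\<lambda>x. \<bar>det (matrix (g' x))\<bar> * f (g x)) \<in> borel_measurable borel"
  shows "(\<integral>\<^sup>+x\<in>S. ennreal (\<bar>det (matrix (g' x))\<bar> * f (g x)) \<partial>lborel)
       = (\<integral>\<^sup>+y\<in>g ` S. ennreal (f y) \<partial>lborel)"
proof -
  obtain \<pi> :: "'n ordinal_index \<Rightarrow> 'n" where \<pi>: "bij \<pi>"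
    using ex_bij_ordinal_index by blast
  define T where "T = reindex \<pi>"
  define U where "U = reindex (inv \<pi>)"
  have TU [simp]: "T (U y) = y" and UT [simp]: "U (T x) = x" for x y
    using reindex_reindex_inv[OF \<pi>] by (simp_all add: T_def U_def)
  have [measurable]: "T \<in> borel \<rightarrow>\<^sub>M borel" "U \<in> borel \<rightarrow>\<^sub>M borel"
    by (simp_all add: T_def U_def)
  have blT: "bounded_linear T" and blU: "bounded_linear U"
    by (simp_all add: T_def U_def linear_reindex linear_linear flip: linear_conv_bounded_linear)
  have dT: "distr lborel borel T = lborel" and dU: "distr lborel borel U = lborel"
    using \<pi> by (auto simp: T_def U_def intro!: lborel_distr_reindex bij_imp_bij_inv)
  have im: "T ` A = U -` A" for A
    by (auto simp: image_iff) (metis TU)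
  define G where "G y = T (g (U y))" for y
  define G' where "G' y h = T (g' (U y) (U h))" for y h
  have GT: "G ` T ` S = T ` g ` S"
    by (auto simp: G_def image_image)
  have detG: "det (matrix (G' y)) = det (matrix (g' (U y)))" for y
  proof -
    have "U (axis j 1) = axis (\<pi> j) 1" for j
      using \<pi> by (auto simp: U_def vec_eq_iff axis_def bij_is_inj surj_f_inv_f[OF bij_is_surj])
    then have "matrix (G' y) $ i $ j = matrix (g' (U y)) $ \<pi> i $ \<pi> j" for i j
      by (simp add: matrix_def G'_def T_def)
    then have "matrix (G' y) = (\<chi> i j. matrix (g' (U y)) $ \<pi> i $ \<pi> j)"
      by (simp add: vec_eq_iff)
    then show ?thesis
      using det_reindex[OF \<pi>] by simp
  qed
  have tr: "(\<integral>\<^sup>+x\<in>A. h x \<partial>lborel) = (\<integral>\<^sup>+y\<in>T ` A. h (U y) \<partial>lborel)"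
    if [measurable]: "h \<in> borel_measurable borel" "A \<in> sets borel" for h :: "_ \<Rightarrow> ennreal" and A
  proof -
    have "(\<integral>\<^sup>+x\<in>A. h x \<partial>lborel) = (\<integral>\<^sup>+x. h x * indicator A x \<partial>distr lborel borel U)"
      by (simp add: dU)
    also have "\<dots> = (\<integral>\<^sup>+y. h (U y) * indicator A (U y) \<partial>lborel)"
      by (rule nn_integral_distr) auto
    finally show ?thesis by (simp add: im indicator_def)
  qed
  have "(\<integral>\<^sup>+x\<in>S. ennreal (\<bar>det (matrix (g' x))\<bar> * f (g x)) \<partial>lborel)
      = (\<integral>\<^sup>+y\<in>T ` S. ennreal (\<bar>det (matrix (g' (U y)))\<bar> * f (g (U y))) \<partial>lborel)"
    using S meas by (intro tr) auto
  also have "\<dots> = (\<integral>\<^sup>+y\<in>T ` S. ennreal (\<bar>det (matrix (G' y))\<bar> * f (U (G y))) \<partial>lborel)"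
    by (simp add: detG G_def)
  also have "\<dots> = (\<integral>\<^sup>+y\<in>G ` T ` S. ennreal (f (U y)) \<partial>lborel)"
  proof (rule nn_integral_change_of_variables_wellorder)
    show "T ` S \<in> sets borel"
      unfolding im by (rule measurable_sets_borel[OF _ S]) measurable
    show "G ` T ` S \<in> sets borel"
      unfolding GT im[of "g ` S"] by (rule measurable_sets_borel[OF _ gS]) measurable
    show "(G has_derivative G' y) (at y within T ` S)" if y: "y \<in> T ` S" for y
    proof -
      have Uy: "U y \<in> S" and US: "U ` T ` S = S" using y by (auto simp: image_image)
      have 1: "(U has_derivative U) (at y within T ` S)"
        using blU by (rule bounded_linear_imp_has_derivative)
      have 2: "((\<lambda>y. g (U y)) has_derivative (\<lambda>h. g' (U y) (U h))) (at y within T ` S)"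
        by (rule has_derivative_in_compose[OF 1]) (use der[OF Uy] US in simp)
      show ?thesis
        unfolding G_def G'_def using bounded_linear.has_derivative[OF blT 2] by simp
    qed
    show "inj_on G (T ` S)"
      by (auto simp: inj_on_def G_def) (metis UT inj inj_onD)
    show "integrable lborel (\<lambda>x. f (U x))"
      using f(1) integrable_distr_eq[of U lborel borel f] by (simp add: dU)
    have "(\<lambda>y. \<bar>det (matrix (g' (U y)))\<bar> * f (g (U y))) \<in> borel_measurable borel"
      using meas by measurable
    then show "(\<lambda>x. \<bar>det (matrix (G' x))\<bar> * f (U (G x))) \<in> borel_measurable borel"
      by (simp add: detG G_def)
  qed (use f in auto)
  also have "\<dots> = (\<integral>\<^sup>+y\<in>g ` S. ennreal (f y) \<partial>lborel)"
    unfolding GT using f gS by (intro tr[symmetric]) auto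
  finally show ?thesis .
qed

section \<open>A smooth bump function\<close>

text \<open>
  The functions \<open>p(t) (1 - t\<^sup>2)\<^sup>-\<^sup>k exp (-1 / (1 - t\<^sup>2))\<close>, extended by zero, form a class that is closed
  under differentiation; \<open>bump_step\<close> computes the data \<open>(p, k)\<close> of the derivative by the product rule.
\<close>

definition bump_shape :: "real poly \<times> nat \<Rightarrow> real \<Rightarrow> real" where
  "bump_shape = (\<lambda>(p, k) t. if \<bar>t\<bar> < 1 then poly p t / (1 - t\<^sup>2) ^ k * exp (- 1 / (1 - t\<^sup>2)) else 0)"

definition bump_step :: "real poly \<times> nat \<Rightarrow> real poly \<times> nat" where
  "bump_step = (\<lambda>(p, k). (pderiv p * [:1, 0, -1:]\<^sup>2 + [:0, 2 * real k:] * [:1, 0, -1:] * p - [:0, 2:] * p, k + 2))"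

lemma power_le_fact_exp: "0 \<le> v \<Longrightarrow> v ^ m \<le> fact m * exp (v :: real)"
proof -
  assume v: "0 \<le> v"
  have "(\<Sum>n\<in>{m}. v ^ n /\<^sub>R fact n) \<le> exp v"
    unfolding exp_def using v by (intro sum_le_suminf summable_exp_generic) auto
  then show ?thesis by (simp add: field_simps)
qed

text \<open>
  With \<open>u = 1 - t\<^sup>2\<close>, the exponential decay of \<open>exp (-1 / u)\<close> beats every power of \<open>1 / u\<close>. A quadratic bound
  suffices to obtain differentiability, with derivative zero, at the boundary points.
\<close>

lemma bump_shape_quadratic_bound:
  "\<exists>C\<ge>0. \<forall>s. \<bar>bump_shape pk s\<bar> \<le> C * (max 0 (1 - s\<^sup>2))\<^sup>2"
proof -
  obtain p k where pk: "pk = (p, k)" by force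
  have "bounded (poly p ` {-1..1})"
    by (intro compact_imp_bounded compact_continuous_image) (auto intro!: continuous_intros)
  then obtain P where "\<forall>t\<in>{-1..1}. \<bar>poly p t\<bar> \<le> P"
    by (auto simp: bounded_iff)
  then have P: "\<And>t. t \<in> {-1..1} \<Longrightarrow> \<bar>poly p t\<bar> \<le> P" by blast
  have P0: "0 \<le> P" using P[of 0] by simp
  have "\<bar>bump_shape pk s\<bar> \<le> (P * fact (k + 2)) * (max 0 (1 - s\<^sup>2))\<^sup>2" for s
  proof (cases "\<bar>s\<bar> < 1")
    case True
    define u where "u = 1 - s\<^sup>2"
    have u: "0 < u" using True by (simp add: u_def abs_square_less_1)
    have "(1 / u) ^ (k + 2) \<le> fact (k + 2) * exp (1 / u)"
      using u by (intro power_le_fact_exp) auto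
    then have "exp (- 1 / u) / u ^ k \<le> fact (k + 2) * u\<^sup>2"
      using u by (simp add: field_simps exp_minus power_add power2_eq_square)
    then have "\<bar>poly p s\<bar> * (exp (- 1 / u) / u ^ k) \<le> P * (fact (k + 2) * u\<^sup>2)"
      by (rule mult_mono[rotated]) (use P[of s] P0 True u in \<open>auto simp: abs_less_iff\<close>)
    then show ?thesis
      using True u by (simp add: bump_shape_def pk u_def[symmetric] abs_mult algebra_simps)
  next
    case False
    then show ?thesis using P0 by (simp add: bump_shape_def pk)
  qed
  then show ?thesis using P0 by (intro exI[of _ "P * fact (k + 2)"]) auto
qed

lemma bump_shape_has_derivative:
  "(bump_shape pk has_real_derivative bump_shape (bump_step pk) t) (at t)"
proof (cases "\<bar>t\<bar> < 1")
  case True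
  obtain p k where pk: "pk = (p, k)" by force
  define u where "u = 1 - t\<^sup>2"
  have u: "u \<noteq> 0" using True by (auto simp: u_def abs_square_less_1 dest: abs_square_less_1[THEN iffD2])
  have dv: "((\<lambda>t. 1 / (1 - t\<^sup>2)) has_real_derivative 2 * t / u\<^sup>2) (at t)"
    using u by (auto intro!: derivative_eq_intros simp: u_def power2_eq_square)
  \<comment> \<open>The factor in front repairs the case where k is zero, in which the truncated
    exponent is wrong.\<close>
  have kv: "real k * (1 / u) ^ (k - Suc 0) = real k * u * (1 / u) ^ k"
    using u by (cases k) auto
  have "((\<lambda>t. poly p t * (1 / (1 - t\<^sup>2)) ^ k * exp (- (1 / (1 - t\<^sup>2)))) has_real_derivative
      (poly (pderiv p) t * (1 / u) ^ k + (real k * u * (1 / u) ^ k) * (2 * t / u\<^sup>2) * poly p t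
        - poly p t * (1 / u) ^ k * (2 * t / u\<^sup>2)) * exp (- (1 / u))) (at t)"
    by (rule DERIV_cong, rule DERIV_mult[OF DERIV_mult[OF poly_DERIV DERIV_power[OF dv]]
          DERIV_chain2[OF DERIV_exp DERIV_minus[OF dv]]])
       (simp only: kv[symmetric] u_def[symmetric], simp add: algebra_simps)
  also have "(poly (pderiv p) t * (1 / u) ^ k + (real k * u * (1 / u) ^ k) * (2 * t / u\<^sup>2) * poly p t
        - poly p t * (1 / u) ^ k * (2 * t / u\<^sup>2))
      = (poly (pderiv p) t * u\<^sup>2 + 2 * real k * t * u * poly p t - 2 * t * poly p t) / u ^ (k + 2)"
    using u by (simp add: field_simps power2_eq_square)
  also have "\<dots> * exp (- (1 / u)) = bump_shape (bump_step pk) t"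
    using True by (simp add: bump_shape_def bump_step_def pk u_def power2_eq_square algebra_simps)
  finally have "((\<lambda>t. poly p t / (1 - t\<^sup>2) ^ k * exp (- 1 / (1 - t\<^sup>2))) has_real_derivative
      bump_shape (bump_step pk) t) (at t)"
    by (simp add: power_one_over)
  then show ?thesis
  proof (rule has_field_derivative_transform_within_open[where S = "{-1<..<1}"])
  qed (use True in \<open>auto simp: bump_shape_def pk\<close>)
next
  case False
  obtain C where C: "C \<ge> 0" "\<And>s. \<bar>bump_shape pk s\<bar> \<le> C * (max 0 (1 - s\<^sup>2))\<^sup>2"
    using bump_shape_quadratic_bound by blast
  have f0: "bump_shape r t = 0" for r using False by (simp add: bump_shape_def split: prod.splits)
  have bd: "\<bar>bump_shape pk s\<bar> \<le> 4 * C * \<bar>s - t\<bar>\<^sup>2" for s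
  proof -
    have "max 0 (1 - s\<^sup>2) \<le> 2 * \<bar>s - t\<bar>"
    proof (cases "\<bar>s\<bar> < 1")
      case True
      have "1 - s\<^sup>2 = (1 - \<bar>s\<bar>) * (1 + \<bar>s\<bar>)" by (simp add: algebra_simps power2_eq_square)
      also have "\<dots> \<le> \<bar>s - t\<bar> * 2" using True False by (intro mult_mono) auto
      finally show ?thesis by simp
    next
      case f: False
      then have "1 \<le> s\<^sup>2" by (simp add: abs_square_less_1 flip: not_less)
      then show ?thesis by simp
    qed
    then have "(max 0 (1 - s\<^sup>2))\<^sup>2 \<le> (2 * \<bar>s - t\<bar>)\<^sup>2" by (intro power_mono) auto
    from order_trans[OF C(2) mult_left_mono[OF this C(1)]] show ?thesis
      by (simp add: power_mult_distrib)
  qed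
  have "((\<lambda>s. (bump_shape pk s - bump_shape pk t) / (s - t)) \<longlongrightarrow> 0) (at t)"
  proof (rule Lim_null_comparison)
    show "\<forall>\<^sub>F s in at t. norm ((bump_shape pk s - bump_shape pk t) / (s - t)) \<le> 4 * C * \<bar>s - t\<bar>"
    proof (rule always_eventually, rule allI)
      fix s
      show "norm ((bump_shape pk s - bump_shape pk t) / (s - t)) \<le> 4 * C * \<bar>s - t\<bar>"
        using bd[of s] by (cases "s = t") (auto simp: f0 divide_le_eq power2_eq_square mult.assoc simp del: abs_mult_self_eq)
    qed
    show "((\<lambda>s. 4 * C * \<bar>s - t\<bar>) \<longlongrightarrow> 0) (at t)"
      by (auto intro!: tendsto_eq_intros)
  qed
  then show ?thesis by (simp add: has_field_derivative_iff f0)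
qed

definition bump :: "nat \<Rightarrow> real \<Rightarrow> real" where
  "bump n = bump_shape ((bump_step ^^ n) (1, 0))"

lemma bump_has_derivative: "(bump n has_real_derivative bump (Suc n) t) (at t)"
  unfolding bump_def by (simp add: bump_shape_has_derivative)

lemma bump_eq_0: "1 \<le> \<bar>t\<bar> \<Longrightarrow> bump n t = 0"
  by (auto simp: bump_def bump_shape_def split: prod.splits)

lemma bump_0: "0 \<le> bump 0 t" "\<bar>t\<bar> < 1 \<Longrightarrow> 0 < bump 0 t"
  by (auto simp: bump_def bump_shape_def)

lemma bump_bounded: "\<exists>C\<ge>0. \<forall>t. \<bar>bump n t\<bar> \<le> C"
proof -
  obtain C where C: "C \<ge> 0" "\<And>s. \<bar>bump n s\<bar> \<le> C * (max 0 (1 - s\<^sup>2))\<^sup>2"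
    using bump_shape_quadratic_bound unfolding bump_def by blast
  have "(max 0 (1 - s\<^sup>2))\<^sup>2 \<le> 1\<^sup>2" for s :: real
    by (intro power_mono) auto
  then have "\<bar>bump n s\<bar> \<le> C" for s
    using C(2)[of s] mult_left_mono[of "(max 0 (1 - s\<^sup>2))\<^sup>2" 1 C] C(1) by force
  with C(1) show ?thesis by blast
qed

text \<open>
  A tensor product of one-dimensional bumps, in which the \<open>i\<close>-th factor is differentiated \<open>m i\<close> times. So
  \<open>bump_vec m\<close> is the partial derivative of multi-index \<open>m\<close> of \<open>bump_vec (\<lambda>_. 0)\<close>.
\<close>

definition bump_vec :: "('n::finite \<Rightarrow> nat) \<Rightarrow> real^'n \<Rightarrow> real" where
  "bump_vec m x = (\<Prod>i\<in>UNIV. bump (m i) (x $ i))"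

lemma bump_vec_has_derivative:
  "(bump_vec m has_derivative (\<lambda>h. \<Sum>i\<in>UNIV. h $ i * bump_vec (m(i := Suc (m i))) x)) (at x)"
proof -
  have eq: "bump_vec (m(i := Suc (m i))) x = bump (Suc (m i)) (x $ i) * (\<Prod>j\<in>UNIV - {i}. bump (m j) (x $ j))" for i
    unfolding bump_vec_def by (subst prod.remove[of _ i]) (auto intro!: prod.cong)
  have e: "((\<lambda>x. bump (m i) (x $ i)) has_derivative (\<lambda>h. bump (Suc (m i)) (x $ i) * h $ i)) (at x)" for i
    using has_derivative_compose[OF bounded_linear_imp_has_derivative[OF bounded_linear_vec_nth[of i]]
        bump_has_derivative[unfolded has_field_derivative_def]]
    by simp
  from has_derivative_prod[OF e, where I = UNIV]
  have "(bump_vec m has_derivative (\<lambda>y. \<Sum>i\<in>UNIV. bump (Suc (m i)) (x $ i) * y $ i *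
      (\<Prod>j\<in>UNIV - {i}. bump (m j) (x $ j)))) (at x)"
    by (simp add: bump_vec_def[abs_def])
  then show ?thesis by (simp only: eq ac_simps)
qed

lemma continuous_on_bump_vec: "continuous_on A (bump_vec m)"
  by (meson bump_vec_has_derivative continuous_at_imp_continuous_on has_derivative_continuous)

lemma bump_vec_eq_0: "sqrt (CARD('n::finite)) \<le> norm x \<Longrightarrow> bump_vec m (x :: real^'n) = 0"
proof (rule ccontr)
  assume n: "sqrt (CARD('n)) \<le> norm x" and "bump_vec m x \<noteq> 0"
  then have "\<bar>x $ i\<bar> < 1" for i
    by (auto simp: bump_vec_def) (metis bump_eq_0 not_le)
  then have "(x $ i)\<^sup>2 < 1" for i by (simp add: abs_square_less_1)
  then have "(\<Sum>i\<in>UNIV. (x $ i)\<^sup>2) < (\<Sum>i\<in>(UNIV :: 'n set). 1)"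
    by (intro sum_strict_mono) auto
  then have "norm x < sqrt (CARD('n))"
    by (simp add: norm_vec_def L2_set_def)
  with n show False by simp
qed

lemma bump_vec_bounded: "\<exists>C\<ge>0. \<forall>x. \<bar>bump_vec m x\<bar> \<le> C"
proof -
  obtain C where C: "\<And>n. C n \<ge> 0" "\<And>n t. \<bar>bump n t\<bar> \<le> C n" using bump_bounded by metis
  have "\<bar>bump_vec m x\<bar> \<le> (\<Prod>i\<in>UNIV. C (m i))" for x
    unfolding bump_vec_def abs_prod by (intro prod_mono) (auto simp: C)
  moreover have "(\<Prod>i\<in>UNIV. C (m i)) \<ge> 0" by (intro prod_nonneg) (auto simp: C)
  ultimately show ?thesis by blast
qed

lemma bump_vec_nonneg: "0 \<le> bump_vec (\<lambda>_. 0) x"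
  by (auto simp: bump_vec_def intro!: prod_nonneg bump_0)

lemma iterated_partial_bump_vec:
  "iterated_partial is (\<lambda>z. bump_vec (\<lambda>_. 0) (s *\<^sub>R (z - x)))
     = (\<lambda>z. s ^ length is * bump_vec (count_list is) (s *\<^sub>R (z - x)))"
proof (induction "is")
  case (Cons i "is")
  let ?m = "count_list is"
  have "((\<lambda>z. s ^ length is * bump_vec ?m (s *\<^sub>R (z - x))) has_derivative
      (\<lambda>h. s ^ length is * (\<Sum>j\<in>UNIV. (s *\<^sub>R h) $ j * bump_vec (?m(j := Suc (?m j))) (s *\<^sub>R (z - x))))) (at z)" for z
    by (rule has_derivative_mult_right, rule has_derivative_compose[OF _ bump_vec_has_derivative])
       (auto intro!: derivative_eq_intros)
  note d = frechet_derivative_at[OF this, symmetric]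
  have m: "?m(i := Suc (?m i)) = count_list (i # is)" by (auto simp: fun_eq_iff)
  have "(\<Sum>j\<in>UNIV. (s *\<^sub>R axis i 1) $ j * bump_vec (?m(j := Suc (?m j))) y) = s * bump_vec (count_list (i # is)) y" for y
    by (subst sum.remove[of _ i]) (auto simp: axis_def m[symmetric])
  then show ?case
    by (simp only: iterated_partial.simps Cons.IH partial_def d length_Cons power_Suc ac_simps)
next
  case Nil
  have "count_list [] = (\<lambda>_::'n. 0)" by (simp add: fun_eq_iff)
  then show ?case by (simp only: iterated_partial.simps) simp
qed

lemma test_function_bump_vec:
  fixes x :: "real^'n"
  assumes "s \<noteq> 0"
  shows "test_function (\<lambda>z. bump_vec (\<lambda>_. 0) (s *\<^sub>R (z - x)))"
  unfolding test_function_def iterated_partial_bump_vec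
proof safe
  fix "is" :: "'n list" and z
  have "(\<lambda>z. bump_vec (count_list is) (s *\<^sub>R (z - x))) differentiable at z"
    by (rule differentiable_compose[of "bump_vec (count_list is)"])
       (auto intro!: derivative_intros differentiableI[OF bump_vec_has_derivative])
  then show "(\<lambda>z. s ^ length is * bump_vec (count_list is) (s *\<^sub>R (z - x))) differentiable at z"
    by (intro differentiable_mult) auto
next
  have "{z. bump_vec (\<lambda>_. 0) (s *\<^sub>R (z - x)) \<noteq> 0} \<subseteq> cball x (sqrt (CARD('n)) / \<bar>s\<bar>)"
  proof clarsimp
    fix z assume "bump_vec (\<lambda>_. 0) (s *\<^sub>R (z - x)) \<noteq> 0"
    then have "norm (s *\<^sub>R (z - x)) < sqrt (CARD('n))" using bump_vec_eq_0 not_le by blast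
    then show "dist x z \<le> sqrt (CARD('n)) / \<bar>s\<bar>"
      using assms unfolding norm_scaleR
      by (simp add: dist_norm norm_minus_commute pos_le_divide_eq mult.commute)
  qed
  then show "compact (closure {z. bump_vec (\<lambda>_. 0) (s *\<^sub>R (z - x)) \<noteq> 0})"
    by (meson bounded_cball bounded_subset compact_closure)
qed

lemma integrable_bump_vec:
  assumes "0 < s"
  shows "integrable lborel (\<lambda>v. bump_vec m (s *\<^sub>R v) :: real)"
proof -
  let ?K = "cball (0 :: real^'n) (sqrt (CARD('n)) / s)"
  have "integrable lborel (\<lambda>v. indicator ?K v *\<^sub>R (bump_vec m (s *\<^sub>R v) :: real))"
    by (rule borel_integrable_compact)
       (auto intro!: continuous_on_compose2[OF continuous_on_bump_vec] continuous_intros)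
  also have "(\<lambda>v. indicator ?K v *\<^sub>R (bump_vec m (s *\<^sub>R v) :: real)) = (\<lambda>v. bump_vec m (s *\<^sub>R v))"
    using assms by (auto simp: fun_eq_iff indicator_def pos_less_divide_eq not_le mult.commute
        pos_divide_less_eq intro!: bump_vec_eq_0)
  finally show ?thesis .
qed

text \<open>
  The normalising constant of the mollifier at scale \<open>1 / s\<close>. As an integral for each \<open>s\<close> it cancels
  directly in the estimates, without the scaling law of Lebesgue measure.
\<close>

definition bump_mass :: "'n::finite itself \<Rightarrow> real \<Rightarrow> real" where
  "bump_mass _ s = (\<integral>v. bump_vec (\<lambda>_. 0) (s *\<^sub>R (v :: real^'n)) \<partial>lborel)"

lemma bump_mass_pos:
  assumes s: "0 < s"
  shows "0 < bump_mass TYPE('n::finite) s"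
proof -
  let ?b = "\<lambda>v :: real^'n. bump_vec (\<lambda>_. 0) (s *\<^sub>R v)"
  have pos: "0 < ?b v" if "v \<in> ball 0 (1 / s)" for v
  proof -
    have "norm (s *\<^sub>R v) < 1" using that s by (simp add: field_simps)
    then have "\<bar>(s *\<^sub>R v) $ i\<bar> < 1" for i
      using component_le_norm_cart[of "s *\<^sub>R v" i] by linarith
    then show ?thesis by (auto simp: bump_vec_def intro!: prod_pos bump_0)
  qed
  have "\<not> (AE v in lborel. ?b v = 0)"
  proof
    assume "AE v in lborel. ?b v = 0"
    then have "AE v in lborel. v \<notin> ball (0 :: real^'n) (1 / s)"
      by (rule AE_mp) (use pos in \<open>fastforce intro!: AE_I2\<close>)
    then have "emeasure lborel (ball (0 :: real^'n) (1 / s)) = 0"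
      by (subst (asm) AE_iff_measurable[where N = "ball 0 (1 / s)"]) auto
    then have "measure lborel (ball (0 :: real^'n) (1 / s)) = 0"
      by (simp add: measure_def)
    then show False
      using content_ball_gt_0_iff[of "0 :: real^'n" "1 / s"] s by simp
  qed
  then have "(\<integral>v. ?b v \<partial>lborel) \<noteq> 0"
    using s by (subst integral_nonneg_eq_0_iff_AE) (auto simp: bump_vec_nonneg integrable_bump_vec)
  moreover have "0 \<le> (\<integral>v. ?b v \<partial>lborel)"
    by (simp add: bump_vec_nonneg)
  ultimately show ?thesis by (simp add: bump_mass_def)
qed

lemma bump_vec_lipschitz: "\<exists>L\<ge>0. \<forall>x y. \<bar>bump_vec m x - bump_vec m y\<bar> \<le> L * norm (x - y)"
proof -
  obtain C where C: "\<And>m :: 'a \<Rightarrow> nat. C m \<ge> 0" "\<And>(m :: 'a \<Rightarrow> nat) x. \<bar>bump_vec m x\<bar> \<le> C m"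
    using bump_vec_bounded by metis
  let ?L = "\<Sum>i\<in>UNIV. C (m(i := Suc (m i)))"
  have on: "onorm (\<lambda>h. \<Sum>i\<in>UNIV. h $ i * bump_vec (m(i := Suc (m i))) x) \<le> ?L" for x
  proof (rule onorm_le)
    fix h :: "real^'a"
    have "norm (\<Sum>i\<in>UNIV. h $ i * bump_vec (m(i := Suc (m i))) x)
        \<le> (\<Sum>i\<in>UNIV. norm h * C (m(i := Suc (m i))))"
      by (rule sum_norm_le) (auto simp: abs_mult component_le_norm_cart C intro!: mult_mono)
    then show "norm (\<Sum>i\<in>UNIV. h $ i * bump_vec (m(i := Suc (m i))) x) \<le> ?L * norm h"
      by (simp add: sum_distrib_left mult.commute)
  qed
  have "\<bar>bump_vec m x - bump_vec m y\<bar> \<le> ?L * norm (x - y)" for x y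
    using differentiable_bound[of UNIV "bump_vec m", OF convex_UNIV bump_vec_has_derivative on, of x y] by simp
  moreover have "?L \<ge> 0" by (intro sum_nonneg C)
  ultimately show ?thesis by blast
qed

text \<open>
  First-order Taylor expansion with a remainder that is uniform in the base point, since all second
  partial derivatives are bounded. This is what permits differentiation under the integral sign in
  \<open>mollify_has_derivative\<close>.
\<close>

lemma bump_vec_taylor:
  "\<exists>C\<ge>0. \<forall>y h. \<bar>bump_vec m (y + h) - bump_vec m y - (\<Sum>i\<in>UNIV. h $ i * bump_vec (m(i := Suc (m i))) y)\<bar>
      \<le> C * (norm h)\<^sup>2"
proof -
  obtain L where L: "\<And>m :: 'a \<Rightarrow> nat. L m \<ge> 0"
      "\<And>(m :: 'a \<Rightarrow> nat) x y. \<bar>bump_vec m x - bump_vec m y\<bar> \<le> L m * norm (x - y)"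
    using bump_vec_lipschitz by metis
  let ?b = "\<lambda>i. bump_vec (m(i := Suc (m i)))"
  let ?C = "\<Sum>i\<in>UNIV. L (m(i := Suc (m i)))"
  have C0: "?C \<ge> 0" by (intro sum_nonneg L)
  have "\<bar>bump_vec m (y + h) - bump_vec m y - (\<Sum>i\<in>UNIV. h $ i * ?b i y)\<bar> \<le> ?C * (norm h)\<^sup>2" for y h
  proof -
    have "norm (bump_vec m (y + h) - bump_vec m y - (\<Sum>i\<in>UNIV. (y + h - y) $ i * ?b i y))
        \<le> norm (y + h - y) * (?C * norm h)"
    proof (rule differentiable_bound_linearization[of y "y + h" "cball y (norm h)" "bump_vec m"
          "\<lambda>x h. \<Sum>i\<in>UNIV. h $ i * ?b i x"])
      show "y + t *\<^sub>R (y + h - y) \<in> cball y (norm h)" if "t \<in> {0..1}" for t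
        using that by (auto simp: dist_norm intro: mult_left_le_one_le)
      show "onorm ((\<lambda>h. \<Sum>i\<in>UNIV. h $ i * ?b i x) - (\<lambda>h. \<Sum>i\<in>UNIV. h $ i * ?b i y)) \<le> ?C * norm h"
        if x: "x \<in> cball y (norm h)" for x
      proof (rule onorm_le)
        fix k :: "real^'a"
        have "norm ((\<Sum>i\<in>UNIV. k $ i * ?b i x) - (\<Sum>i\<in>UNIV. k $ i * ?b i y))
            = norm (\<Sum>i\<in>UNIV. k $ i * (?b i x - ?b i y))"
          by (simp add: sum_subtractf[symmetric] algebra_simps)
        also have "\<dots> \<le> (\<Sum>i\<in>UNIV. norm k * (L (m(i := Suc (m i))) * norm h))"
        proof (rule sum_norm_le)
          fix i
          have "\<bar>?b i x - ?b i y\<bar> \<le> L (m(i := Suc (m i))) * norm (x - y)" by (rule L)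
          also have "\<dots> \<le> L (m(i := Suc (m i))) * norm h"
            using x by (intro mult_left_mono L) (auto simp: dist_norm norm_minus_commute)
          finally show "norm (k $ i * (?b i x - ?b i y)) \<le> norm k * (L (m(i := Suc (m i))) * norm h)"
            unfolding real_norm_def abs_mult by (intro mult_mono) (auto simp: component_le_norm_cart)
        qed
        also have "\<dots> = ?C * norm h * norm k"
          by (simp add: sum_distrib_left sum_distrib_right ac_simps)
        finally show "norm (((\<lambda>h. \<Sum>i\<in>UNIV. h $ i * ?b i x) - (\<lambda>h. \<Sum>i\<in>UNIV. h $ i * ?b i y)) k)
            \<le> ?C * norm h * norm k" by simp
      qed
    qed (auto intro: has_derivative_at_withinI[OF bump_vec_has_derivative])
    then show ?thesis by (simp add: power2_eq_square ac_simps)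
  qed
  with C0 show ?thesis by blast
qed

section \<open>Mollification\<close>

lemma nn_integral_translate:
  fixes h :: "'a::euclidean_space \<Rightarrow> ennreal"
  assumes [measurable]: "h \<in> borel_measurable borel"
  shows "(\<integral>\<^sup>+x. h (x + w) \<partial>lborel) = (\<integral>\<^sup>+x. h x \<partial>lborel)"
proof -
  have "(\<integral>\<^sup>+x. h x \<partial>lborel) = (\<integral>\<^sup>+x. h x \<partial>distr lborel borel ((+) w))"
    by (simp add: lborel_distr_plus)
  also have "\<dots> = (\<integral>\<^sup>+x. h (w + x) \<partial>lborel)"
    by (rule nn_integral_distr) auto
  finally show ?thesis by (simp add: add.commute)
qed

lemma finite_measure_compact_open_approx:
  fixes A :: "'a::euclidean_space set"
  assumes A: "A \<in> sets borel" "emeasure lborel A < \<infinity>" and e: "0 < e"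
  obtains K U where "compact K" "open U" "K \<subseteq> A" "A \<subseteq> U" "emeasure lborel (U - K) \<le> ennreal e"
proof -
  obtain U where U: "open U" "A \<subseteq> U" "emeasure lborel (U - A) < ennreal (e / 3)"
    using outer_regular_lborel[OF A(1), of "e / 3"] e by auto
  \<comment> \<open>The complement of an outer approximation of the complement is an inner closed
    approximation.\<close>
  obtain V where V: "open V" "- A \<subseteq> V" "emeasure lborel (V - - A) < ennreal (e / 3)"
    using outer_regular_lborel[of "- A" "e / 3"] A e by auto
  have [measurable]: "A \<in> sets borel" "U \<in> sets borel" "V \<in> sets borel" using A U V by auto
  define B where "B n = A - cball 0 (real n)" for n :: nat
  have [measurable]: "B n \<in> sets borel" for n by (simp add: B_def)
  have "(\<lambda>n. emeasure lborel (B n)) \<longlonglongrightarrow> emeasure lborel (\<Inter>n. B n)"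
  proof (rule Lim_emeasure_decseq)
    show "decseq B" unfolding B_def by (intro antimonoI) auto
    show "emeasure lborel (B n) \<noteq> \<infinity>" for n
      using emeasure_mono[of "B n" A lborel] A by (auto simp: B_def top_unique less_top)
  qed auto
  moreover have "(\<Inter>n. B n) = {}"
    by (auto simp: B_def) (meson real_arch_simple)
  ultimately have "(\<lambda>n. emeasure lborel (B n)) \<longlonglongrightarrow> 0" by simp
  then have "\<forall>\<^sub>F n in sequentially. emeasure lborel (B n) < ennreal (e / 3)"
    using e by (intro order_tendstoD) auto
  then obtain n where n: "emeasure lborel (B n) < ennreal (e / 3)"
    by (auto simp: eventually_sequentially)
  define K where "K = - V \<inter> cball 0 (real n)"
  show thesis
  proof
    show "compact K" unfolding K_def using V by (intro closed_Int_compact) auto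
    show "K \<subseteq> A" using V by (auto simp: K_def)
    have [measurable]: "K \<in> sets borel" by (simp add: K_def)
    have "U - K \<subseteq> (U - A) \<union> (V - - A) \<union> B n" by (auto simp: K_def B_def)
    then have "emeasure lborel (U - K) \<le> emeasure lborel ((U - A) \<union> (V - - A) \<union> B n)"
      by (intro emeasure_mono) auto
    also have "\<dots> \<le> emeasure lborel (U - A) + emeasure lborel (V - - A) + emeasure lborel (B n)"
      by (intro order_trans[OF emeasure_subadditive] add_mono order_refl) auto
    also have "\<dots> \<le> ennreal (e / 3) + ennreal (e / 3) + ennreal (e / 3)"
      using U V n by (intro add_mono) auto
    also have "\<dots> = ennreal e" using e by (simp flip: ennreal_plus)
    finally show "emeasure lborel (U - K) \<le> ennreal e" .
  qed (use U in auto)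
qed

text \<open>
  By approximation it suffices to treat indicators of sets \<open>A\<close> of finite measure. If \<open>K \<subseteq> A \<subseteq> U\<close> with
  \<open>K\<close> compact and \<open>U\<close> open, then for \<open>w\<close> shorter than the distance from \<open>K\<close> to the complement of \<open>U\<close> the
  indicators of \<open>A\<close> at \<open>x\<close> and \<open>x + w\<close> can differ only if \<open>x\<close> or \<open>x + w\<close> lies in the small set \<open>U - K\<close>.
\<close>

lemma translation_continuous_L1:
  fixes f :: "'a::euclidean_space \<Rightarrow> 'b::{banach, second_countable_topology}"
  assumes "integrable lborel f"
  shows "\<forall>e>0. \<exists>\<delta>>0. \<forall>w. norm w < \<delta> \<longrightarrow> (\<integral>\<^sup>+x. ennreal (norm (f (x + w) - f x)) \<partial>lborel) \<le> ennreal e"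
  using assms
proof (induction rule: integrable_induct)
  case (base A c)
  then have [measurable]: "A \<in> sets borel" by simp
  show ?case
  proof (intro allI impI)
    fix e :: real assume e: "0 < e"
    define \<eta> where "\<eta> = e / (2 * norm c + 1)"
    have \<eta>: "0 < \<eta>" using e by (auto simp: \<eta>_def intro!: divide_pos_pos add_nonneg_pos)
    obtain K U where KU: "compact K" "open U" "K \<subseteq> A" "A \<subseteq> U" "emeasure lborel (U - K) \<le> ennreal \<eta>"
      using finite_measure_compact_open_approx[OF _ _ \<eta>, of A] base by auto
    have [measurable]: "K \<in> sets borel" "U \<in> sets borel" using KU by (auto simp: compact_imp_closed)
    obtain \<delta> where \<delta>: "\<delta> > 0" "(\<Union>x\<in>K. ball x \<delta>) \<subseteq> U"
      using compact_subset_open_imp_ball_epsilon_subset[of K U] KU by auto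
    have "(\<integral>\<^sup>+x. ennreal (norm (indicator A (x + w) *\<^sub>R c - indicator A x *\<^sub>R c)) \<partial>lborel) \<le> ennreal e"
      if w: "norm w < \<delta>" for w
    proof -
      have m1: "(\<lambda>x. indicator (U - K) (x + w) :: ennreal) \<in> borel_measurable lborel"
        and m2: "(\<lambda>x. indicator (U - K) x :: ennreal) \<in> borel_measurable lborel"
        by measurable
      have "ennreal (norm (indicator A (x + w) *\<^sub>R c - indicator A x *\<^sub>R c))
          \<le> ennreal (norm c) * (indicator (U - K) (x + w) + indicator (U - K) x)" for x
      proof -
        have 1: "x + w \<in> U" if "x \<in> K" using \<delta> that w by (force simp: dist_norm)
        have 2: "x \<in> U" if "x + w \<in> K" using \<delta>(2) that w by (force simp: dist_norm)
        show ?thesis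
          using 1 2 KU(3,4) by (auto simp: indicator_def mult_2_right split: if_splits)
      qed
      then have "(\<integral>\<^sup>+x. ennreal (norm (indicator A (x + w) *\<^sub>R c - indicator A x *\<^sub>R c)) \<partial>lborel)
          \<le> (\<integral>\<^sup>+x. ennreal (norm c) * (indicator (U - K) (x + w) + indicator (U - K) x) \<partial>lborel)"
        by (intro nn_integral_mono) auto
      also have "\<dots> = ennreal (norm c) * ((\<integral>\<^sup>+x. indicator (U - K) (x + w) \<partial>lborel) + (\<integral>\<^sup>+x. indicator (U - K) x \<partial>lborel))"
        by (simp only: nn_integral_cmult nn_integral_add borel_measurable_add m1 m2)
      also have "\<dots> = ennreal (norm c) * (emeasure lborel (U - K) + emeasure lborel (U - K))"
        by (subst nn_integral_translate) auto
      also have "\<dots> \<le> ennreal (norm c) * (ennreal \<eta> + ennreal \<eta>)"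
        by (intro mult_left_mono add_mono KU) auto
      also have "\<dots> = ennreal (norm c * (\<eta> + \<eta>))"
        using \<eta> ennreal_plus[of \<eta> \<eta>] ennreal_mult'[of "norm c" "\<eta> + \<eta>"] by (metis less_imp_le norm_ge_zero)
      also have "\<dots> \<le> ennreal e"
      proof (rule ennreal_leI)
        have "norm c * (\<eta> + \<eta>) \<le> (2 * norm c + 1) * \<eta>" using \<eta> by (simp add: algebra_simps)
        also have "\<dots> = e" unfolding \<eta>_def using norm_ge_zero[of c] by (simp add: add_nonneg_eq_0_iff)
        finally show "norm c * (\<eta> + \<eta>) \<le> e" .
      qed
      finally show ?thesis .
    qed
    with \<delta>(1) show "\<exists>\<delta>>0. \<forall>w. norm w < \<delta> \<longrightarrow>
        (\<integral>\<^sup>+x. ennreal (norm (indicator A (x + w) *\<^sub>R c - indicator A x *\<^sub>R c)) \<partial>lborel) \<le> ennreal e" by blast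
  qed
next
  case (add f g)
  then have [measurable]: "f \<in> borel_measurable borel" "g \<in> borel_measurable borel"
    by (auto dest: borel_measurable_integrable)
  show ?case
  proof (intro allI impI)
    fix e :: real assume e: "0 < e"
    then have e2: "0 < e / 2" by simp
    obtain \<delta>1 where \<delta>1: "\<delta>1 > 0"
        "\<And>w. norm w < \<delta>1 \<Longrightarrow> (\<integral>\<^sup>+x. ennreal (norm (f (x + w) - f x)) \<partial>lborel) \<le> ennreal (e / 2)"
      using add.IH(1)[rule_format, OF e2] by blast
    obtain \<delta>2 where \<delta>2: "\<delta>2 > 0"
        "\<And>w. norm w < \<delta>2 \<Longrightarrow> (\<integral>\<^sup>+x. ennreal (norm (g (x + w) - g x)) \<partial>lborel) \<le> ennreal (e / 2)"
      using add.IH(2)[rule_format, OF e2] by blast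
    note \<delta> = \<delta>1 \<delta>2
    have "(\<integral>\<^sup>+x. ennreal (norm (f (x + w) + g (x + w) - (f x + g x))) \<partial>lborel) \<le> ennreal e"
      if "norm w < min \<delta>1 \<delta>2" for w
    proof -
      have "(\<integral>\<^sup>+x. ennreal (norm (f (x + w) + g (x + w) - (f x + g x))) \<partial>lborel)
          \<le> (\<integral>\<^sup>+x. ennreal (norm (f (x + w) - f x)) + ennreal (norm (g (x + w) - g x)) \<partial>lborel)"
        by (intro nn_integral_mono) (simp add: norm_diff_triangle_ineq flip: ennreal_plus)
      also have "\<dots> = (\<integral>\<^sup>+x. ennreal (norm (f (x + w) - f x)) \<partial>lborel) + (\<integral>\<^sup>+x. ennreal (norm (g (x + w) - g x)) \<partial>lborel)"
        by (rule nn_integral_add) auto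
      also have "\<dots> \<le> ennreal (e / 2) + ennreal (e / 2)"
        using that by (intro add_mono \<delta>) auto
      finally show ?thesis using e by (simp flip: ennreal_plus)
    qed
    with \<delta> show "\<exists>\<delta>>0. \<forall>w. norm w < \<delta> \<longrightarrow>
        (\<integral>\<^sup>+x. ennreal (norm (f (x + w) + g (x + w) - (f x + g x))) \<partial>lborel) \<le> ennreal e"
      by (intro exI[of _ "min \<delta>1 \<delta>2"]) auto
  qed
next
  case (lim f s)
  then have [measurable]: "f \<in> borel_measurable borel" "\<And>i. s i \<in> borel_measurable borel"
    by (auto dest: borel_measurable_integrable)
  have conv: "(\<lambda>i. \<integral>\<^sup>+x. ennreal (norm (f x - s i x)) \<partial>lborel) \<longlonglongrightarrow> 0"
  proof (rule nn_integral_dominated_convergence_norm[where w = "\<lambda>x. 2 * norm (f x)"])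
    show "(\<integral>\<^sup>+x. ennreal (2 * norm (f x)) \<partial>lborel) < \<infinity>"
      using lim by (simp add: integrable_iff_bounded nn_integral_cmult ennreal_mult ennreal_mult_less_top)
  qed (use lim in auto)
  show ?case
  proof (intro allI impI)
    fix e :: real assume e: "0 < e"
    then have "\<forall>\<^sub>F i in sequentially. (\<integral>\<^sup>+x. ennreal (norm (f x - s i x)) \<partial>lborel) < ennreal (e / 3)"
      using conv by (intro order_tendstoD) auto
    then obtain i where i: "(\<integral>\<^sup>+x. ennreal (norm (f x - s i x)) \<partial>lborel) < ennreal (e / 3)"
      by (auto simp: eventually_sequentially)
    have "0 < e / 3" using e by simp
    obtain \<delta> where \<delta>: "\<delta> > 0"
        "\<And>w. norm w < \<delta> \<Longrightarrow> (\<integral>\<^sup>+x. ennreal (norm (s i (x + w) - s i x)) \<partial>lborel) \<le> ennreal (e / 3)"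
      using lim.IH[of i, rule_format, OF \<open>0 < e / 3\<close>] by blast
    have "(\<integral>\<^sup>+x. ennreal (norm (f (x + w) - f x)) \<partial>lborel) \<le> ennreal e" if "norm w < \<delta>" for w
    proof -
      have "ennreal (norm (f (x + w) - f x)) \<le> ennreal (norm (f (x + w) - s i (x + w)))
          + (ennreal (norm (s i (x + w) - s i x)) + ennreal (norm (f x - s i x)))" for x
      proof -
        have "norm (f (x + w) - f x)
            = norm ((f (x + w) - s i (x + w)) + ((s i (x + w) - s i x) - (f x - s i x)))" by simp
        also have "\<dots> \<le> norm (f (x + w) - s i (x + w)) + (norm (s i (x + w) - s i x) + norm (f x - s i x))"
          by (intro order_trans[OF norm_triangle_ineq] add_mono norm_triangle_ineq4 order_refl)
        finally show ?thesis by (simp flip: ennreal_plus)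
      qed
      then have "(\<integral>\<^sup>+x. ennreal (norm (f (x + w) - f x)) \<partial>lborel)
          \<le> (\<integral>\<^sup>+x. ennreal (norm (f (x + w) - s i (x + w)))
          + (ennreal (norm (s i (x + w) - s i x)) + ennreal (norm (f x - s i x))) \<partial>lborel)"
        by (intro nn_integral_mono) auto
      also have "\<dots> = (\<integral>\<^sup>+x. ennreal (norm (f (x + w) - s i (x + w))) \<partial>lborel)
          + ((\<integral>\<^sup>+x. ennreal (norm (s i (x + w) - s i x)) \<partial>lborel) + (\<integral>\<^sup>+x. ennreal (norm (f x - s i x)) \<partial>lborel))"
        by (simp add: nn_integral_add)
      also have "(\<integral>\<^sup>+x. ennreal (norm (f (x + w) - s i (x + w))) \<partial>lborel) = (\<integral>\<^sup>+x. ennreal (norm (f x - s i x)) \<partial>lborel)"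
        by (rule nn_integral_translate) auto
      also have "\<dots> + ((\<integral>\<^sup>+x. ennreal (norm (s i (x + w) - s i x)) \<partial>lborel) + \<dots>)
          \<le> ennreal (e / 3) + (ennreal (e / 3) + ennreal (e / 3))"
        using i \<delta>(2)[OF that] by (intro add_mono) auto
      also have "\<dots> = ennreal e" using e by (simp flip: ennreal_plus)
      finally show ?thesis .
    qed
    with \<delta>(1) show "\<exists>\<delta>>0. \<forall>w. norm w < \<delta> \<longrightarrow>
        (\<integral>\<^sup>+x. ennreal (norm (f (x + w) - f x)) \<partial>lborel) \<le> ennreal e" by blast
  qed
qed

text \<open>
  Convolution of \<open>f\<close> with a (derivative of a) bump of width proportional to \<open>1 / s\<close>, not yet normalised.
\<close>

definition mollify :: "('n::finite \<Rightarrow> nat) \<Rightarrow> real \<Rightarrow> (real^'n \<Rightarrow> 'b::euclidean_space) \<Rightarrow> real^'n \<Rightarrow> 'b" where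
  "mollify m s f x = (\<integral>z. bump_vec m (s *\<^sub>R (z - x)) *\<^sub>R f z \<partial>lborel)"

lemma borel_measurable_bump_vec [measurable]: "bump_vec m \<in> borel_measurable borel"
  by (intro borel_measurable_continuous_onI continuous_on_bump_vec)

lemma bump_vec_scaled_eq_0:
  fixes v :: "real^'n"
  assumes "0 < s" "sqrt (CARD('n)) / s \<le> norm v"
  shows "bump_vec m (s *\<^sub>R v) = 0"
  using assms by (intro bump_vec_eq_0) (simp add: field_simps)

lemma locally_integrableD:
  assumes "locally_integrable f"
  shows "f \<in> borel_measurable borel" "integrable lborel (\<lambda>z. indicator (cball x r) z *\<^sub>R f z)"
  using assms by (auto simp: locally_integrable_def set_integrable_def)

lemma integrable_bump_vec_scaleR:
  fixes f :: "real^'n \<Rightarrow> 'b::euclidean_space"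
  assumes f: "locally_integrable f" and s: "0 < s"
  shows "integrable lborel (\<lambda>z. bump_vec m (s *\<^sub>R (z - x)) *\<^sub>R f z)"
proof -
  note [measurable] = locally_integrableD(1)[OF f]
  obtain C where C: "C \<ge> 0" "\<And>x :: real^'n. \<bar>bump_vec m x\<bar> \<le> C" using bump_vec_bounded by blast
  let ?K = "cball x (sqrt (CARD('n)) / s)"
  show ?thesis
  proof (rule Bochner_Integration.integrable_bound)
    show "integrable lborel (\<lambda>z. C *\<^sub>R (indicator ?K z *\<^sub>R f z))"
      by (intro integrable_scaleR_right locally_integrableD f)
    show "AE z in lborel. norm (bump_vec m (s *\<^sub>R (z - x)) *\<^sub>R f z) \<le> norm (C *\<^sub>R (indicator ?K z *\<^sub>R f z))"
    proof (rule AE_I2)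
      fix z
      show "norm (bump_vec m (s *\<^sub>R (z - x)) *\<^sub>R f z) \<le> norm (C *\<^sub>R (indicator ?K z *\<^sub>R f z))"
      proof (cases "z \<in> ?K")
        case True
        then show ?thesis using C by (auto intro!: mult_right_mono)
      next
        case False
        then have "bump_vec m (s *\<^sub>R (z - x)) = 0"
          using s by (intro bump_vec_scaled_eq_0) (auto simp: dist_norm norm_minus_commute)
        then show ?thesis by simp
      qed
    qed
  qed measurable
qed

text \<open>
  By \<open>bump_vec_taylor\<close> the difference quotient under the integral differs from the derivative by
  \<open>O(\<parallel>h\<parallel>\<^sup>2)\<close>, uniformly on a ball that contains the supports for all small \<open>h\<close>, and \<open>f\<close> is integrable there.
  The factor \<open>-s\<close> is the inner derivative of \<open>s (z - x)\<close> with respect to \<open>x\<close>.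
\<close>

lemma mollify_has_derivative:
  fixes f :: "real^'n \<Rightarrow> 'b::euclidean_space"
  assumes f: "locally_integrable f" and s: "0 < s"
  shows "(mollify m s f has_derivative (\<lambda>h. \<Sum>i\<in>UNIV. h $ i *\<^sub>R (- s *\<^sub>R mollify (m(i := Suc (m i))) s f x))) (at x)"
    (is "(_ has_derivative ?D) _")
  unfolding has_derivative_at
proof
  show bl: "bounded_linear ?D"
    by (intro bounded_linear_sum bounded_linear_scaleR_const bounded_linear_vec_nth)
  obtain C where C: "C \<ge> 0" "\<And>(y :: real^'n) h. \<bar>bump_vec m (y + h) - bump_vec m y
      - (\<Sum>i\<in>UNIV. h $ i * bump_vec (m(i := Suc (m i))) y)\<bar> \<le> C * (norm h)\<^sup>2"
    using bump_vec_taylor[of m] by blast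
  define K where "K = cball x (sqrt (CARD('n)) / s + 1)"
  have int_f: "integrable lborel (\<lambda>z. indicator K z *\<^sub>R f z)"
    unfolding K_def by (rule locally_integrableD[OF f])
  define I where "I = (\<integral>z. norm (indicator K z *\<^sub>R f z) \<partial>lborel)"
  have bound: "norm (mollify m s f (x + h) - mollify m s f x - ?D h) \<le> C * s\<^sup>2 * I * (norm h)\<^sup>2"
    if h: "norm h \<le> 1" for h
  proof -
    let ?b = "\<lambda>i. bump_vec (m(i := Suc (m i)))"
    let ?R = "\<lambda>z. bump_vec m (s *\<^sub>R (z - (x + h))) - bump_vec m (s *\<^sub>R (z - x))
        - (\<Sum>i\<in>UNIV. h $ i * (- s * ?b i (s *\<^sub>R (z - x))))"
    note int = integrable_bump_vec_scaleR[OF f s]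
    have "?D h = (\<Sum>i\<in>UNIV. \<integral>z. (h $ i * (- s * ?b i (s *\<^sub>R (z - x)))) *\<^sub>R f z \<partial>lborel)"
      using int by (simp add: mollify_def flip: scaleR_scaleR)
    also have "\<dots> = (\<integral>z. (\<Sum>i\<in>UNIV. (h $ i * (- s * ?b i (s *\<^sub>R (z - x)))) *\<^sub>R f z) \<partial>lborel)"
      by (rule Bochner_Integration.integral_sum[symmetric])
         (use int in \<open>simp flip: scaleR_scaleR\<close>)
    finally have D: "?D h = (\<integral>z. (\<Sum>i\<in>UNIV. (h $ i * (- s * ?b i (s *\<^sub>R (z - x)))) *\<^sub>R f z) \<partial>lborel)" .
    have intD: "integrable lborel (\<lambda>z. (\<Sum>i\<in>UNIV. (h $ i * (- s * ?b i (s *\<^sub>R (z - x)))) *\<^sub>R f z))"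
      by (rule Bochner_Integration.integrable_sum) (use int in \<open>simp flip: scaleR_scaleR\<close>)
    have eq: "mollify m s f (x + h) - mollify m s f x - ?D h = (\<integral>z. ?R z *\<^sub>R f z \<partial>lborel)"
      unfolding D unfolding mollify_def Bochner_Integration.integral_diff[OF int int, symmetric]
        Bochner_Integration.integral_diff[OF Bochner_Integration.integrable_diff[OF int int] intD, symmetric]
      by (simp only: scaleR_diff_left scaleR_sum_left)
    have intR: "integrable lborel (\<lambda>z. ?R z *\<^sub>R f z)"
      unfolding scaleR_diff_left scaleR_sum_left
      by (rule Bochner_Integration.integrable_diff[OF Bochner_Integration.integrable_diff[OF int int] intD])
    have ptw: "norm (?R z *\<^sub>R f z) \<le> (C * s\<^sup>2 * (norm h)\<^sup>2) * norm (indicator K z *\<^sub>R f z)" for z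
    proof (cases "z \<in> K")
      case True
      have "\<bar>?R z\<bar> = \<bar>bump_vec m (s *\<^sub>R (z - x) + (- s) *\<^sub>R h) - bump_vec m (s *\<^sub>R (z - x))
          - (\<Sum>i\<in>UNIV. ((- s) *\<^sub>R h) $ i * ?b i (s *\<^sub>R (z - x)))\<bar>"
        by (simp add: algebra_simps)
      also have "\<dots> \<le> C * (norm ((- s) *\<^sub>R h))\<^sup>2" by (rule C)
      also have "\<dots> = C * s\<^sup>2 * (norm h)\<^sup>2" by (simp add: power_mult_distrib)
      finally show ?thesis using True by (auto intro!: mult_right_mono)
    next
      case False
      then have d: "sqrt (CARD('n)) / s + 1 < norm (z - x)" by (simp add: K_def dist_norm norm_minus_commute)
      moreover have "norm (z - x) \<le> norm (z - (x + h)) + norm h"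
        using norm_triangle_ineq[of "z - (x + h)" h] by (simp add: algebra_simps)
      ultimately have "sqrt (CARD('n)) / s \<le> norm (z - (x + h))" "sqrt (CARD('n)) / s \<le> norm (z - x)"
        using h by linarith+
      then have "?R z = 0" using s by (simp only: bump_vec_scaled_eq_0) simp
      then show ?thesis using C by simp
    qed
    have "norm (\<integral>z. ?R z *\<^sub>R f z \<partial>lborel) \<le> (\<integral>z. (C * s\<^sup>2 * (norm h)\<^sup>2) * norm (indicator K z *\<^sub>R f z) \<partial>lborel)"
      using int_f by (intro Bochner_Integration.integral_norm_bound_integral[OF intR] ptw integrable_mult_right integrable_norm)
    also have "\<dots> = C * s\<^sup>2 * I * (norm h)\<^sup>2" by (simp add: I_def)
    finally show ?thesis unfolding eq .
  qed
  show "(\<lambda>h. norm (mollify m s f (x + h) - mollify m s f x - ?D h) / norm h) \<midarrow>0\<rightarrow> 0"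
  proof (rule Lim_null_comparison)
    have "\<forall>\<^sub>F h in at 0. h \<in> ball (0 :: real^'n) 1" by (auto simp: eventually_at dist_commute intro!: exI[of _ 1])
    then show "\<forall>\<^sub>F h in at 0. norm (norm (mollify m s f (x + h) - mollify m s f x - ?D h) / norm h) \<le> C * s\<^sup>2 * I * norm h"
    proof (rule eventually_mono)
      fix h :: "real^'n" assume "h \<in> ball 0 1"
      then have "norm (mollify m s f (x + h) - mollify m s f x - ?D h) \<le> C * s\<^sup>2 * I * (norm h)\<^sup>2"
        by (intro bound) simp
      then show "norm (norm (mollify m s f (x + h) - mollify m s f x - ?D h) / norm h) \<le> C * s\<^sup>2 * I * norm h"
        by (cases "h = 0") (auto simp: divide_le_eq power2_eq_square mult.assoc)
    qed
    show "(\<lambda>h :: real^'n. C * s\<^sup>2 * I * norm h) \<midarrow>0\<rightarrow> 0"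
      by (auto intro!: tendsto_eq_intros)
  qed
qed

lemma continuous_on_mollify:
  assumes "locally_integrable f" "0 < s"
  shows "continuous_on A (mollify m s f)"
  by (meson mollify_has_derivative[OF assms] continuous_at_imp_continuous_on has_derivative_continuous)

text \<open>
  The translated and scaled bump is a test function; differentiating it in \<open>z\<close> instead of \<open>x\<close> changes the
  sign, which cancels the sign in the definition of the weak derivative.
\<close>

lemma mollify_weak_deriv:
  fixes f :: "real^'n \<Rightarrow> 'b::euclidean_space"
  assumes w: "has_weak_deriv (\<lambda>j. if j = i then 1 else 0) f g" and s: "0 < s"
  shows "- s *\<^sub>R mollify ((\<lambda>_. 0)(i := Suc 0)) s f x = mollify (\<lambda>_. 0) s g x"
proof -
  let ?\<phi> = "\<lambda>z. bump_vec (\<lambda>_. 0) (s *\<^sub>R (z - x))"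
  have m: "count_list [i] = (\<lambda>_. 0)(i := Suc 0)" by (auto simp: fun_eq_iff)
  have "test_function ?\<phi> \<and> (\<forall>k. count_list [i] k = (if k = i then 1 else 0))"
    using test_function_bump_vec[of s x] s by auto
  then have "(\<integral>x. iterated_partial [i] ?\<phi> x *\<^sub>R f x \<partial>lborel)
      = (- 1) ^ (\<Sum>j\<in>(UNIV :: 'n set). if j = i then 1 else 0) *\<^sub>R (\<integral>z. ?\<phi> z *\<^sub>R g z \<partial>lborel)"
    using w unfolding has_weak_deriv_def by blast
  then show ?thesis
    unfolding iterated_partial_bump_vec m mollify_def
    by (simp add: minus_equation_iff flip: scaleR_scaleR)
qed

lemma mollify_gradient:
  fixes f :: "real^'n \<Rightarrow> 'b::euclidean_space"
  assumes w: "\<And>i. has_weak_deriv (\<lambda>j. if j = i then 1 else 0) f (g i)" and s: "0 < s"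
  shows "(mollify (\<lambda>_. 0) s f has_derivative (\<lambda>h. \<Sum>i\<in>UNIV. h $ i *\<^sub>R mollify (\<lambda>_. 0) s (g i) x)) (at x)"
proof -
  have f: "locally_integrable f" using w by (auto simp: has_weak_deriv_def)
  have "mollify (\<lambda>_. 0) s (g i) x = - s *\<^sub>R mollify ((\<lambda>_. 0)(i := Suc ((\<lambda>_. 0) i))) s f x" for i
    using mollify_weak_deriv[OF w s] by simp
  then show ?thesis using mollify_has_derivative[OF f s, of "\<lambda>_. 0" x] by (simp only:)
qed

lemma mollify_cong_near:
  fixes f :: "real^'n \<Rightarrow> 'b::euclidean_space"
  assumes s: "0 < s" and eq: "\<And>z. norm (z - x) < sqrt (CARD('n)) / s \<Longrightarrow> f z = f' z"
  shows "mollify m s f x = mollify m s f' x"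
  unfolding mollify_def
proof (intro Bochner_Integration.integral_cong refl)
  fix z
  show "bump_vec m (s *\<^sub>R (z - x)) *\<^sub>R f z = bump_vec m (s *\<^sub>R (z - x)) *\<^sub>R f' z"
    using eq[of z] bump_vec_scaled_eq_0[OF s, of "z - x" m]
    by (cases "norm (z - x) < sqrt (CARD('n)) / s") auto
qed

lemma sets_borel_ball [measurable]: "ball x r \<in> sets borel"
  by simp

definition smoothing :: "real \<Rightarrow> (real^'n \<Rightarrow> 'b::euclidean_space) \<Rightarrow> real^'n \<Rightarrow> 'b" where
  "smoothing s f x = mollify (\<lambda>_. 0) s f x /\<^sub>R bump_mass TYPE('n) s"

lemma smoothing_gradient:
  fixes f :: "real^'n \<Rightarrow> 'b::euclidean_space"
  assumes w: "\<And>i. has_weak_deriv (\<lambda>j. if j = i then 1 else 0) f (g i)" and s: "0 < s"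
  shows "(smoothing s f has_derivative (\<lambda>h. \<Sum>i\<in>UNIV. h $ i *\<^sub>R smoothing s (g i) x)) (at x)"
proof -
  have "((\<lambda>x. mollify (\<lambda>_. 0) s f x /\<^sub>R bump_mass TYPE('n) s) has_derivative
      (\<lambda>h. (\<Sum>i\<in>UNIV. h $ i *\<^sub>R mollify (\<lambda>_. 0) s (g i) x) /\<^sub>R bump_mass TYPE('n) s)) (at x)"
    by (intro has_derivative_scaleR_right mollify_gradient[OF w s])
  then show ?thesis
    by (simp add: smoothing_def[abs_def] scaleR_sum_right mult.commute)
qed

lemma continuous_on_smoothing:
  assumes "locally_integrable f" "0 < s"
  shows "continuous_on A (smoothing s f)"
  unfolding smoothing_def[abs_def] by (intro continuous_intros continuous_on_mollify assms)

lemma integrable_imp_locally_integrable: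
  assumes "integrable lborel f"
  shows "locally_integrable f"
  using assms by (auto simp: locally_integrable_def set_integrable_def compact_imp_closed
      intro!: integrable_mult_indicator)

text \<open>
  \<open>smoothing s f x - f x\<close> is an average of \<open>f (x + v) - f x\<close> over \<open>v\<close> in the support of the mollifier.
  Exchanging the order of integration leaves the \<open>L\<^sup>1\<close> distance of \<open>f\<close> to its small translates.
\<close>

lemma smoothing_L1:
  fixes f :: "real^'n \<Rightarrow> 'b::euclidean_space"
  assumes f: "integrable lborel f" and e: "0 < e"
  shows "\<exists>S>0. \<forall>s\<ge>S. (\<integral>\<^sup>+x. ennreal (norm (smoothing s f x - f x)) \<partial>lborel) \<le> ennreal e"
proof -
  obtain \<delta> where \<delta>: "\<delta> > 0"
      "\<And>w. norm w < \<delta> \<Longrightarrow> (\<integral>\<^sup>+x. ennreal (norm (f (x + w) - f x)) \<partial>lborel) \<le> ennreal e"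
    using translation_continuous_L1[OF f, rule_format, OF e] by blast
  have f': "locally_integrable f" by (rule integrable_imp_locally_integrable[OF f])
  have [measurable]: "f \<in> borel_measurable borel" using f by auto
  define S where "S = sqrt (CARD('n)) / \<delta>"
  have S: "0 < S" using \<delta> by (simp add: S_def)
  have "(\<integral>\<^sup>+x. ennreal (norm (smoothing s f x - f x)) \<partial>lborel) \<le> ennreal e" if "S \<le> s" for s
  proof -
    have s: "0 < s" using that S by simp
    have Ss: "sqrt (CARD('n)) / s \<le> \<delta>"
      using that s \<delta> by (simp add: S_def field_simps)
    define \<kappa> where "\<kappa> = bump_mass TYPE('n) s"
    have \<kappa>: "0 < \<kappa>" using bump_mass_pos[OF s] by (simp add: \<kappa>_def)
    let ?b = "\<lambda>v :: real^'n. bump_vec (\<lambda>_. 0) (s *\<^sub>R v)"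
    have b0: "0 \<le> ?b v" for v by (rule bump_vec_nonneg)
    have int_b: "integrable lborel ?b" by (rule integrable_bump_vec[OF s])
    have nnb: "(\<integral>\<^sup>+v. ennreal (?b v) \<partial>lborel) = ennreal \<kappa>"
      unfolding \<kappa>_def bump_mass_def by (rule nn_integral_eq_integral[OF int_b]) (simp add: b0)
    have shift: "integrable lborel (\<lambda>z. ?b (z - x))" "(\<integral>z. ?b (z - x) \<partial>lborel) = \<kappa>" for x
    proof -
      have "integrable (distr lborel borel ((+) (- x))) ?b"
        using int_b by (simp add: lborel_distr_plus)
      then show "integrable lborel (\<lambda>z. ?b (z - x))"
        by (subst (asm) integrable_distr_eq) auto
      have "\<kappa> = (\<integral>v. ?b v \<partial>distr lborel borel ((+) (- x)))"
        by (simp add: lborel_distr_plus \<kappa>_def bump_mass_def)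
      also have "\<dots> = (\<integral>z. ?b (z - x) \<partial>lborel)"
        by (subst integral_distr) auto
      finally show "(\<integral>z. ?b (z - x) \<partial>lborel) = \<kappa>" ..
    qed
    have ptw: "ennreal (norm (smoothing s f x - f x)) * ennreal \<kappa>
        \<le> (\<integral>\<^sup>+v. ennreal (?b v) * ennreal (norm (f (x + v) - f x)) \<partial>lborel)" for x
    proof -
      have i1: "integrable lborel (\<lambda>z. ?b (z - x) *\<^sub>R f z)"
        by (rule integrable_bump_vec_scaleR[OF f' s])
      have i2: "integrable lborel (\<lambda>z. ?b (z - x) *\<^sub>R f x)"
        by (intro integrable_scaleR_left shift)
      have "\<kappa> *\<^sub>R (smoothing s f x - f x) = (\<integral>z. ?b (z - x) *\<^sub>R f z \<partial>lborel) - (\<integral>z. ?b (z - x) *\<^sub>R f x \<partial>lborel)"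
        using \<kappa> shift[of x] by (simp add: smoothing_def mollify_def \<kappa>_def scaleR_diff_right)
      also have "\<dots> = (\<integral>z. ?b (z - x) *\<^sub>R (f z - f x) \<partial>lborel)"
        using i1 i2 by (simp add: scaleR_diff_right)
      finally have eq: "\<kappa> *\<^sub>R (smoothing s f x - f x) = (\<integral>z. ?b (z - x) *\<^sub>R (f z - f x) \<partial>lborel)" .
      have "ennreal (norm (smoothing s f x - f x)) * ennreal \<kappa> = ennreal (norm (\<kappa> *\<^sub>R (smoothing s f x - f x)))"
        using \<kappa> by (simp add: ennreal_mult mult.commute)
      also have "\<dots> \<le> (\<integral>\<^sup>+z. ennreal (norm (?b (z - x) *\<^sub>R (f z - f x))) \<partial>lborel)"
        unfolding eq using i1 i2 by (intro integral_norm_bound_ennreal) (simp add: scaleR_diff_right)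
      also have "\<dots> = (\<integral>\<^sup>+z. ennreal (?b (z - x)) * ennreal (norm (f z - f x)) \<partial>lborel)"
        by (simp add: b0 ennreal_mult)
      also have "\<dots> = (\<integral>\<^sup>+v. ennreal (?b (v + x - x)) * ennreal (norm (f (v + x) - f x)) \<partial>lborel)"
        by (rule nn_integral_translate[symmetric]) measurable
      finally show ?thesis by (simp add: add.commute)
    qed
    have [measurable]: "smoothing s f \<in> borel_measurable borel"
      by (intro borel_measurable_continuous_onI continuous_on_smoothing f' s)
    have "(\<integral>\<^sup>+x. ennreal (norm (smoothing s f x - f x)) \<partial>lborel) * ennreal \<kappa>
        = (\<integral>\<^sup>+x. ennreal (norm (smoothing s f x - f x)) * ennreal \<kappa> \<partial>lborel)"
      by (rule nn_integral_multc[symmetric]) measurable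
    also have "\<dots> \<le> (\<integral>\<^sup>+x. (\<integral>\<^sup>+v. ennreal (?b v) * ennreal (norm (f (x + v) - f x)) \<partial>lborel) \<partial>lborel)"
      by (intro nn_integral_mono ptw)
    also have "\<dots> = (\<integral>\<^sup>+v. (\<integral>\<^sup>+x. ennreal (?b v) * ennreal (norm (f (x + v) - f x)) \<partial>lborel) \<partial>lborel)"
      by (rule lborel_pair.Fubini'[symmetric]) measurable
    also have "\<dots> = (\<integral>\<^sup>+v. ennreal (?b v) * (\<integral>\<^sup>+x. ennreal (norm (f (x + v) - f x)) \<partial>lborel) \<partial>lborel)"
      by (intro nn_integral_cong nn_integral_cmult) measurable
    also have "\<dots> \<le> (\<integral>\<^sup>+v. ennreal (?b v) * ennreal e \<partial>lborel)"
    proof (rule nn_integral_mono)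
      fix v :: "real^'n"
      show "ennreal (?b v) * (\<integral>\<^sup>+x. ennreal (norm (f (x + v) - f x)) \<partial>lborel) \<le> ennreal (?b v) * ennreal e"
      proof (cases "norm v < \<delta>")
        case True
        then show ?thesis by (intro mult_left_mono \<delta>) auto
      next
        case False
        then have "?b v = 0" using Ss by (intro bump_vec_scaled_eq_0 s) auto
        then show ?thesis by simp
      qed
    qed
    also have "\<dots> = ennreal \<kappa> * ennreal e"
      unfolding nnb[symmetric] by (rule nn_integral_multc) measurable
    finally have "ennreal \<kappa> * (\<integral>\<^sup>+x. ennreal (norm (smoothing s f x - f x)) \<partial>lborel) \<le> ennreal \<kappa> * ennreal e"
      by (simp add: mult.commute)
    then show ?thesis
      using \<kappa> by (subst (asm) ennreal_mult_le_mult_iff) auto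
  qed
  with S show ?thesis by blast
qed

text \<open>
  Inside a ball, mollification at scales below one only sees the values of \<open>f\<close> on a slightly larger ball,
  so \<open>f\<close> may be truncated to an integrable function.
\<close>

lemma smoothing_L1_local:
  fixes f :: "real^'n \<Rightarrow> 'b::euclidean_space"
  assumes f: "locally_integrable f" and e: "0 < e"
  shows "\<exists>S>0. \<forall>s\<ge>S. (\<integral>\<^sup>+x\<in>ball 0 R. ennreal (norm (smoothing s f x - f x)) \<partial>lborel) \<le> ennreal e"
proof -
  let ?g = "\<lambda>z. indicator (cball 0 (R + 1)) z *\<^sub>R f z"
  obtain S where S: "S > 0" "\<And>s. s \<ge> S \<Longrightarrow> (\<integral>\<^sup>+x. ennreal (norm (smoothing s ?g x - ?g x)) \<partial>lborel) \<le> ennreal e"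
    using smoothing_L1[OF locally_integrableD(2)[OF f] e] by blast
  have "(\<integral>\<^sup>+x\<in>ball 0 R. ennreal (norm (smoothing s f x - f x)) \<partial>lborel) \<le> ennreal e"
    if "max S (sqrt (CARD('n))) \<le> s" for s
  proof -
    have s: "0 < s" "sqrt (CARD('n)) / s \<le> 1" "S \<le> s" using that S by (auto simp: field_simps)
    have "(\<integral>\<^sup>+x\<in>ball 0 R. ennreal (norm (smoothing s f x - f x)) \<partial>lborel)
        \<le> (\<integral>\<^sup>+x. ennreal (norm (smoothing s ?g x - ?g x)) \<partial>lborel)"
    proof (rule nn_integral_mono)
      fix x :: "real^'n"
      show "ennreal (norm (smoothing s f x - f x)) * indicator (ball 0 R) x \<le> ennreal (norm (smoothing s ?g x - ?g x))"
      proof (cases "x \<in> ball 0 R")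
        case True
        have "f z = ?g z" if "norm (z - x) < sqrt (CARD('n)) / s" for z
          using True that s(2) norm_triangle_ineq[of x "z - x"] by (auto simp: indicator_def)
        then have "mollify (\<lambda>_. 0) s f x = mollify (\<lambda>_. 0) s ?g x"
          by (rule mollify_cong_near[OF s(1)])
        moreover have "f x = ?g x" using True by (auto simp: indicator_def)
        ultimately have "norm (smoothing s f x - f x) = norm (smoothing s ?g x - ?g x)"
          by (simp only: smoothing_def)
        with True show ?thesis by simp
      qed auto
    qed
    also have "\<dots> \<le> ennreal e" by (rule S(2)[OF s(3)])
    finally show ?thesis .
  qed
  then show ?thesis using S(1) by (intro exI[of _ "max S (sqrt (CARD('n)))"]) auto
qed

section \<open>Uniqueness and linearity of weak derivatives\<close>

text \<open>
  The fundamental lemma of the calculus of variations: all mollifications of \<open>g\<close> vanish, and they converge to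
  \<open>g\<close> locally in \<open>L\<^sup>1\<close>.
\<close>

lemma weak_deriv_zero_imp_AE_zero:
  fixes g :: "real^'n \<Rightarrow> 'b::euclidean_space"
  assumes g: "locally_integrable g"
    and zero: "\<And>\<phi>. test_function \<phi> \<Longrightarrow> (\<integral>x. \<phi> x *\<^sub>R g x \<partial>lborel) = 0"
  shows "AE x in lborel. g x = 0"
proof -
  note [measurable] = locally_integrableD(1)[OF g]
  have "AE x in lborel. x \<in> ball 0 (real n) \<longrightarrow> g x = 0" for n :: nat
  proof -
    have le: "(\<integral>\<^sup>+x\<in>ball 0 (real n). ennreal (norm (g x)) \<partial>lborel) \<le> ennreal e" if e: "0 < e" for e
    proof -
      obtain s where s: "s > 0" "(\<integral>\<^sup>+x\<in>ball 0 (real n). ennreal (norm (smoothing s g x - g x)) \<partial>lborel) \<le> ennreal e"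
        using smoothing_L1_local[OF g e, of "real n"] by blast
      have "smoothing s g x = 0" for x
        using zero[OF test_function_bump_vec[of s x]] s(1) by (simp add: smoothing_def mollify_def)
      with s(2) show ?thesis by simp
    qed
    have "(\<integral>\<^sup>+x\<in>ball 0 (real n). ennreal (norm (g x)) \<partial>lborel) = 0"
    proof (rule order_antisym[OF ennreal_le_epsilon zero_le])
      fix e :: real assume "0 < e"
      from le[OF this] show "(\<integral>\<^sup>+x\<in>ball 0 (real n). ennreal (norm (g x)) \<partial>lborel) \<le> 0 + ennreal e" by simp
    qed
    then have "AE x in lborel. ennreal (norm (g x)) * indicator (ball 0 (real n)) x = 0"
      by (subst (asm) nn_integral_0_iff_AE) auto
    then show ?thesis by (rule AE_mp) (auto intro!: AE_I2 simp: indicator_def split: if_splits)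
  qed
  then have "AE x in lborel. \<forall>n::nat. x \<in> ball 0 (real n) \<longrightarrow> g x = 0"
    unfolding AE_all_countable by blast
  then show ?thesis
  proof (rule AE_mp, intro AE_I2 impI)
    fix x :: "real^'n" assume "\<forall>n::nat. x \<in> ball 0 (real n) \<longrightarrow> g x = 0"
    moreover obtain n :: nat where "norm x < n" using reals_Archimedean2 by blast
    ultimately show "g x = 0" by auto
  qed
qed

lemma ex_list_count_eq: "\<exists>is. \<forall>i. count_list is i = j (i :: 'a::finite)"
proof -
  have rep: "count_list (replicate n a) i = (if i = a then n else 0)" for n and a i :: 'a
    by (induction n) auto
  have "\<exists>is. \<forall>i. count_list is i = (if i \<in> A then j i else 0)" for A :: "'a set"
  proof (induction A rule: finite_induct[OF finite])
    case (2 a A)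
    then obtain "is" where "\<forall>i. count_list is i = (if i \<in> A then j i else 0)" by blast
    with 2 show ?case
      by (intro exI[of _ "replicate (j a) a @ is"]) (auto simp: rep)
  qed (simp add: exI[of _ "[]"])
  from this[of UNIV] show ?thesis by simp
qed

lemma integrable_test_function_scaleR:
  assumes \<phi>: "test_function \<phi>" and h: "locally_integrable h"
  shows "integrable lborel (\<lambda>x. \<phi> x *\<^sub>R h x)"
proof -
  define K where "K = closure {x. \<phi> x \<noteq> 0}"
  have K: "compact K" using \<phi> by (simp add: K_def test_function_def)
  have "iterated_partial [] \<phi> differentiable (at x)" for x
    using \<phi> unfolding test_function_def by blast
  then have cont: "continuous_on A \<phi>" for A
    by (auto intro!: continuous_at_imp_continuous_on differentiable_imp_continuous_within)
  have [measurable]: "h \<in> borel_measurable borel" "\<phi> \<in> borel_measurable borel"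
    using h cont by (auto simp: locally_integrable_def intro: borel_measurable_continuous_onI)
  have "bounded (\<phi> ` K)" by (intro compact_imp_bounded compact_continuous_image cont K)
  then obtain C where C: "\<forall>x\<in>K. \<bar>\<phi> x\<bar> \<le> C" by (auto simp: bounded_iff)
  have "integrable lborel (\<lambda>x. C *\<^sub>R (indicator K x *\<^sub>R h x))"
    using h K by (intro integrable_scaleR_right) (auto simp: locally_integrable_def set_integrable_def)
  then show ?thesis
  proof (rule Bochner_Integration.integrable_bound)
    have "norm (\<phi> x *\<^sub>R h x) \<le> norm (C *\<^sub>R (indicator K x *\<^sub>R h x))" for x
    proof (cases "x \<in> K")
      case True
      then have "\<bar>\<phi> x\<bar> \<le> \<bar>C\<bar>" using C by force
      with True show ?thesis by (simp add: mult_right_mono)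
    next
      case False
      then have "\<phi> x = 0" using closure_subset[of "{x. \<phi> x \<noteq> 0}"] by (auto simp: K_def)
      then show ?thesis by simp
    qed
    then show "AE x in lborel. norm (\<phi> x *\<^sub>R h x) \<le> norm (C *\<^sub>R (indicator K x *\<^sub>R h x))" by simp
  qed measurable
qed

text \<open>
  Needed because \<open>weak_deriv\<close> is a choice of representative, which only agrees almost everywhere with
  any weak derivative at hand.
\<close>

lemma has_weak_deriv_unique:
  assumes "has_weak_deriv j f g" "has_weak_deriv j f g'"
  shows "AE x in lborel. g x = g' x"
proof -
  have [measurable]: "g \<in> borel_measurable borel" "g' \<in> borel_measurable borel"
    and l: "locally_integrable g" "locally_integrable g'"
    using assms by (auto simp: has_weak_deriv_def locally_integrable_def)
  obtain "is" where "is": "\<And>i. count_list is i = j i"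
    using ex_list_count_eq[of j] by blast
  have "AE x in lborel. g x - g' x = 0"
  proof (rule weak_deriv_zero_imp_AE_zero)
    show "locally_integrable (\<lambda>x. g x - g' x)"
      using l by (auto simp: locally_integrable_def set_integrable_def scaleR_diff_right)
    fix \<phi> :: "real^'a \<Rightarrow> real" assume \<phi>: "test_function \<phi>"
    note int = integrable_test_function_scaleR[OF \<phi>]
    have t: "test_function \<phi> \<and> (\<forall>i. count_list is i = j i)" using \<phi> "is" by blast
    have "(\<integral>x. iterated_partial is \<phi> x *\<^sub>R f x \<partial>lborel)
        = (- 1) ^ (\<Sum>i\<in>UNIV. j i) *\<^sub>R (\<integral>x. \<phi> x *\<^sub>R g x \<partial>lborel)"
      using assms(1) t unfolding has_weak_deriv_def by blast
    moreover have "(\<integral>x. iterated_partial is \<phi> x *\<^sub>R f x \<partial>lborel)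
        = (- 1) ^ (\<Sum>i\<in>UNIV. j i) *\<^sub>R (\<integral>x. \<phi> x *\<^sub>R g' x \<partial>lborel)"
      using assms(2) t unfolding has_weak_deriv_def by blast
    ultimately have "(\<integral>x. \<phi> x *\<^sub>R g x \<partial>lborel) = (\<integral>x. \<phi> x *\<^sub>R g' x \<partial>lborel)" by simp
    then show "(\<integral>x. \<phi> x *\<^sub>R (g x - g' x) \<partial>lborel) = 0"
      using int[OF l(1)] int[OF l(2)] by (simp add: scaleR_diff_right)
  qed
  then show ?thesis by simp
qed

lemma iterated_partial_append:
  "iterated_partial (is @ js) \<phi> = iterated_partial is (iterated_partial js \<phi>)"
  by (induction "is") auto

lemma test_function_partial:
  assumes \<phi>: "test_function \<phi>"
  shows "test_function (partial i \<phi>)"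
  unfolding test_function_def
proof
  show "\<forall>is x. iterated_partial is (partial i \<phi>) differentiable at x"
    using \<phi> iterated_partial_append[of _ "[i]" \<phi>] unfolding test_function_def
    by (metis iterated_partial.simps)
  let ?K = "closure {x. \<phi> x \<noteq> 0}"
  have "partial i \<phi> x = 0" if "x \<notin> ?K" for x
  proof -
    have "(\<phi> has_derivative (\<lambda>_. 0)) (at x)"
    proof (rule has_derivative_transform_within_open)
      show "((\<lambda>_. 0) has_derivative (\<lambda>_. 0)) (at x)" by simp
      show "open (- ?K)" by (rule open_Compl[OF closed_closure])
      show "0 = \<phi> y" if "y \<in> - ?K" for y
        using that closure_subset[of "{x. \<phi> x \<noteq> 0}"] by auto
    qed (use that in simp)
    then show ?thesis by (simp add: partial_def frechet_derivative_at[symmetric])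
  qed
  then have "{x. partial i \<phi> x \<noteq> 0} \<subseteq> ?K" by auto
  moreover have "bounded ?K" using \<phi> by (simp add: test_function_def compact_imp_bounded)
  ultimately show "compact (closure {x. partial i \<phi> x \<noteq> 0})"
    by (simp only: compact_closure) (rule bounded_subset)
qed

lemma test_function_iterated_partial:
  "test_function \<phi> \<Longrightarrow> test_function (iterated_partial is \<phi>)"
  by (induction "is") (auto intro: test_function_partial)

lemma locally_integrable_diff:
  "locally_integrable f \<Longrightarrow> locally_integrable g \<Longrightarrow> locally_integrable (\<lambda>x. f x - g x)"
  by (auto simp: locally_integrable_def set_integrable_def scaleR_diff_right)

lemma has_weak_deriv_diff:
  assumes f: "has_weak_deriv j f f'" and g: "has_weak_deriv j g g'"
  shows "has_weak_deriv j (\<lambda>x. f x - g x) (\<lambda>x. f' x - g' x)"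
proof -
  have l: "locally_integrable f" "locally_integrable f'" "locally_integrable g" "locally_integrable g'"
    using f g by (auto simp: has_weak_deriv_def)
  have "(\<integral>x. iterated_partial is \<phi> x *\<^sub>R (f x - g x) \<partial>lborel)
      = (- 1) ^ (\<Sum>i\<in>UNIV. j i) *\<^sub>R (\<integral>x. \<phi> x *\<^sub>R (f' x - g' x) \<partial>lborel)"
    if t: "test_function \<phi> \<and> (\<forall>i. count_list is i = j i)" for \<phi> "is"
  proof -
    note i1 = integrable_test_function_scaleR[OF conjunct1[OF t]]
    note i2 = integrable_test_function_scaleR[OF test_function_iterated_partial[OF conjunct1[OF t]]]
    have "(\<integral>x. iterated_partial is \<phi> x *\<^sub>R f x \<partial>lborel) = (- 1) ^ (\<Sum>i\<in>UNIV. j i) *\<^sub>R (\<integral>x. \<phi> x *\<^sub>R f' x \<partial>lborel)"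
      using f t unfolding has_weak_deriv_def by blast
    moreover have "(\<integral>x. iterated_partial is \<phi> x *\<^sub>R g x \<partial>lborel) = (- 1) ^ (\<Sum>i\<in>UNIV. j i) *\<^sub>R (\<integral>x. \<phi> x *\<^sub>R g' x \<partial>lborel)"
      using g t unfolding has_weak_deriv_def by blast
    ultimately show ?thesis
      using l by (simp add: scaleR_diff_right i1 i2)
  qed
  then show ?thesis
    using l by (simp add: has_weak_deriv_def locally_integrable_diff)
qed

lemma has_weak_deriv_0:
  assumes "locally_integrable f"
  shows "has_weak_deriv (\<lambda>_. 0) f f"
proof -
  have "iterated_partial is \<phi> = \<phi>" if "\<forall>i. count_list is i = 0" for "is" :: "'a list" and \<phi>
  proof (cases "is")
    case (Cons i js)
    with that[rule_format, of i] show ?thesis by simp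
  qed simp
  then show ?thesis using assms by (auto simp: has_weak_deriv_def)
qed

lemma has_weak_deriv_weak_deriv: "has_weak_deriv j f g \<Longrightarrow> has_weak_deriv j f (weak_deriv j f)"
  unfolding weak_deriv_def by (rule someI[where P = "has_weak_deriv j f"])

lemma weak_deriv_AE_eq:
  assumes "has_weak_deriv j f g"
  shows "AE x in lborel. weak_deriv j f x = g x"
  by (rule has_weak_deriv_unique[OF has_weak_deriv_weak_deriv[OF assms] assms])

section \<open>The maximal function\<close>

lemma norm_diff_le_nn_integral_segment:
  fixes e :: "'a::euclidean_space \<Rightarrow> 'b::euclidean_space"
  assumes der: "\<And>y. (e has_derivative e' y) (at y)"
    and bd: "\<And>y h. norm (e' y h) \<le> norm h * N y" and N: "continuous_on UNIV N"
  shows "ennreal (norm (e z - e x))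
    \<le> (\<integral>\<^sup>+t\<in>{0..1}. ennreal (norm (z - x)) * ennreal (N (x + t *\<^sub>R (z - x))) \<partial>lborel)"
proof (cases "z = x")
  case False
  have N0: "0 \<le> N y" for y
    using bd[of y "z - x"] False by (metis norm_ge_zero order_trans zero_le_mult_iff
        less_le_not_le zero_less_norm_iff right_minus_eq)
  let ?g = "\<lambda>t. norm (z - x) * N (x + t *\<^sub>R (z - x))"
  have contg: "continuous_on {0..1::real} ?g"
    by (intro continuous_intros continuous_on_compose2[OF N]) auto
  have "((\<lambda>t. e' (x + t *\<^sub>R (z - x)) (z - x)) has_integral
      e (x + 1 *\<^sub>R (z - x)) - e (x + 0 *\<^sub>R (z - x))) {0..1}"
  proof (rule fundamental_theorem_of_calculus)
    fix t :: real
    have "((\<lambda>t. e (x + t *\<^sub>R (z - x))) has_derivative (\<lambda>h. e' (x + t *\<^sub>R (z - x)) (h *\<^sub>R (z - x)))) (at t within {0..1})"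
      by (rule has_derivative_compose[OF _ der]) (auto intro!: derivative_eq_intros)
    moreover have "e' (x + t *\<^sub>R (z - x)) (h *\<^sub>R (z - x)) = h *\<^sub>R e' (x + t *\<^sub>R (z - x)) (z - x)" for h
      using has_derivative_bounded_linear[OF der] linear_scale bounded_linear.linear by blast
    ultimately show "((\<lambda>t. e (x + t *\<^sub>R (z - x))) has_vector_derivative e' (x + t *\<^sub>R (z - x)) (z - x)) (at t within {0..1})"
      by (simp add: has_vector_derivative_def)
  qed simp
  then have hi: "((\<lambda>t. e' (x + t *\<^sub>R (z - x)) (z - x)) has_integral e z - e x) {0..1}" by simp
  have "norm (e z - e x) \<le> integral {0..1} ?g"
    using integral_norm_bound_integral[of "\<lambda>t. e' (x + t *\<^sub>R (z - x)) (z - x)" "{0..1}" ?g] hi bd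
      integrable_continuous_real[OF contg] by (auto simp: has_integral_iff)
  also have "\<dots> = (LINT t:{0..1}|lborel. ?g t)"
    by (rule set_borel_integral_eq_integral(2)[symmetric]) (rule borel_integrable_atLeastAtMost', rule contg)
  finally have "ennreal (norm (e z - e x)) \<le> ennreal (LINT t:{0..1}|lborel. ?g t)" by (rule ennreal_leI)
  also have "\<dots> = (\<integral>\<^sup>+t. ennreal (indicator {0..1} t *\<^sub>R ?g t) \<partial>lborel)"
    unfolding set_lebesgue_integral_def
    using borel_integrable_atLeastAtMost'[OF contg] N0
    by (intro nn_integral_eq_integral[symmetric]) (auto simp: set_integrable_def)
  also have "\<dots> = (\<integral>\<^sup>+t\<in>{0..1}. ennreal (norm (z - x)) * ennreal (N (x + t *\<^sub>R (z - x))) \<partial>lborel)"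
    by (intro nn_integral_cong) (auto simp: indicator_def ennreal_mult N0)
  finally show ?thesis .
qed simp

lemma nn_integral_ball_dilation:
  fixes h :: "'a::euclidean_space \<Rightarrow> ennreal"
  assumes [measurable]: "h \<in> borel_measurable borel" and t: "0 < t"
  shows "(\<integral>\<^sup>+w\<in>ball x (t * r). h w \<partial>lborel)
      = ennreal (t ^ DIM('a)) * (\<integral>\<^sup>+z\<in>ball x r. h (x + t *\<^sub>R (z - x)) \<partial>lborel)"
proof -
  let ?T = "\<lambda>z. (x - t *\<^sub>R x) + t *\<^sub>R z"
  have m [measurable]: "(\<lambda>w. h w * indicator (ball x (t * r)) w) \<in> borel_measurable borel"
    by measurable
  have mT: "(\<lambda>z. h (?T z) * indicator (ball x (t * r)) (?T z)) \<in> borel_measurable borel"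
    by (rule measurable_compose[OF _ m]) measurable
  have "(\<integral>\<^sup>+w\<in>ball x (t * r). h w \<partial>lborel)
      = (\<integral>\<^sup>+w. h w * indicator (ball x (t * r)) w \<partial>density (distr lborel borel ?T) (\<lambda>_. \<bar>t\<bar> ^ DIM('a)))"
    using lborel_affine[of t "x - t *\<^sub>R x"] t by simp
  also have "\<dots> = (\<integral>\<^sup>+w. ennreal (\<bar>t\<bar> ^ DIM('a)) * (h w * indicator (ball x (t * r)) w) \<partial>distr lborel borel ?T)"
    using m by (subst nn_integral_density) (auto simp: ennreal_power)
  also have "\<dots> = (\<integral>\<^sup>+z. ennreal (\<bar>t\<bar> ^ DIM('a)) * (h (?T z) * indicator (ball x (t * r)) (?T z)) \<partial>lborel)"
    using m by (subst nn_integral_distr) auto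
  also have "\<dots> = ennreal (\<bar>t\<bar> ^ DIM('a)) * (\<integral>\<^sup>+z. h (?T z) * indicator (ball x (t * r)) (?T z) \<partial>lborel)"
    using mT by (intro nn_integral_cmult) auto
  also have "(\<integral>\<^sup>+z. h (?T z) * indicator (ball x (t * r)) (?T z) \<partial>lborel)
      = (\<integral>\<^sup>+z\<in>ball x r. h (x + t *\<^sub>R (z - x)) \<partial>lborel)"
  proof (rule nn_integral_cong)
    fix z
    have eq: "?T z = x + t *\<^sub>R (z - x)" by (simp add: algebra_simps)
    have "?T z \<in> ball x (t * r) \<longleftrightarrow> z \<in> ball x r"
      unfolding eq using t by (simp add: dist_norm norm_minus_commute)
    then show "h (?T z) * indicator (ball x (t * r)) (?T z) = h (x + t *\<^sub>R (z - x)) * indicator (ball x r) z"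
      unfolding eq by (simp add: indicator_def)
  qed
  finally show ?thesis using t by simp
qed

text \<open>
  Integrate the bound of \<open>norm_diff_le_nn_integral_segment\<close> over \<open>z\<close> and exchange integrals. For fixed \<open>t\<close> the
  points \<open>x + t (z - x)\<close> fill the ball of radius \<open>t r\<close>, where the maximal bound applies; the Jacobian
  \<open>t\<^sup>-\<^sup>d\<close> of the dilation cancels the factor \<open>t\<^sup>d\<close> of that bound.
\<close>

lemma nn_integral_ball_diff_le:
  fixes e :: "'a::euclidean_space \<Rightarrow> 'b::euclidean_space"
  assumes der: "\<And>y. (e has_derivative e' y) (at y)"
    and bd: "\<And>y h. norm (e' y h) \<le> norm h * N y" and N: "continuous_on UNIV N"
    and r: "0 < r" and M: "0 \<le> M"
    and max: "\<And>s. 0 < s \<Longrightarrow> s \<le> r \<Longrightarrow> (\<integral>\<^sup>+z\<in>ball x s. ennreal (N z) \<partial>lborel) \<le> ennreal (M * s ^ DIM('a))"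
  shows "(\<integral>\<^sup>+z\<in>ball x r. ennreal (norm (e z - e x)) \<partial>lborel) \<le> ennreal (M * r ^ (DIM('a) + 1))"
proof -
  have [measurable]: "N \<in> borel_measurable borel"
    by (intro borel_measurable_continuous_onI N)
  have "(\<integral>\<^sup>+z\<in>ball x r. ennreal (norm (e z - e x)) \<partial>lborel)
      \<le> (\<integral>\<^sup>+z. (\<integral>\<^sup>+t. ennreal r * (ennreal (N (x + t *\<^sub>R (z - x))) * indicator (ball x r) z * indicator {0..1} t) \<partial>lborel) \<partial>lborel)"
  proof (rule nn_integral_mono)
    fix z
    show "ennreal (norm (e z - e x)) * indicator (ball x r) z
      \<le> (\<integral>\<^sup>+t. ennreal r * (ennreal (N (x + t *\<^sub>R (z - x))) * indicator (ball x r) z * indicator {0..1} t) \<partial>lborel)"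
    proof (cases "z \<in> ball x r")
      case True
      have "ennreal (norm (e z - e x)) \<le> (\<integral>\<^sup>+t\<in>{0..1}. ennreal (norm (z - x)) * ennreal (N (x + t *\<^sub>R (z - x))) \<partial>lborel)"
        by (rule norm_diff_le_nn_integral_segment[OF der bd N])
      also have "\<dots> \<le> (\<integral>\<^sup>+t. ennreal r * (ennreal (N (x + t *\<^sub>R (z - x))) * indicator (ball x r) z * indicator {0..1} t) \<partial>lborel)"
        using True by (intro nn_integral_mono)
          (auto simp: indicator_def dist_norm norm_minus_commute intro!: mult_right_mono ennreal_leI)
      finally show ?thesis using True by simp
    qed simp
  qed
  also have "\<dots> = (\<integral>\<^sup>+t. (\<integral>\<^sup>+z. ennreal r * (ennreal (N (x + t *\<^sub>R (z - x))) * indicator (ball x r) z * indicator {0..1} t) \<partial>lborel) \<partial>lborel)"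
    by (rule lborel_pair.Fubini'[symmetric]) measurable
  also have "\<dots> \<le> (\<integral>\<^sup>+t. ennreal (M * r ^ (DIM('a) + 1)) * indicator {0..1::real} t \<partial>lborel)"
  proof (rule nn_integral_mono_AE)
    \<comment> \<open>At zero the dilation degenerates.\<close>
  have "AE t::real in lborel. t \<noteq> 0" by (rule AE_lborel_singleton)
    then show "AE t in lborel. (\<integral>\<^sup>+z. ennreal r * (ennreal (N (x + t *\<^sub>R (z - x))) * indicator (ball x r) z * indicator {0..1} t) \<partial>lborel)
        \<le> ennreal (M * r ^ (DIM('a) + 1)) * indicator {0..1::real} t"
    proof (rule AE_mp, intro AE_I2 impI)
      fix t :: real assume t0: "t \<noteq> 0"
      show "(\<integral>\<^sup>+z. ennreal r * (ennreal (N (x + t *\<^sub>R (z - x))) * indicator (ball x r) z * indicator {0..1} t) \<partial>lborel)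
        \<le> ennreal (M * r ^ (DIM('a) + 1)) * indicator {0..1::real} t"
      proof (cases "t \<in> {0..1}")
        case True
        then have t: "0 < t" "t \<le> 1" using t0 by auto
        let ?I = "\<integral>\<^sup>+z\<in>ball x r. ennreal (N (x + t *\<^sub>R (z - x))) \<partial>lborel"
        have "ennreal (t ^ DIM('a)) * ?I = (\<integral>\<^sup>+w\<in>ball x (t * r). ennreal (N w) \<partial>lborel)"
          using t by (intro nn_integral_ball_dilation[symmetric]) auto
        also have "\<dots> \<le> ennreal (M * (t * r) ^ DIM('a))"
          using t r by (intro max) (auto simp: mult_left_le_one_le)
        also have "\<dots> = ennreal (t ^ DIM('a)) * ennreal (M * r ^ DIM('a))"
          using t M r by (simp add: power_mult_distrib ac_simps flip: ennreal_mult)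
        finally have I: "?I \<le> ennreal (M * r ^ DIM('a))"
          using t by (subst (asm) ennreal_mult_le_mult_iff) auto
        have "(\<integral>\<^sup>+z. ennreal r * (ennreal (N (x + t *\<^sub>R (z - x))) * indicator (ball x r) z * indicator {0..1} t) \<partial>lborel)
          = ennreal r * ?I"
          using True by (simp add: nn_integral_cmult)
        also have "\<dots> \<le> ennreal r * ennreal (M * r ^ DIM('a))" by (intro mult_left_mono I) auto
        also have "\<dots> = ennreal (M * r ^ (DIM('a) + 1))"
          using r M by (simp add: ac_simps flip: ennreal_mult)
        finally show ?thesis using True by simp
      qed simp
    qed
  qed
  also have "\<dots> = ennreal (M * r ^ (DIM('a) + 1))"
    by (subst nn_integral_cmult_indicator) auto
  finally show ?thesis .
qed

text \<open>
  A pointwise Sobolev inequality: compare \<open>e x\<close> and \<open>e y\<close> with the values of \<open>e\<close> on the ball with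
  diameter \<open>[x, y]\<close>, which lies in both balls of radius \<open>\<parallel>x - y\<parallel>\<close> around \<open>x\<close> and \<open>y\<close>, and average.
\<close>

lemma norm_diff_le_maximal:
  fixes e :: "'a::euclidean_space \<Rightarrow> 'b::euclidean_space"
  assumes der: "\<And>y. (e has_derivative e' y) (at y)"
    and bd: "\<And>y h. norm (e' y h) \<le> norm h * N y" and N: "continuous_on UNIV N"
    and M: "0 \<le> M" and xy: "dist x y \<le> 1"
    and maxx: "\<And>s. 0 < s \<Longrightarrow> s \<le> 1 \<Longrightarrow> (\<integral>\<^sup>+z\<in>ball x s. ennreal (N z) \<partial>lborel) \<le> ennreal (M * s ^ DIM('a))"
    and maxy: "\<And>s. 0 < s \<Longrightarrow> s \<le> 1 \<Longrightarrow> (\<integral>\<^sup>+z\<in>ball y s. ennreal (N z) \<partial>lborel) \<le> ennreal (M * s ^ DIM('a))"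
  shows "norm (e x - e y) \<le> (2 ^ (DIM('a) + 1) / unit_ball_vol (DIM('a))) * M * norm (x - y)"
proof (cases "x = y")
  case False
  define r where "r = dist x y"
  have r: "0 < r" "r \<le> 1" using False xy by (auto simp: r_def)
  define c where "c = (1 / 2) *\<^sub>R (x + y)"
  have ce: "continuous_on UNIV e"
    by (meson der continuous_at_imp_continuous_on has_derivative_continuous)
  have [measurable]: "e \<in> borel_measurable borel" by (intro borel_measurable_continuous_onI ce)
  have dcx: "dist c x = r / 2" and dcy: "dist c y = r / 2"
  proof -
    have "c - x = (1 / 2) *\<^sub>R (y - x)" "c - y = (1 / 2) *\<^sub>R (x - y)"
      by (auto simp: c_def algebra_simps simp flip: scaleR_left.add)
    then show "dist c x = r / 2" "dist c y = r / 2"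
      by (simp_all add: dist_norm r_def norm_minus_commute)
  qed
  have sub: "ball c (r / 2) \<subseteq> ball x r" "ball c (r / 2) \<subseteq> ball y r"
    using dcx dcy by (auto simp: ball_subset_ball_iff)
  have "ennreal (norm (e x - e y)) * emeasure lborel (ball c (r / 2))
      = (\<integral>\<^sup>+z\<in>ball c (r / 2). ennreal (norm (e x - e y)) \<partial>lborel)"
    by (rule nn_integral_cmult_indicator[symmetric]) auto
  also have "\<dots> \<le> (\<integral>\<^sup>+z. ennreal (norm (e z - e x)) * indicator (ball x r) z
      + ennreal (norm (e z - e y)) * indicator (ball y r) z \<partial>lborel)"
  proof (rule nn_integral_mono)
    fix z
    show "ennreal (norm (e x - e y)) * indicator (ball c (r / 2)) z
      \<le> ennreal (norm (e z - e x)) * indicator (ball x r) z + ennreal (norm (e z - e y)) * indicator (ball y r) z"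
    proof (cases "z \<in> ball c (r / 2)")
      case True
      then have "z \<in> ball x r" "z \<in> ball y r" using sub by auto
      moreover have "norm (e x - e y) \<le> norm (e z - e x) + norm (e z - e y)"
        by (metis norm_minus_commute norm_triangle_sub norm_diff_triangle_le order_refl)
      ultimately show ?thesis using True by (simp flip: ennreal_plus)
    qed simp
  qed
  also have "\<dots> = (\<integral>\<^sup>+z\<in>ball x r. ennreal (norm (e z - e x)) \<partial>lborel)
      + (\<integral>\<^sup>+z\<in>ball y r. ennreal (norm (e z - e y)) \<partial>lborel)"
    by (rule nn_integral_add) auto
  also have "\<dots> \<le> ennreal (M * r ^ (DIM('a) + 1)) + ennreal (M * r ^ (DIM('a) + 1))"
    using r by (intro add_mono nn_integral_ball_diff_le[OF der bd N] M maxx maxy) auto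
  finally have "ennreal (norm (e x - e y)) * ennreal (unit_ball_vol (DIM('a)) * (r / 2) ^ DIM('a))
      \<le> ennreal (2 * (M * r ^ (DIM('a) + 1)))"
    using r M by (simp add: emeasure_ball flip: ennreal_plus)
  then have "norm (e x - e y) * (unit_ball_vol (DIM('a)) * (r / 2) ^ DIM('a)) \<le> 2 * (M * r ^ (DIM('a) + 1))"
    using r M by (subst (asm) ennreal_mult[symmetric]) (auto simp: ennreal_le_iff)
  moreover have "unit_ball_vol (real DIM('a)) > 0" by simp
  ultimately have "norm (e x - e y) \<le> (2 ^ (DIM('a) + 1) / unit_ball_vol (DIM('a))) * M * r"
    using r by (simp add: field_simps)
  then show ?thesis by (simp add: r_def dist_norm)
qed simp

text \<open>
  The set where the maximal function of \<open>H\<close>, restricted to radii at most \<open>1\<close>, is at most \<open>m\<close>, up to the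
  volume of the unit ball.
\<close>

definition maximal_good :: "('a::euclidean_space \<Rightarrow> ennreal) \<Rightarrow> real \<Rightarrow> 'a set" where
  "maximal_good H m = {x. \<forall>r. 0 < r \<and> r \<le> 1 \<longrightarrow> (\<integral>\<^sup>+z\<in>ball x r. H z \<partial>lborel) \<le> ennreal (m * r ^ DIM('a))}"

text \<open>
  Integrals over open balls are lower semicontinuous in the centre, by Fatou's lemma.
\<close>

lemma closed_maximal_good:
  fixes H :: "'a::euclidean_space \<Rightarrow> ennreal"
  assumes [measurable]: "H \<in> borel_measurable borel"
  shows "closed (maximal_good H m)"
  unfolding closed_sequential_limits
proof safe
  fix X x assume X: "\<forall>n. X n \<in> maximal_good H m" "X \<longlonglongrightarrow> x"
  show "x \<in> maximal_good H m"
    unfolding maximal_good_def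
  proof safe
    fix r :: real assume r: "0 < r" "r \<le> 1"
    have "(\<integral>\<^sup>+z\<in>ball x r. H z \<partial>lborel) \<le> (\<integral>\<^sup>+z. liminf (\<lambda>n. H z * indicator (ball (X n) r) z) \<partial>lborel)"
    proof (rule nn_integral_mono)
      fix z
      show "H z * indicator (ball x r) z \<le> liminf (\<lambda>n. H z * indicator (ball (X n) r) z)"
      proof (cases "z \<in> ball x r")
        case True
        have "(\<lambda>n. dist (X n) z) \<longlonglongrightarrow> dist x z" by (intro tendsto_intros X)
        then have "\<forall>\<^sub>F n in sequentially. dist (X n) z < r"
          using True by (intro order_tendstoD) auto
        then have "\<forall>\<^sub>F n in sequentially. H z \<le> H z * indicator (ball (X n) r) z"
          by (rule eventually_mono) auto
        then have "H z \<le> liminf (\<lambda>n. H z * indicator (ball (X n) r) z)"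
          by (rule Liminf_bounded)
        then show ?thesis using True by simp
      qed simp
    qed
    also have "\<dots> \<le> liminf (\<lambda>n. \<integral>\<^sup>+z. H z * indicator (ball (X n) r) z \<partial>lborel)"
      by (rule nn_integral_liminf) measurable
    also have "\<dots> \<le> limsup (\<lambda>n. \<integral>\<^sup>+z. H z * indicator (ball (X n) r) z \<partial>lborel)"
      by (rule Liminf_le_Limsup) simp
    also have "\<dots> \<le> ennreal (m * r ^ DIM('a))"
      using X(1) r by (intro Limsup_bounded always_eventually) (auto simp: maximal_good_def)
    finally show "(\<integral>\<^sup>+z\<in>ball x r. H z \<partial>lborel) \<le> ennreal (m * r ^ DIM('a))" .
  qed
qed

text \<open>
  The weak-type inequality of Hardy and Littlewood. Every bad point is the centre of a ball on which the
  integral of \<open>H\<close> is large; Vitali's lemma selects disjoint ones among these balls whose fivefold dilations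
  still cover the bad set.
\<close>

lemma emeasure_maximal_bad_le:
  fixes H :: "'a::euclidean_space \<Rightarrow> ennreal"
  assumes [measurable]: "H \<in> borel_measurable borel" and m: "0 < m"
  shows "emeasure lborel (- maximal_good H m)
    \<le> ennreal (5 ^ DIM('a) * unit_ball_vol (DIM('a)) / m) * (\<integral>\<^sup>+x. H x \<partial>lborel)"
proof -
  let ?K = "- maximal_good H m"
  have "\<forall>x\<in>?K. \<exists>r. 0 < r \<and> r \<le> 1 \<and> ennreal (m * r ^ DIM('a)) < (\<integral>\<^sup>+z\<in>ball x r. H z \<partial>lborel)"
    by (auto simp: maximal_good_def not_le)
  then obtain r where r: "\<And>x. x \<in> ?K \<Longrightarrow> 0 < r x \<and> r x \<le> 1"
    "\<And>x. x \<in> ?K \<Longrightarrow> ennreal (m * r x ^ DIM('a)) < (\<integral>\<^sup>+z\<in>ball x (r x). H z \<partial>lborel)"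
    by metis
  have "?K \<subseteq> (\<Union>i\<in>?K. ball i (r i))" using r(1) by force
  then obtain C where C: "countable C" "C \<subseteq> ?K"
     "pairwise (\<lambda>i j. disjnt (ball i (r i)) (ball j (r j))) C" "?K \<subseteq> (\<Union>i\<in>C. ball i (5 * r i))"
    using Vitali_covering_lemma_balls[where S = "?K" and K = "?K" and a = "\<lambda>i. i" and r = r and B = 1] r(1) by auto
  define g where "g n = from_nat_into C n" for n
  define J where "J = to_nat_on C ` C"
  have gC: "g n \<in> C" and inj: "to_nat_on C (g n) = n" if "n \<in> J" for n
    using that C(1) by (auto simp: g_def J_def)
  have surj: "\<exists>n\<in>J. g n = i" if "i \<in> C" for i
    using that C(1) by (auto simp: g_def J_def)
  \<comment> \<open>The selected balls, dilated by the factor k and enumerated by the natural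
    numbers.\<close>
  define B where "B k n = (if n \<in> J then ball (g n) (k * r (g n)) else {})" for k :: real and n
  have [measurable]: "B k n \<in> sets borel" for k n by (simp add: B_def)
  have disj: "disjoint_family (B 1)"
    unfolding disjoint_family_on_def
  proof safe
    fix a b x assume ab: "a \<noteq> b" "x \<in> B 1 a" "x \<in> B 1 b"
    then have J: "a \<in> J" "b \<in> J" by (auto simp: B_def split: if_splits)
    then have "g a \<noteq> g b" using ab inj by metis
    then have "disjnt (ball (g a) (r (g a))) (ball (g b) (r (g b)))"
      using C(3) gC J by (auto simp: pairwise_def)
    then show "x \<in> {}" using ab J by (auto simp: B_def disjnt_def)
  qed
  define c where "c = 5 ^ DIM('a) * unit_ball_vol (DIM('a)) / m"
  have c0: "0 \<le> c" using m by (simp add: c_def)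
  let ?N = "density lborel H"
  have B5: "emeasure lborel (B 5 n) \<le> ennreal c * emeasure ?N (B 1 n)" for n
  proof (cases "n \<in> J")
    case True
    then have K: "g n \<in> ?K" using gC C(2) by blast
    let ?r = "r (g n)"
    have "emeasure lborel (B 5 n) = ennreal (unit_ball_vol (DIM('a)) * (5 * ?r) ^ DIM('a))"
      using True r(1)[OF K] by (simp add: B_def emeasure_ball)
    also have "\<dots> = ennreal c * ennreal (m * ?r ^ DIM('a))"
      using m r(1)[OF K] by (simp add: c_def power_mult_distrib flip: ennreal_mult)
    also have "\<dots> \<le> ennreal c * (\<integral>\<^sup>+z\<in>ball (g n) ?r. H z \<partial>lborel)"
      using r(2)[OF K] by (intro mult_left_mono) auto
    also have "\<dots> = ennreal c * emeasure ?N (B 1 n)"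
      using True by (simp add: emeasure_density B_def)
    finally show ?thesis .
  qed (simp add: B_def)
  have "emeasure lborel ?K \<le> emeasure lborel (\<Union>n. B 5 n)"
  proof (rule emeasure_mono)
    show "?K \<subseteq> (\<Union>n. B 5 n)"
    proof
      fix x assume "x \<in> ?K"
      then obtain i where i: "i \<in> C" "x \<in> ball i (5 * r i)" using C(4) by blast
      then obtain n where "n \<in> J" "g n = i" using surj by blast
      then show "x \<in> (\<Union>n. B 5 n)" using i by (auto simp: B_def)
    qed
  qed auto
  also have "\<dots> \<le> (\<Sum>n. emeasure lborel (B 5 n))"
    by (rule emeasure_subadditive_countably) auto
  also have "\<dots> \<le> (\<Sum>n. ennreal c * emeasure ?N (B 1 n))"
    by (intro suminf_le B5) auto
  also have "\<dots> = ennreal c * (\<Sum>n. emeasure ?N (B 1 n))" by simp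
  also have "(\<Sum>n. emeasure ?N (B 1 n)) = emeasure ?N (\<Union>n. B 1 n)"
    using disj by (intro suminf_emeasure) auto
  also have "\<dots> \<le> emeasure ?N UNIV" by (intro emeasure_mono) auto
  also have "\<dots> = (\<integral>\<^sup>+x. H x \<partial>lborel)" by (simp add: emeasure_density)
  finally show ?thesis by (simp add: c_def mult_left_mono)
qed

lemma AE_maximal_good:
  fixes H :: "'a::euclidean_space \<Rightarrow> ennreal"
  assumes H [measurable]: "H \<in> borel_measurable borel" and fin: "(\<integral>\<^sup>+x. H x \<partial>lborel) < \<infinity>"
  shows "AE x in lborel. \<exists>m::nat. x \<in> maximal_good H (real m)"
proof -
  have [measurable]: "maximal_good H m \<in> sets borel" for m
    by (intro borel_closed closed_maximal_good H)
  let ?B = "\<Inter>m::nat. - maximal_good H (real m)"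
  let ?c = "5 ^ DIM('a) * unit_ball_vol (DIM('a))"
  obtain I where I: "(\<integral>\<^sup>+x. H x \<partial>lborel) = ennreal I" "0 \<le> I"
    using fin by (cases "\<integral>\<^sup>+x. H x \<partial>lborel") auto
  have le: "emeasure lborel ?B \<le> ennreal (?c * I / real (Suc n))" for n
  proof -
    have "emeasure lborel ?B \<le> emeasure lborel (- maximal_good H (real (Suc n)))"
      by (intro emeasure_mono) (auto simp del: of_nat_Suc)
    also have "\<dots> \<le> ennreal (?c / real (Suc n)) * ennreal I"
      unfolding I(1)[symmetric] by (rule emeasure_maximal_bad_le) auto
    finally show ?thesis using I by (simp flip: ennreal_mult)
  qed
  have "(\<lambda>n. ennreal (?c * I / real (Suc n))) \<longlonglongrightarrow> ennreal 0"
    by (intro tendsto_ennrealI LIMSEQ_Suc lim_const_over_n)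
  then have "emeasure lborel ?B \<le> 0"
    using le by (intro LIMSEQ_le_const) auto
  then have "AE x in lborel. x \<notin> ?B"
    by (intro AE_not_in) (auto simp: null_sets_def)
  then show ?thesis by simp
qed

section \<open>Relative differentiability of weakly differentiable functions\<close>

text \<open>
  For \<open>l \<ge> k\<close> the gradient of \<open>u\<^sub>l - u\<^sub>k\<close> is dominated by \<open>2 \<cdot> 2\<^sup>-\<^sup>k H\<close>, so \<open>norm_diff_le_maximal\<close> bounds its
  Lipschitz constant on \<open>S\<close> by a multiple of \<open>2\<^sup>-\<^sup>k m\<close>. Letting \<open>l\<close> tend to infinity gives the same for
  \<open>f - u\<^sub>k\<close>. Hence, relative to \<open>S\<close>, the increments of \<open>f\<close> are those of the differentiable \<open>u\<^sub>k\<close> up to an error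
  that is small uniformly in the distance to \<open>x\<close>.
\<close>

lemma lusin_differentiable:
  fixes f :: "real^'n \<Rightarrow> 'b::euclidean_space" and u :: "nat \<Rightarrow> real^'n \<Rightarrow> 'b"
    and V :: "nat \<Rightarrow> 'n \<Rightarrow> real^'n \<Rightarrow> 'b" and H :: "real^'n \<Rightarrow> ennreal"
  assumes der: "\<And>k y. (u k has_derivative (\<lambda>h. \<Sum>i\<in>UNIV. h $ i *\<^sub>R V k i y)) (at y)"
    and contV: "\<And>k i. continuous_on UNIV (V k i)"
    and H [measurable]: "H \<in> borel_measurable borel"
    and bu: "\<And>k y. y \<in> ball 0 (R + 1) \<Longrightarrow> ennreal (norm (u k y - f y)) \<le> ennreal ((1/2)^k) * H y"
    and bV: "\<And>k y. y \<in> ball 0 (R + 1) \<Longrightarrow> ennreal (\<Sum>i\<in>UNIV. norm (V k i y - g i y)) \<le> ennreal ((1/2)^k) * H y"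
    and m: "0 \<le> m"
    and S: "S = maximal_good H m \<inter> {y \<in> ball 0 R. H y < \<infinity>}" and x: "x \<in> S"
  shows "(f has_derivative (\<lambda>h. \<Sum>i\<in>UNIV. h $ i *\<^sub>R g i x)) (at x within S)"
proof -
  define A where "A = 2 ^ (DIM(real^'n) + 1) / unit_ball_vol (real DIM(real^'n)) * (2 * m)"
  have A0: "0 \<le> A" using m by (simp add: A_def)
  have inR: "z \<in> ball 0 (R + 1)" if "y \<in> S" "z \<in> ball y s" "s \<le> 1" for y z s
    using that norm_triangle_ineq[of y "z - y"] by (auto simp: S dist_norm norm_minus_commute)
  have conv: "(\<lambda>k. u k y) \<longlonglongrightarrow> f y" if y: "y \<in> S" for y
  proof -
    obtain c where c: "H y = ennreal c" "0 \<le> c" using y by (cases "H y") (auto simp: S)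
    have "norm (u k y - f y) \<le> (1/2)^k * c" for k
      using bu[of y k] y c by (auto simp: S simp flip: ennreal_mult)
    moreover have "(\<lambda>k. (1/2)^k * c) \<longlonglongrightarrow> 0"
      by (auto intro!: tendsto_eq_intros LIMSEQ_realpow_zero)
    ultimately have "(\<lambda>k. u k y - f y) \<longlonglongrightarrow> 0"
      using Lim_null_comparison[of "\<lambda>k. u k y - f y" "\<lambda>k. (1/2)^k * c" sequentially]
      by (simp add: always_eventually)
    then show ?thesis by (simp add: LIM_zero_iff)
  qed
  have lip: "norm ((f x - u k x) - (f y - u k y)) \<le> A * (1/2)^k * norm (x - y)"
    if x: "x \<in> S" and y: "y \<in> S" and xy: "dist x y \<le> 1" for x y k
  proof -
    have *: "norm ((u l x - u k x) - (u l y - u k y)) \<le> A * (1/2)^k * norm (x - y)" if l: "k \<le> l" for l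
    proof -
      define N where "N z = (\<Sum>i\<in>UNIV. norm (V l i z - V k i z))" for z
      have N: "ennreal (N z) \<le> ennreal (2 * (1/2)^k) * H z" if z: "z \<in> ball 0 (R + 1)" for z
      proof -
        have "N z \<le> (\<Sum>i\<in>UNIV. norm (V l i z - g i z) + norm (V k i z - g i z))"
          unfolding N_def by (intro sum_mono) (metis norm_triangle_ineq4 add_diff_cancel diff_diff_eq2 diff_add_cancel)
        then have "ennreal (N z) \<le> ennreal (\<Sum>i\<in>UNIV. norm (V l i z - g i z)) + ennreal (\<Sum>i\<in>UNIV. norm (V k i z - g i z))"
          by (simp add: sum.distrib sum_nonneg flip: ennreal_plus)
        also have "\<dots> \<le> ennreal ((1/2)^l) * H z + ennreal ((1/2)^k) * H z"
          by (intro add_mono bV z)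
        also have "\<dots> \<le> ennreal ((1/2)^k) * H z + ennreal ((1/2)^k) * H z"
          using l by (intro add_mono mult_right_mono ennreal_leI power_decreasing) auto
        also have "\<dots> = ennreal (2 * (1/2)^k) * H z"
        proof -
          have "ennreal (2 * (1/2)^k) = ennreal ((1/2)^k) + ennreal ((1/2)^k)"
            by (subst mult_2, rule ennreal_plus) auto
          then show ?thesis by (simp only: distrib_right)
        qed
        finally show ?thesis .
      qed
      have maxN: "(\<integral>\<^sup>+z\<in>ball w s. ennreal (N z) \<partial>lborel) \<le> ennreal ((2 * (1/2)^k * m) * s ^ DIM(real^'n))"
        if w: "w \<in> S" and s: "0 < s" "s \<le> 1" for w s
      proof -
        have "(\<integral>\<^sup>+z\<in>ball w s. ennreal (N z) \<partial>lborel) \<le> (\<integral>\<^sup>+z. ennreal (2 * (1/2)^k) * (H z * indicator (ball w s) z) \<partial>lborel)"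
        proof (rule nn_integral_mono)
          fix z show "ennreal (N z) * indicator (ball w s) z \<le> ennreal (2 * (1/2)^k) * (H z * indicator (ball w s) z)"
            using N[of z] inR[OF w, of z s] s by (auto simp: indicator_def)
        qed
        also have "\<dots> = ennreal (2 * (1/2)^k) * (\<integral>\<^sup>+z\<in>ball w s. H z \<partial>lborel)"
          by (rule nn_integral_cmult) measurable
        also have "\<dots> \<le> ennreal (2 * (1/2)^k) * ennreal (m * s ^ DIM(real^'n))"
          using w s by (intro mult_left_mono) (auto simp: S maximal_good_def)
        also have "\<dots> = ennreal ((2 * (1/2)^k * m) * s ^ DIM(real^'n))"
          using m s by (simp add: mult.assoc flip: ennreal_mult)
        finally show ?thesis .
      qed
      \<comment> \<open>Here the maximal function enters: it bounds the averages of the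
        gradient N of the difference around x and y.\<close>
      have "norm ((\<lambda>z. u l z - u k z) x - (\<lambda>z. u l z - u k z) y)
          \<le> 2 ^ (DIM(real^'n) + 1) / unit_ball_vol (real DIM(real^'n)) * (2 * (1/2)^k * m) * norm (x - y)"
      proof (rule norm_diff_le_maximal[where e' = "\<lambda>y h. \<Sum>i\<in>UNIV. h $ i *\<^sub>R (V l i y - V k i y)" and N = N])
        show "((\<lambda>z. u l z - u k z) has_derivative (\<lambda>h. \<Sum>i\<in>UNIV. h $ i *\<^sub>R (V l i z - V k i z))) (at z)" for z
          by (rule has_derivative_eq_rhs[OF has_derivative_diff[OF der der]])
             (simp add: scaleR_diff_right sum_subtractf)
        show "norm (\<Sum>i\<in>UNIV. h $ i *\<^sub>R (V l i z - V k i z)) \<le> norm h * N z" for z h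
          unfolding N_def sum_distrib_left
          by (rule sum_norm_le) (auto intro!: mult_right_mono component_le_norm_cart)
        show "continuous_on UNIV N"
          unfolding N_def[abs_def] by (intro continuous_intros contV)
      qed (use m xy x y maxN in auto)
      then show ?thesis by (simp add: A_def ac_simps)
    qed
    have "(\<lambda>l. norm ((u l x - u k x) - (u l y - u k y))) \<longlonglongrightarrow> norm ((f x - u k x) - (f y - u k y))"
      by (intro tendsto_intros conv x y)
    then show ?thesis
      by (rule LIMSEQ_le_const2) (use * in blast)
  qed
  show ?thesis
    unfolding has_derivative_within_alt
  proof (intro conjI allI impI)
    show "bounded_linear (\<lambda>h. \<Sum>i\<in>UNIV. h $ i *\<^sub>R g i x)"
      by (intro bounded_linear_sum bounded_linear_scaleR_const bounded_linear_vec_nth)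
    fix \<epsilon> :: real assume \<epsilon>: "0 < \<epsilon>"
    obtain c where c: "H x = ennreal c" "0 \<le> c" using x by (cases "H x") (auto simp: S)
    have "(\<lambda>k. (A + c) * (1/2)^k) \<longlonglongrightarrow> 0"
      by (auto intro!: tendsto_eq_intros LIMSEQ_realpow_zero)
    then have "\<forall>\<^sub>F k in sequentially. (A + c) * (1/2)^k < \<epsilon> / 3"
      using \<epsilon> by (intro order_tendstoD) auto
    then obtain k where k: "(A + c) * (1/2)^k < \<epsilon> / 3" by (auto simp: eventually_sequentially)
    have "A * (1/2)^k \<ge> 0" "c * (1/2)^k \<ge> 0" using A0 c by auto
    with k have kA: "A * (1/2)^k \<le> \<epsilon> / 3" and kc: "c * (1/2)^k \<le> \<epsilon> / 3"
      by (auto simp: distrib_right)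
    have "(\<Sum>i\<in>UNIV. norm (V k i x - g i x)) \<le> (1/2)^k * c"
      using bV[of x k] x c by (auto simp: S sum_nonneg simp flip: ennreal_mult)
    with kc have gk: "(\<Sum>i\<in>UNIV. norm (V k i x - g i x)) \<le> \<epsilon> / 3" by (simp add: mult.commute)
    have "0 < \<epsilon> / 3" using \<epsilon> by simp
    with der[of k x] obtain d where d: "0 < d" "\<And>y. norm (y - x) < d \<Longrightarrow>
        norm (u k y - u k x - (\<Sum>i\<in>UNIV. (y - x) $ i *\<^sub>R V k i x)) \<le> \<epsilon> / 3 * norm (y - x)"
      unfolding has_derivative_within_alt by blast
    have "norm (f y - f x - (\<Sum>i\<in>UNIV. (y - x) $ i *\<^sub>R g i x)) \<le> \<epsilon> * norm (y - x)"
      if y: "y \<in> S" "norm (y - x) < min d 1" for y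
    proof -
      have 1: "norm ((f y - u k y) - (f x - u k x)) \<le> \<epsilon> / 3 * norm (y - x)"
        using lip[OF y(1) x, of k] y(2) mult_right_mono[OF kA norm_ge_zero[of "y - x"]]
        by (auto simp: dist_norm)
      have 2: "norm (u k y - u k x - (\<Sum>i\<in>UNIV. (y - x) $ i *\<^sub>R V k i x)) \<le> \<epsilon> / 3 * norm (y - x)"
        using d y by auto
      have "norm (\<Sum>i\<in>UNIV. (y - x) $ i *\<^sub>R (V k i x - g i x)) \<le> (\<Sum>i\<in>UNIV. norm (y - x) * norm (V k i x - g i x))"
        by (rule sum_norm_le) (auto intro!: mult_right_mono component_le_norm_cart[of "y - x", simplified])
      also have "\<dots> \<le> \<epsilon> / 3 * norm (y - x)"
        using mult_left_mono[OF gk norm_ge_zero[of "y - x"]] by (simp add: sum_distrib_left mult.commute)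
      finally have 3: "norm (\<Sum>i\<in>UNIV. (y - x) $ i *\<^sub>R (V k i x - g i x)) \<le> \<epsilon> / 3 * norm (y - x)" .
      have "f y - f x - (\<Sum>i\<in>UNIV. (y - x) $ i *\<^sub>R g i x)
          = ((f y - u k y) - (f x - u k x)) + (u k y - u k x - (\<Sum>i\<in>UNIV. (y - x) $ i *\<^sub>R V k i x))
            + (\<Sum>i\<in>UNIV. (y - x) $ i *\<^sub>R (V k i x - g i x))"
        by (simp add: scaleR_diff_right sum_subtractf)
      also have "norm \<dots> \<le> \<epsilon> / 3 * norm (y - x) + \<epsilon> / 3 * norm (y - x) + \<epsilon> / 3 * norm (y - x)"
        by (intro order_trans[OF norm_triangle_ineq] add_mono 1 2 3)
      finally show ?thesis by simp
    qed
    then show "\<exists>d>0. \<forall>y\<in>S. norm (y - x) < d \<longrightarrow> norm (f y - f x - (\<Sum>i\<in>UNIV. (y - x) $ i *\<^sub>R g i x)) \<le> \<epsilon> * norm (y - x)"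
      using d(1) by (intro exI[of _ "min d 1"]) auto
  qed
qed

text \<open>
  The scales are chosen so that the mollifications of \<open>f\<close> and of its weak partial derivatives are
  \<open>4\<^sup>-\<^sup>k\<close>-close in \<open>L\<^sup>1\<close> on a ball. Summing the errors with weights \<open>2\<^sup>k\<close> yields an integrable \<open>H\<close> that
  dominates all of them at once.
\<close>

lemma weak_gradient_local_cover:
  fixes f :: "real^'n \<Rightarrow> 'b::euclidean_space"
  assumes w: "\<And>i. has_weak_deriv (\<lambda>j. if j = i then 1 else 0) f (g i)"
  shows "\<exists>S :: nat \<Rightarrow> (real^'n) set. (\<forall>m. S m \<in> sets borel) \<and> (AE x in lborel. x \<in> ball 0 R \<longrightarrow> (\<exists>m. x \<in> S m))
     \<and> (\<forall>m. \<forall>x\<in>S m. (f has_derivative (\<lambda>h. \<Sum>i\<in>UNIV. h $ i *\<^sub>R g i x)) (at x within S m))"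
proof -
  have f: "locally_integrable f" and g: "locally_integrable (g i)" for i
    using w by (auto simp: has_weak_deriv_def)
  note [measurable] = locally_integrableD(1)[OF f] locally_integrableD(1)[OF g]
  let ?B = "ball (0 :: real^'n) (R + 1)"
  have ex: "\<exists>s>0. (\<integral>\<^sup>+y\<in>?B. ennreal (norm (smoothing s f y - f y)) \<partial>lborel) \<le> ennreal ((1/4)^k)
      \<and> (\<forall>i. (\<integral>\<^sup>+y\<in>?B. ennreal (norm (smoothing s (g i) y - g i y)) \<partial>lborel) \<le> ennreal ((1/4)^k))" for k
  proof -
    have e: "0 < (1/4 :: real)^k" by simp
    obtain s0 where s0: "s0 > 0"
      "\<And>s. s \<ge> s0 \<Longrightarrow> (\<integral>\<^sup>+y\<in>?B. ennreal (norm (smoothing s f y - f y)) \<partial>lborel) \<le> ennreal ((1/4)^k)"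
      using smoothing_L1_local[OF f e, where R = "R + 1"] by blast
    have "\<forall>i. \<exists>t>0. \<forall>s\<ge>t. (\<integral>\<^sup>+y\<in>?B. ennreal (norm (smoothing s (g i) y - g i y)) \<partial>lborel) \<le> ennreal ((1/4)^k)"
      using smoothing_L1_local[OF g e, where R = "R + 1"] by blast
    then obtain t where t: "\<And>i. t i > 0"
      "\<And>i s. s \<ge> t i \<Longrightarrow> (\<integral>\<^sup>+y\<in>?B. ennreal (norm (smoothing s (g i) y - g i y)) \<partial>lborel) \<le> ennreal ((1/4)^k)"
      using choice_iff[of "\<lambda>i t. t > 0 \<and> (\<forall>s\<ge>t. (\<integral>\<^sup>+y\<in>?B. ennreal (norm (smoothing s (g i) y - g i y)) \<partial>lborel) \<le> ennreal ((1/4)^k))"]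
      by blast
    have "t i \<le> (\<Sum>i\<in>UNIV. t i)" for i
      by (rule member_le_sum) (auto intro: less_imp_le t)
    then have ti: "t i \<le> s0 + (\<Sum>i\<in>UNIV. t i)" for i
      using s0(1) by (simp add: add_increasing)
    have "0 \<le> (\<Sum>i\<in>UNIV. t i)" by (intro sum_nonneg) (auto intro: less_imp_le t)
    then show ?thesis
      using s0 t(2)[OF ti] by (intro exI[of _ "s0 + (\<Sum>i\<in>UNIV. t i)"]) (auto intro: add_pos_nonneg)
  qed
  obtain s where s: "\<And>k. s k > 0"
    "\<And>k. (\<integral>\<^sup>+y\<in>?B. ennreal (norm (smoothing (s k) f y - f y)) \<partial>lborel) \<le> ennreal ((1/4)^k)"
    "\<And>k i. (\<integral>\<^sup>+y\<in>?B. ennreal (norm (smoothing (s k) (g i) y - g i y)) \<partial>lborel) \<le> ennreal ((1/4)^k)"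
  proof -
    have "\<exists>s. \<forall>k. s k > 0 \<and> (\<integral>\<^sup>+y\<in>?B. ennreal (norm (smoothing (s k) f y - f y)) \<partial>lborel) \<le> ennreal ((1/4)^k)
        \<and> (\<forall>i. (\<integral>\<^sup>+y\<in>?B. ennreal (norm (smoothing (s k) (g i) y - g i y)) \<partial>lborel) \<le> ennreal ((1/4)^k))"
      by (rule choice, rule allI, rule ex)
    then show ?thesis using that by blast
  qed
  define D where "D k y = norm (smoothing (s k) f y - f y) + (\<Sum>i\<in>UNIV. norm (smoothing (s k) (g i) y - g i y))" for k y
  define H where "H y = (\<Sum>k. ennreal (2^k) * (ennreal (D k y) * indicator ?B y))" for y
  have [measurable]: "smoothing (s k) f \<in> borel_measurable borel" "smoothing (s k) (g i) \<in> borel_measurable borel" for k i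
    by (auto intro!: borel_measurable_continuous_onI continuous_on_smoothing f g s)
  have Dm [measurable]: "D k \<in> borel_measurable borel" for k
    unfolding D_def[abs_def] by measurable
  have Hm [measurable]: "H \<in> borel_measurable borel"
    unfolding H_def[abs_def] by measurable
  have intD: "(\<integral>\<^sup>+y\<in>?B. ennreal (D k y) \<partial>lborel) \<le> ennreal ((1 + real CARD('n)) * (1/4)^k)" for k
  proof -
    have "(\<integral>\<^sup>+y\<in>?B. ennreal (D k y) \<partial>lborel)
        = (\<integral>\<^sup>+y. ennreal (norm (smoothing (s k) f y - f y)) * indicator ?B y
           + (\<Sum>i\<in>UNIV. ennreal (norm (smoothing (s k) (g i) y - g i y)) * indicator ?B y) \<partial>lborel)"
      by (intro nn_integral_cong) (auto simp: D_def indicator_def sum_nonneg)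
    also have "\<dots> = (\<integral>\<^sup>+y\<in>?B. ennreal (norm (smoothing (s k) f y - f y)) \<partial>lborel)
         + (\<Sum>i\<in>UNIV. \<integral>\<^sup>+y\<in>?B. ennreal (norm (smoothing (s k) (g i) y - g i y)) \<partial>lborel)"
      by (subst nn_integral_add, measurable) (subst nn_integral_sum, measurable)
    also have "\<dots> \<le> ennreal ((1/4)^k) + (\<Sum>i\<in>(UNIV :: 'n set). ennreal ((1/4)^k))"
      by (intro add_mono sum_mono s)
    also have "\<dots> = ennreal ((1 + real CARD('n)) * (1/4)^k)"
      by (simp add: distrib_right ennreal_mult ennreal_of_nat_eq_real_of_nat)
    finally show ?thesis .
  qed
  have "(\<integral>\<^sup>+y. H y \<partial>lborel) = (\<Sum>k. \<integral>\<^sup>+y. ennreal (2^k) * (ennreal (D k y) * indicator ?B y) \<partial>lborel)"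
    unfolding H_def by (rule nn_integral_suminf) measurable
  also have "\<dots> = (\<Sum>k. ennreal (2^k) * (\<integral>\<^sup>+y\<in>?B. ennreal (D k y) \<partial>lborel))"
    by (intro suminf_cong nn_integral_cmult) measurable
  also have "\<dots> \<le> (\<Sum>k. ennreal ((1 + real CARD('n)) * (1/2)^k))"
  proof (rule suminf_le)
    fix k
    have "ennreal (2^k) * (\<integral>\<^sup>+y\<in>?B. ennreal (D k y) \<partial>lborel) \<le> ennreal (2^k) * ennreal ((1 + real CARD('n)) * (1/4)^k)"
      by (intro mult_left_mono intD) auto
    also have "\<dots> = ennreal (2^k * ((1 + real CARD('n)) * (1/4)^k))" by (rule ennreal_mult[symmetric]) auto
    also have "(2::real)^k * ((1 + real CARD('n)) * (1/4)^k) = (1 + real CARD('n)) * (2 * (1/4))^k"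
      by (simp only: power_mult_distrib ac_simps)
    finally show "ennreal (2^k) * (\<integral>\<^sup>+y\<in>?B. ennreal (D k y) \<partial>lborel) \<le> ennreal ((1 + real CARD('n)) * (1/2)^k)"
      by simp
  qed auto
  also have "\<dots> < \<infinity>"
    unfolding infinity_ennreal_def less_top[symmetric]
    by (rule ennreal_suminf_neq_top) (auto intro: summable_mult summable_geometric)
  finally have fin: "(\<integral>\<^sup>+y. H y \<partial>lborel) < \<infinity>" .
  have DH: "ennreal (D k y) \<le> ennreal ((1/2)^k) * H y" if y: "y \<in> ?B" for k y
  proof -
    have "ennreal (2^k) * (ennreal (D k y) * indicator ?B y) \<le> H y"
      unfolding H_def using sum_le_suminf[of "\<lambda>k. ennreal (2^k) * (ennreal (D k y) * indicator ?B y)" "{k}"] by simp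
    then have "ennreal ((1/2)^k) * (ennreal (2^k) * ennreal (D k y)) \<le> ennreal ((1/2)^k) * H y"
      using y by (intro mult_left_mono) auto
    moreover have "ennreal ((1/2)^k) * ennreal (2^k) = 1"
      by (simp add: power_one_over flip: ennreal_mult)
    ultimately show ?thesis by (simp flip: mult.assoc)
  qed
  define S where "S m = maximal_good H (real m) \<inter> {y \<in> ball 0 R. H y < \<infinity>}" for m :: nat
  have "S m \<in> sets borel" for m
  proof -
    have "{y \<in> ball 0 R. H y < \<infinity>} = ball 0 R \<inter> {y \<in> space borel. H y < \<infinity>}" by auto
    also have "\<dots> \<in> sets borel" by measurable
    finally show ?thesis
      unfolding S_def using closed_maximal_good[OF Hm] by auto
  qed
  moreover have "AE x in lborel. x \<in> ball 0 R \<longrightarrow> (\<exists>m. x \<in> S m)"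
  proof -
    have "AE x in lborel. H x \<noteq> \<infinity>"
      using fin by (intro nn_integral_PInf_AE) auto
    with AE_maximal_good[OF Hm fin] show ?thesis
      by eventually_elim (auto simp: S_def less_top)
  qed
  moreover have "(f has_derivative (\<lambda>h. \<Sum>i\<in>UNIV. h $ i *\<^sub>R g i x)) (at x within S m)" if "x \<in> S m" for m x
  proof (rule lusin_differentiable[where u = "\<lambda>k. smoothing (s k) f" and V = "\<lambda>k i. smoothing (s k) (g i)" and H = H and R = R and m = "real m"])
    show "(smoothing (s k) f has_derivative (\<lambda>h. \<Sum>i\<in>UNIV. h $ i *\<^sub>R smoothing (s k) (g i) y)) (at y)" for k y
      by (rule smoothing_gradient[OF w s(1)])
    show "continuous_on UNIV (smoothing (s k) (g i))" for k i
      by (rule continuous_on_smoothing[OF g s(1)])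
    show "ennreal (norm (smoothing (s k) f y - f y)) \<le> ennreal ((1/2)^k) * H y" if "y \<in> ?B" for k y
      by (rule order_trans[OF ennreal_leI DH[OF that]]) (simp add: D_def sum_nonneg)
    show "ennreal (\<Sum>i\<in>UNIV. norm (smoothing (s k) (g i) y - g i y)) \<le> ennreal ((1/2)^k) * H y" if "y \<in> ?B" for k y
      by (rule order_trans[OF ennreal_leI DH[OF that]]) (simp add: D_def)
  qed (use that in \<open>auto simp: S_def\<close>)
  ultimately show ?thesis by blast
qed

theorem weak_gradient_cover:
  fixes f :: "real^'n \<Rightarrow> 'b::euclidean_space"
  assumes w: "\<And>i. has_weak_deriv (\<lambda>j. if j = i then 1 else 0) f (g i)"
  obtains S :: "nat \<Rightarrow> (real^'n) set" where "\<And>n. S n \<in> sets borel" "AE x in lborel. \<exists>n. x \<in> S n"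
    "\<And>n x. x \<in> S n \<Longrightarrow> (f has_derivative (\<lambda>h. \<Sum>i\<in>UNIV. h $ i *\<^sub>R g i x)) (at x within S n)"
proof -
  have "\<forall>R::nat. \<exists>S :: nat \<Rightarrow> (real^'n) set. (\<forall>m. S m \<in> sets borel) \<and> (AE x in lborel. x \<in> ball 0 (real R) \<longrightarrow> (\<exists>m. x \<in> S m))
     \<and> (\<forall>m. \<forall>x\<in>S m. (f has_derivative (\<lambda>h. \<Sum>i\<in>UNIV. h $ i *\<^sub>R g i x)) (at x within S m))"
    using weak_gradient_local_cover[OF w] by blast
  then obtain S :: "nat \<Rightarrow> nat \<Rightarrow> (real^'n) set" where S: "\<forall>R. (\<forall>m. S R m \<in> sets borel)
      \<and> (AE x in lborel. x \<in> ball 0 (real R) \<longrightarrow> (\<exists>m. x \<in> S R m))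
      \<and> (\<forall>m. \<forall>x\<in>S R m. (f has_derivative (\<lambda>h. \<Sum>i\<in>UNIV. h $ i *\<^sub>R g i x)) (at x within S R m))"
    unfolding choice_iff by blast
  \<comment> \<open>Balls of all radii are treated at once by merging two countable families into
    one.\<close>
  define T where "T n = (case prod_decode n of (R, m) \<Rightarrow> S R m)" for n
  have TS: "T (prod_encode (R, m)) = S R m" for R m by (simp add: T_def)
  show thesis
  proof
    show "T n \<in> sets borel" for n using S by (auto simp: T_def split: prod.splits)
    show "(f has_derivative (\<lambda>h. \<Sum>i\<in>UNIV. h $ i *\<^sub>R g i x)) (at x within T n)" if "x \<in> T n" for n x
      using S that by (auto simp: T_def split: prod.splits)
    have "AE x in lborel. \<forall>R::nat. x \<in> ball 0 (real R) \<longrightarrow> (\<exists>m. x \<in> S R m)"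
      unfolding AE_all_countable using S by blast
    then show "AE x in lborel. \<exists>n. x \<in> T n"
    proof (rule AE_mp, intro AE_I2 impI)
      fix x :: "real^'n" assume *: "\<forall>R::nat. x \<in> ball 0 (real R) \<longrightarrow> (\<exists>m. x \<in> S R m)"
      obtain R :: nat where "norm x < R" using reals_Archimedean2 by blast
      with * obtain m where "x \<in> S R m" by auto
      then show "\<exists>n. x \<in> T n" unfolding TS[symmetric] by blast
    qed
  qed
qed

section \<open>The Gaussian measure and its pullbacks\<close>

lemma std_gaussian_density_pos: "0 < std_gaussian_density x"
  by (auto simp: std_gaussian_density_def intro!: prod_pos normal_density_pos)

lemma borel_measurable_std_gaussian_density [measurable]: "std_gaussian_density \<in> borel_measurable borel"
proof -
  have "(\<lambda>x :: real^'n. \<Prod>i\<in>UNIV. std_normal_density (x $ i)) \<in> borel_measurable borel"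
    by (intro borel_measurable_prod measurable_compose[OF _ borel_measurable_normal_density]
        borel_measurable_continuous_onI continuous_intros)
  then show ?thesis by (simp add: std_gaussian_density_def[abs_def])
qed

lemma nn_integral_std_gaussian_density: "(\<integral>\<^sup>+x. ennreal (std_gaussian_density (x :: real^'n)) \<partial>lborel) = 1"
proof -
  have "(\<integral>\<^sup>+x. ennreal (std_gaussian_density (x :: real^'n)) \<partial>lborel)
      = (\<integral>\<^sup>+x. (\<Prod>b\<in>Basis. ennreal (std_normal_density ((x :: real^'n) \<bullet> b))) \<partial>lborel)"
    by (intro nn_integral_cong) (simp add: std_gaussian_density_def prod_Basis_vec prod_ennreal)
  also have "\<dots> = (\<Prod>b\<in>(Basis :: (real^'n) set). \<integral>\<^sup>+x. ennreal (std_normal_density x) \<partial>lborel)"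
    by (rule nn_integral_lborel_prod) auto
  also have "(\<integral>\<^sup>+x. ennreal (std_normal_density x) \<partial>lborel) = 1"
    by (subst nn_integral_eq_integral) auto
  finally show ?thesis by simp
qed

lemma prob_space_std_gaussian: "prob_space (std_gaussian :: (real^'n) measure)"
  by (rule prob_spaceI) (simp add: std_gaussian_def emeasure_density nn_integral_std_gaussian_density)

lemma sets_std_gaussian [measurable_cong, simp]: "sets std_gaussian = sets borel"
  by (simp add: std_gaussian_def)

lemma space_std_gaussian [simp]: "space std_gaussian = UNIV"
  by (simp add: std_gaussian_def)

lemma AE_std_gaussian_iff: "(AE x in std_gaussian. P x) \<longleftrightarrow> (AE x in lborel. P x)"
  unfolding std_gaussian_def by (subst AE_density) (auto simp: std_gaussian_density_pos)

lemma integrable_std_gaussian_density: "integrable lborel (std_gaussian_density :: real^'n \<Rightarrow> real)"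
  by (rule integrableI_nonneg)
     (auto simp: nn_integral_std_gaussian_density std_gaussian_density_pos less_imp_le)

lemma ln_std_gaussian_density_diff:
  fixes x y :: "real^'n"
  shows "ln (std_gaussian_density x) - ln (std_gaussian_density y) = ((norm y)\<^sup>2 - (norm x)\<^sup>2) / 2"
proof -
  have "ln (std_gaussian_density z) = real CARD('n) * ln (1 / sqrt (2 * pi)) - (norm z)\<^sup>2 / 2" for z :: "real^'n"
  proof -
    have "ln (std_gaussian_density z) = (\<Sum>i\<in>UNIV. ln (std_normal_density (z $ i)))"
      unfolding std_gaussian_density_def
      by (rule ln_prod) (auto simp: less_imp_neq[OF normal_density_pos, symmetric])
    also have "\<dots> = (\<Sum>i\<in>UNIV. ln (1 / sqrt (2 * pi)) - (z $ i)\<^sup>2 / 2)"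
      by (intro sum.cong refl) (simp add: std_normal_density_def ln_div)
    also have "\<dots> = real CARD('n) * ln (1 / sqrt (2 * pi)) - (\<Sum>i\<in>UNIV. (z $ i)\<^sup>2) / 2"
      by (simp add: sum_subtractf sum_divide_distrib)
    also have "(\<Sum>i\<in>UNIV. (z $ i)\<^sup>2) = (norm z)\<^sup>2"
      by (simp add: norm_vec_def L2_set_def sum_nonneg)
    finally show ?thesis .
  qed
  from this[of x] this[of y] show ?thesis by (simp add: field_simps)
qed

lemma measurable_weak_jacobian:
  assumes "\<And>b. weak_deriv (\<lambda>i. if i = b then 1 else 0) F \<in> borel_measurable borel"
  shows "(\<lambda>x. det (weak_jacobian F x)) \<in> borel_measurable borel"
proof -
  have "(\<lambda>x. weak_deriv (\<lambda>i. if i = b then 1 else 0) F x $ a) \<in> borel_measurable borel" for a b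
    by (rule measurable_compose[OF assms[of b]]) (intro borel_measurable_continuous_onI continuous_intros)
  then show ?thesis
    unfolding det_def weak_jacobian_def
    by (simp only: vec_lambda_beta) (intro borel_measurable_sum borel_measurable_times borel_measurable_prod borel_measurable_const)
qed

text \<open>
  On each piece of the cover the change of variables identifies both measures. Off the pieces both vanish:
  the right-hand side because the rest is a Lebesgue null set, the left-hand side by absolute
  continuity.
\<close>

theorem pullback_std_gaussian_density:
  fixes F :: "real^'n \<Rightarrow> real^'n"
  assumes w: "\<And>b. has_weak_deriv (\<lambda>i. if i = b then 1 else 0) F (weak_deriv (\<lambda>i. if i = b then 1 else 0) F)"
    and bij: "bij F" and inv [measurable]: "inv F \<in> borel_measurable borel"
    and ac: "absolutely_continuous lborel (pullback F std_gaussian)"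
  shows "pullback F std_gaussian
    = density lborel (\<lambda>x. ennreal (\<bar>det (weak_jacobian F x)\<bar> * std_gaussian_density (F x)))"
    (is "?M = ?D")
proof -
  let ?J = "\<lambda>x. \<bar>det (weak_jacobian F x)\<bar> * std_gaussian_density (F x)"
  let ?g = "\<lambda>b. weak_deriv (\<lambda>i. if i = b then 1 else 0) F"
  have Fm [measurable]: "F \<in> borel_measurable borel" and [measurable]: "\<And>b. ?g b \<in> borel_measurable borel"
    using w by (auto simp: has_weak_deriv_def locally_integrable_def)
  have [measurable]: "(\<lambda>x. det (weak_jacobian F x)) \<in> borel_measurable borel"
    by (rule measurable_weak_jacobian) measurable
  obtain S :: "nat \<Rightarrow> (real^'n) set" where S: "\<And>n. S n \<in> sets borel" "AE x in lborel. \<exists>n. x \<in> S n"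
    "\<And>n x. x \<in> S n \<Longrightarrow> (F has_derivative (\<lambda>h. \<Sum>i\<in>UNIV. h $ i *\<^sub>R ?g i x)) (at x within S n)"
    using weak_gradient_cover[OF w] by blast
  have mat: "matrix (\<lambda>h. \<Sum>i\<in>UNIV. h $ i *\<^sub>R ?g i x) = weak_jacobian F x" for x
    by (simp add: vec_eq_iff matrix_def weak_jacobian_def axis_def if_distrib if_distribR cong: if_cong)
  have setsM: "sets ?M = sets borel" by (simp add: pullback_def)
  have M: "emeasure ?M A = (\<integral>\<^sup>+y\<in>F ` A. ennreal (std_gaussian_density y) \<partial>lborel)"
    and FA: "F ` A \<in> sets borel" if A: "A \<in> sets borel" for A
  proof -
    have eq: "inv F -` A = F ` A" using bij by (simp add: bij_vimage_eq_inv_image inv_inv_eq bij_imp_bij_inv)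
    show FA: "F ` A \<in> sets borel"
      unfolding eq[symmetric] using measurable_sets_borel[OF inv A] .
    have "inv F \<in> measurable std_gaussian borel" by measurable
    then show "emeasure ?M A = (\<integral>\<^sup>+y\<in>F ` A. ennreal (std_gaussian_density y) \<partial>lborel)"
      using A FA unfolding pullback_def
      by (simp add: emeasure_distr eq) (simp add: std_gaussian_def emeasure_density)
  qed
  have piece: "emeasure ?M A = emeasure ?D A" if A: "A \<in> sets borel" "A \<subseteq> S n" for A n
  proof -
    have "emeasure ?D A = (\<integral>\<^sup>+x\<in>A. ennreal (\<bar>det (matrix (\<lambda>h. \<Sum>i\<in>UNIV. h $ i *\<^sub>R ?g i x))\<bar> * std_gaussian_density (F x)) \<partial>lborel)"
      using A by (simp add: emeasure_density mat)
    also have "\<dots> = (\<integral>\<^sup>+y\<in>F ` A. ennreal (std_gaussian_density y) \<partial>lborel)"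
    proof (rule nn_integral_change_of_variables[OF A(1) FA[OF A(1)]])
      show "(F has_derivative (\<lambda>h. \<Sum>i\<in>UNIV. h $ i *\<^sub>R ?g i x)) (at x within A)" if "x \<in> A" for x
        using S(3)[of x n] that A(2) has_derivative_subset by blast
      show "inj_on F A" using bij by (meson bij_is_inj inj_on_subset subset_UNIV)
    qed (auto simp: integrable_std_gaussian_density std_gaussian_density_pos less_imp_le mat)
    finally show ?thesis using M[OF A(1)] by simp
  qed
  define N where "N = - (\<Union>n. S n)"
  have Nb: "N \<in> sets borel" using S(1) by (auto simp: N_def)
  have N0: "N \<in> null_sets lborel"
    using S(2) Nb by (simp add: AE_iff_null_sets N_def)
  have MN: "N \<in> null_sets ?M" using ac N0 by (auto simp: absolutely_continuous_def)
  have DN: "N \<in> null_sets ?D"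
    using N0 by (subst null_sets_density_iff) (auto intro: AE_mp[OF AE_not_in[OF N0]])
  define T where "T = disjointed S"
  have Tb: "T n \<in> sets borel" and TS: "T n \<subseteq> S n" for n
    using S(1) sets.range_disjointed_sets[of S borel] disjointed_subset[of S n] by (auto simp: T_def)
  show ?thesis
  proof (rule measure_eqI)
    fix A assume "A \<in> sets ?M"
    then have A: "A \<in> sets borel" by (simp add: setsM)
    have decomp: "emeasure P A = (\<Sum>n. emeasure P (A \<inter> T n))"
      if P: "sets P = sets borel" "N \<in> null_sets P" for P :: "(real^'n) measure"
    proof -
      have "emeasure P A = emeasure P (A - N)"
        using P A by (intro emeasure_Diff_null_set[symmetric]) auto
      also have "A - N = (\<Union>n. A \<inter> T n)"
        using UN_disjointed_eq[of S] by (auto simp: N_def T_def)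
      also have "emeasure P \<dots> = (\<Sum>n. emeasure P (A \<inter> T n))"
      proof (rule suminf_emeasure[symmetric])
        show "disjoint_family (\<lambda>n. A \<inter> T n)"
          using disjoint_family_disjointed[of S] unfolding T_def disjoint_family_on_def by blast
      qed (use P A Tb in auto)
      finally show ?thesis .
    qed
    have "emeasure ?M (A \<inter> T n) = emeasure ?D (A \<inter> T n)" for n
      using A Tb TS by (intro piece[of _ n]) auto
    then show "emeasure ?M A = emeasure ?D A"
      using decomp[of ?M] decomp[of ?D] MN DN by (simp add: setsM)
  qed (simp add: setsM)
qed

corollary lebesgue_density_pullback_std_gaussian:
  fixes F :: "real^'n \<Rightarrow> real^'n"
  assumes w: "\<And>b. has_weak_deriv (\<lambda>i. if i = b then 1 else 0) F (weak_deriv (\<lambda>i. if i = b then 1 else 0) F)"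
    and bij: "bij F" and inv: "inv F \<in> borel_measurable borel"
    and ac: "absolutely_continuous lborel (pullback F std_gaussian)"
  shows "AE x in lborel. lebesgue_density (pullback F std_gaussian) x
    = \<bar>det (weak_jacobian F x)\<bar> * std_gaussian_density (F x)"
proof -
  have [measurable]: "F \<in> borel_measurable borel"
     "\<And>b. weak_deriv (\<lambda>i. if i = b then 1 else 0) F \<in> borel_measurable borel"
    using w by (auto simp: has_weak_deriv_def locally_integrable_def)
  have [measurable]: "(\<lambda>x. det (weak_jacobian F x)) \<in> borel_measurable borel"
    by (rule measurable_weak_jacobian) measurable
  have "AE x in lborel. ennreal (\<bar>det (weak_jacobian F x)\<bar> * std_gaussian_density (F x))
      = RN_deriv lborel (pullback F std_gaussian) x"
    by (rule sigma_finite_measure.RN_deriv_unique[OF sigma_finite_lborel _ pullback_std_gaussian_density[OF assms, symmetric]]) measurable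
  then show ?thesis
    by (rule AE_mp)
       (auto intro!: AE_I2 simp: lebesgue_density_def mult_nonneg_nonneg std_gaussian_density_pos less_imp_le
         simp flip: ennreal_mult dest!: arg_cong[where f = enn2real])
qed

section \<open>Weighted Sobolev norms\<close>

lemma sobolev_space_weak_deriv:
  assumes s: "sobolev_space M k p f" and j: "(\<Sum>i\<in>UNIV. j i) \<le> k"
  shows "has_weak_deriv j f (weak_deriv j f)"
proof -
  obtain g where "has_weak_deriv j f g"
    using s j unfolding sobolev_space_def by blast
  then show ?thesis by (rule has_weak_deriv_weak_deriv)
qed

lemma finite_multi_indices: "finite {j :: 'n::finite \<Rightarrow> nat. (\<Sum>i\<in>UNIV. j i) \<le> k}"
proof (rule finite_subset)
  show "{j :: 'n \<Rightarrow> nat. (\<Sum>i\<in>UNIV. j i) \<le> k} \<subseteq> PiE UNIV (\<lambda>_. {..k})"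
  proof
    fix j :: "'n \<Rightarrow> nat" assume "j \<in> {j. (\<Sum>i\<in>UNIV. j i) \<le> k}"
    moreover have "j i \<le> (\<Sum>i\<in>UNIV. j i)" for i by (rule member_le_sum) auto
    ultimately have "j i \<le> k" for i using order_trans by blast
    then show "j \<in> PiE UNIV (\<lambda>_. {..k})" by (simp add: PiE_UNIV_domain)
  qed
qed (auto intro: finite_PiE)

text \<open>
  The Sobolev norm is defined with the representative \<open>weak_deriv j f\<close>; by uniqueness this one is
  \<open>p\<close>-integrable as soon as some weak derivative is, so that its Lebesgue norm is a genuine one.
\<close>

lemma nn_integral_weak_deriv_le_sobolev_norm:
  fixes f :: "real^'n \<Rightarrow> 'b::euclidean_space"
  assumes s: "sobolev_space std_gaussian k p f" and p: "p \<noteq> 0" and j: "(\<Sum>i\<in>UNIV. j i) \<le> k"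
  shows "(\<integral>\<^sup>+x. ennreal (norm (weak_deriv j f x) powr p) \<partial>std_gaussian)
      \<le> ennreal (sobolev_norm std_gaussian k p f powr p)"
proof -
  let ?L = "\<lambda>j. Lp_norm std_gaussian p (weak_deriv j f) powr p"
  obtain g where g: "has_weak_deriv j f g" "Lp_space std_gaussian p g"
    using s j unfolding sobolev_space_def by blast
  have [measurable]: "weak_deriv j f \<in> borel_measurable borel"
    using has_weak_deriv_weak_deriv[OF g(1)] by (auto simp: has_weak_deriv_def locally_integrable_def)
  have "AE x in std_gaussian. norm (g x) powr p = norm (weak_deriv j f x) powr p"
    unfolding AE_std_gaussian_iff using weak_deriv_AE_eq[OF g(1)] by eventually_elim simp
  then have int: "integrable std_gaussian (\<lambda>x. norm (weak_deriv j f x) powr p)"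
    using g(2) by (subst integrable_cong_AE[symmetric]) (auto simp: Lp_space_def)
  have "(\<integral>\<^sup>+x. ennreal (norm (weak_deriv j f x) powr p) \<partial>std_gaussian)
      = ennreal (\<integral>x. norm (weak_deriv j f x) powr p \<partial>std_gaussian)"
    by (rule nn_integral_eq_integral[OF int]) simp
  also have "(\<integral>x. norm (weak_deriv j f x) powr p \<partial>std_gaussian) = ?L j"
    using p by (simp add: Lp_norm_def powr_powr)
  also have "ennreal (?L j) \<le> ennreal (\<Sum>j | (\<Sum>i\<in>UNIV. j i) \<le> k. ?L j)"
    using j by (intro ennreal_leI member_le_sum) (auto simp: finite_multi_indices)
  also have "(\<Sum>j | (\<Sum>i\<in>UNIV. j i) \<le> k. ?L j) = sobolev_norm std_gaussian k p f powr p"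
    using p by (simp add: sobolev_norm_def powr_powr sum_nonneg)
  finally show ?thesis .
qed

text \<open>
  With \<open>c = 1\<close> and \<open>c = -1\<close> this covers sums and differences.
\<close>

lemma Lp_space_2_add_scaled:
  assumes f: "Lp_space std_gaussian 2 f" and g: "Lp_space std_gaussian 2 g" and c: "\<bar>c\<bar> = 1"
  shows "Lp_space std_gaussian 2 (\<lambda>x. f x + c *\<^sub>R g x)"
proof -
  have [measurable]: "f \<in> borel_measurable std_gaussian" "g \<in> borel_measurable std_gaussian"
    using f g by (auto simp: Lp_space_def)
  have "integrable std_gaussian (\<lambda>x. norm (f x + c *\<^sub>R g x) powr 2)"
  proof (rule Bochner_Integration.integrable_bound)
    show "integrable std_gaussian (\<lambda>x. 2 * (norm (f x) powr 2) + 2 * (norm (g x) powr 2))"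
      using f g by (intro Bochner_Integration.integrable_add integrable_mult_right) (auto simp: Lp_space_def)
    have "(norm (u + c *\<^sub>R v))\<^sup>2 \<le> 2 * (norm u)\<^sup>2 + 2 * (norm v)\<^sup>2" for u v :: 'b
    proof -
      have "(norm (u + c *\<^sub>R v))\<^sup>2 \<le> (norm u + norm v)\<^sup>2"
        using c norm_triangle_ineq[of u "c *\<^sub>R v"] by (intro power_mono) auto
      also have "\<dots> \<le> 2 * (norm u)\<^sup>2 + 2 * (norm v)\<^sup>2"
        using sum_squares_ge_zero[of "norm u - norm v" 0] by (simp add: power2_eq_square algebra_simps)
      finally show ?thesis .
    qed
    then show "AE x in std_gaussian. norm (norm (f x + c *\<^sub>R g x) powr 2) \<le> norm (2 * (norm (f x) powr 2) + 2 * (norm (g x) powr 2))"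
      by (intro AE_I2) simp
  qed measurable
  then show ?thesis by (simp add: Lp_space_def)
qed

lemma sobolev_space_2_diff:
  assumes f: "sobolev_space std_gaussian k 2 f" and g: "sobolev_space std_gaussian k 2 g"
  shows "sobolev_space std_gaussian k 2 (\<lambda>x. f x - g x)"
  unfolding sobolev_space_def
proof (intro allI impI)
  fix j :: "'a \<Rightarrow> nat" assume "(\<Sum>i\<in>UNIV. j i) \<le> k"
  then obtain f' g' where "has_weak_deriv j f f'" "Lp_space std_gaussian 2 f'"
      "has_weak_deriv j g g'" "Lp_space std_gaussian 2 g'"
    using f g unfolding sobolev_space_def by blast
  then show "\<exists>h. has_weak_deriv j (\<lambda>x. f x - g x) h \<and> Lp_space std_gaussian 2 h"
    using has_weak_deriv_diff Lp_space_2_add_scaled[of f' g' "-1"]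
    by (intro exI[of _ "\<lambda>x. f' x - g' x"]) auto
qed

lemma nn_integral_Lp_norm_2:
  assumes "Lp_space M 2 f"
  shows "(\<integral>\<^sup>+x. ennreal ((norm (f x))\<^sup>2) \<partial>M) = ennreal ((Lp_norm M 2 f)\<^sup>2)"
proof -
  have "integrable M (\<lambda>x. (norm (f x))\<^sup>2)" using assms by (simp add: Lp_space_def)
  then have "(\<integral>\<^sup>+x. ennreal ((norm (f x))\<^sup>2) \<partial>M) = ennreal (\<integral>x. (norm (f x))\<^sup>2 \<partial>M)"
    by (rule nn_integral_eq_integral) simp
  then show ?thesis by (simp add: Lp_norm_def powr_half_sqrt integral_nonneg_AE)
qed

section \<open>Determinants and integral inequalities\<close>

text \<open>
  The telescoping identity \<open>a\<^sub>x A - b\<^sub>x B = a\<^sub>x (A - B) + (a\<^sub>x - b\<^sub>x) B\<close>, iterated.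
\<close>

lemma abs_prod_diff_le:
  fixes a b :: "'i \<Rightarrow> real"
  assumes "finite I" and M: "\<And>i. i \<in> I \<Longrightarrow> \<bar>a i\<bar> \<le> M" "\<And>i. i \<in> I \<Longrightarrow> \<bar>b i\<bar> \<le> M"
    and \<Delta>: "\<And>i. i \<in> I \<Longrightarrow> \<bar>a i - b i\<bar> \<le> \<Delta>" and M0: "0 \<le> M"
  shows "\<bar>prod a I - prod b I\<bar> \<le> real (card I) * \<Delta> * M ^ (card I - 1)"
  using assms(1,2,3,4)
proof (induction I rule: finite_induct)
  case (insert x I)
  have pb: "\<bar>prod b I\<bar> \<le> M ^ card I"
    unfolding abs_prod using insert.prems
    by (intro order_trans[OF prod_mono[of I "\<lambda>i. \<bar>b i\<bar>" "\<lambda>_. M"]]) auto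
  have "a x * prod a I - b x * prod b I = a x * (prod a I - prod b I) + (a x - b x) * prod b I"
    by (simp add: algebra_simps)
  also have "\<bar>\<dots>\<bar> \<le> \<bar>a x\<bar> * \<bar>prod a I - prod b I\<bar> + \<bar>a x - b x\<bar> * \<bar>prod b I\<bar>"
    by (metis abs_mult abs_triangle_ineq)
  also have "\<dots> \<le> M * (real (card I) * \<Delta> * M ^ (card I - 1)) + \<Delta> * M ^ card I"
    using insert pb M0 by (intro add_mono mult_mono) (auto intro: order_trans[OF abs_ge_zero])
  also have "M * (real (card I) * \<Delta> * M ^ (card I - 1)) = real (card I) * \<Delta> * M ^ card I"
    by (cases "card I") auto
  finally show ?case using insert.hyps by (simp add: algebra_simps)
qed simp

lemma abs_det_diff_le:
  fixes A B :: "real^'n^'n"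
  assumes M: "\<And>i j. \<bar>A $ i $ j\<bar> \<le> M" "\<And>i j. \<bar>B $ i $ j\<bar> \<le> M"
    and \<Delta>: "\<And>i j. \<bar>A $ i $ j - B $ i $ j\<bar> \<le> \<Delta>"
  shows "\<bar>det A - det B\<bar> \<le> fact (CARD('n)) * (real (CARD('n)) * \<Delta> * M ^ (CARD('n) - 1))"
proof -
  have M0: "0 \<le> M" using M(1)[of undefined undefined] abs_ge_zero by (rule order_trans[rotated])
  have "\<bar>det A - det B\<bar> = \<bar>\<Sum>p | p permutes (UNIV :: 'n set). of_int (sign p) *
      ((\<Prod>i\<in>UNIV. A $ i $ p i) - (\<Prod>i\<in>UNIV. B $ i $ p i))\<bar>"
    by (simp add: det_def sum_subtractf right_diff_distrib)
  also have "\<dots> \<le> (\<Sum>p | p permutes (UNIV :: 'n set). real CARD('n) * \<Delta> * M ^ (CARD('n) - 1))"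
  proof (rule order_trans[OF sum_abs sum_mono])
    fix p :: "'n \<Rightarrow> 'n"
    have "\<bar>real_of_int (sign p)\<bar> = 1" by (metis abs_sign of_int_1 of_int_abs)
    then show "\<bar>of_int (sign p) * ((\<Prod>i\<in>UNIV. A $ i $ p i) - (\<Prod>i\<in>UNIV. B $ i $ p i))\<bar>
        \<le> real CARD('n) * \<Delta> * M ^ (CARD('n) - 1)"
      using abs_prod_diff_le[of UNIV "\<lambda>i. A $ i $ p i" M "\<lambda>i. B $ i $ p i" \<Delta>] M \<Delta> M0
      by (simp add: abs_mult)
  qed
  finally show ?thesis by (simp add: card_permutations)
qed

lemma sum_power_le:
  fixes x :: "'i \<Rightarrow> real"
  assumes I: "finite I" "I \<noteq> {}" and x: "\<And>i. i \<in> I \<Longrightarrow> 0 \<le> x i"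
  shows "(\<Sum>i\<in>I. x i) ^ n \<le> real (card I) ^ n * (\<Sum>i\<in>I. x i ^ n)"
proof -
  define m where "m = Max (x ` I)"
  have "m \<in> x ` I" unfolding m_def using I by (intro Max_in) auto
  then obtain i where i: "i \<in> I" "m = x i" by blast
  have "(\<Sum>i\<in>I. x i) \<le> (\<Sum>i\<in>I. m)" by (intro sum_mono) (auto simp: m_def I)
  then have "(\<Sum>i\<in>I. x i) ^ n \<le> (real (card I) * m) ^ n"
    using x by (intro power_mono) (auto intro: sum_nonneg)
  also have "\<dots> = real (card I) ^ n * x i ^ n" by (simp add: power_mult_distrib i)
  also have "\<dots> \<le> real (card I) ^ n * (\<Sum>i\<in>I. x i ^ n)"
    using I i x by (intro mult_left_mono member_le_sum) auto
  finally show ?thesis .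
qed

lemma Cauchy_Schwarz_nn_integral_real:
  fixes f g :: "'a \<Rightarrow> real"
  assumes [measurable]: "f \<in> borel_measurable M" "g \<in> borel_measurable M"
    and nn: "\<And>x. 0 \<le> f x" "\<And>x. 0 \<le> g x" "0 \<le> A" "0 \<le> B"
    and A: "(\<integral>\<^sup>+x. ennreal ((f x)\<^sup>2) \<partial>M) \<le> ennreal (A\<^sup>2)"
    and B: "(\<integral>\<^sup>+x. ennreal ((g x)\<^sup>2) \<partial>M) \<le> ennreal (B\<^sup>2)"
  shows "(\<integral>\<^sup>+x. ennreal (f x * g x) \<partial>M) \<le> ennreal (A * B)"
proof -
  let ?I = "\<integral>\<^sup>+x. ennreal (f x * g x) \<partial>M"
  have "?I\<^sup>2 = (\<integral>\<^sup>+x. ennreal (f x) * ennreal (g x) \<partial>M)\<^sup>2" using nn by (simp add: ennreal_mult)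
  also have "\<dots> \<le> (\<integral>\<^sup>+x. (ennreal (f x))\<^sup>2 \<partial>M) * (\<integral>\<^sup>+x. (ennreal (g x))\<^sup>2 \<partial>M)"
    by (rule Cauchy_Schwarz_nn_integral) auto
  also have "\<dots> \<le> ennreal (A\<^sup>2) * ennreal (B\<^sup>2)"
    using A B nn by (intro mult_mono) (auto simp: ennreal_power)
  also have "\<dots> = ennreal ((A * B)\<^sup>2)" by (simp add: power_mult_distrib flip: ennreal_mult)
  finally have le: "?I\<^sup>2 \<le> ennreal ((A * B)\<^sup>2)" .
  then have "?I \<noteq> \<infinity>" by (auto simp: top_unique)
  then obtain c where c: "?I = ennreal c" "0 \<le> c" by (cases ?I) auto
  then have "c\<^sup>2 \<le> (A * B)\<^sup>2" using le by (simp add: ennreal_power)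
  then have "c \<le> A * B" by (rule power2_le_imp_le) (simp add: nn)
  then show ?thesis using c by simp
qed

section \<open>The divergence bound\<close>

text \<open>
  The negative part in the definition of \<open>KL\<close> is subtracted, so it can be dropped from an upper bound.
\<close>

lemma KL_le_nn_integral:
  assumes "AE x in lborel. KL_integrand (lebesgue_density M x) (lebesgue_density N x) \<le> ereal (w x)"
  shows "KL M N \<le> enn2ereal (\<integral>\<^sup>+x. ennreal (w x) \<partial>lborel)"
proof -
  let ?h = "\<lambda>x. KL_integrand (lebesgue_density M x) (lebesgue_density N x)"
  have sub: "enn2ereal P - enn2ereal Q \<le> enn2ereal P" for P Q
    using enn2ereal_nonneg[of Q] by (cases "enn2ereal P"; cases "enn2ereal Q") auto
  have "(\<integral>\<^sup>+x. e2ennreal (?h x) \<partial>lborel) \<le> (\<integral>\<^sup>+x. ennreal (w x) \<partial>lborel)"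
  proof (rule nn_integral_mono_AE)
    show "AE x in lborel. e2ennreal (?h x) \<le> ennreal (w x)"
      using assms by eventually_elim (auto dest: e2ennreal_mono simp: ennreal.abs_eq)
  qed
  then have "enn2ereal (\<integral>\<^sup>+x. e2ennreal (?h x) \<partial>lborel) \<le> enn2ereal (\<integral>\<^sup>+x. ennreal (w x) \<partial>lborel)"
    by (simp add: less_eq_ennreal.rep_eq)
  with sub show ?thesis
    unfolding KL_def Let_def by (rule order_trans)
qed

lemma abs_ln_diff_le:
  fixes u v c :: real
  assumes "0 < c" "c \<le> u" "c \<le> v"
  shows "\<bar>ln u - ln v\<bar> \<le> \<bar>u - v\<bar> / c"
proof -
  have *: "ln s - ln t \<le> \<bar>s - t\<bar> / c" if "c \<le> s" "c \<le> t" for s t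
  proof -
    have "ln s - ln t \<le> (s - t) / t" using that assms by (intro ln_diff_le) auto
    also have "\<dots> \<le> \<bar>s - t\<bar> / t" using that assms by (intro divide_right_mono) auto
    also have "\<dots> \<le> \<bar>s - t\<bar> / c" using that assms by (intro divide_left_mono) auto
    finally show ?thesis .
  qed
  from *[of u v] *[of v u] assms show ?thesis by (simp add: abs_minus_commute abs_le_iff)
qed

lemma KL_integrand_le:
  fixes x y :: "real^'n"
  assumes c: "0 < c" "c \<le> u" "c \<le> v"
    and p: "p = u * std_gaussian_density x" and q: "q = v * std_gaussian_density y" and pr: "p \<le> r"
  shows "KL_integrand p q \<le> ereal (r * (norm (x - y) * norm (x + y) / 2 + \<bar>u - v\<bar> / c))"
proof -
  have uv: "0 < u" "0 < v" using c by auto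
  have pq: "0 < p" "0 < q" using uv by (auto simp: p q std_gaussian_density_pos)
  have "(x - y) \<bullet> (x + y) = (norm x)\<^sup>2 - (norm y)\<^sup>2"
    by (simp add: power2_norm_eq_inner inner_diff_left inner_diff_right inner_add_left inner_add_right
        inner_commute)
  then have "\<bar>(norm y)\<^sup>2 - (norm x)\<^sup>2\<bar> = \<bar>(x - y) \<bullet> (x + y)\<bar>"
    by (simp add: abs_minus_commute)
  also have "\<dots> \<le> norm (x - y) * norm (x + y)" by (rule Cauchy_Schwarz_ineq2)
  finally have xy: "\<bar>(norm y)\<^sup>2 - (norm x)\<^sup>2\<bar> \<le> norm (x - y) * norm (x + y)" .
  have "ln (p / q) = (ln u - ln v) + ((norm y)\<^sup>2 - (norm x)\<^sup>2) / 2"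
    using uv std_gaussian_density_pos[of x] std_gaussian_density_pos[of y]
    by (simp add: p q ln_div ln_mult flip: ln_std_gaussian_density_diff)
  also have "\<dots> \<le> \<bar>u - v\<bar> / c + norm (x - y) * norm (x + y) / 2"
    using abs_ln_diff_le[OF c] xy by (intro add_mono) (auto simp: abs_le_iff)
  finally have "ln (p / q) * p \<le> (norm (x - y) * norm (x + y) / 2 + \<bar>u - v\<bar> / c) * p"
    using pq by (intro mult_right_mono) auto
  also have "\<dots> \<le> (norm (x - y) * norm (x + y) / 2 + \<bar>u - v\<bar> / c) * r"
    using c pr by (intro mult_left_mono) auto
  finally show ?thesis using pq by (simp add: KL_integrand_def mult.commute)
qed

text \<open>
  A bound for the \<open>2(d - 1)\<close>-th moment of the sum of the norms of all partial derivatives of two maps with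
  Sobolev norms \<open>b\<close> and \<open>b'\<close>. The summand \<open>1\<close> covers dimension one, where the exponent is zero and the
  moment is the total mass of the Gaussian measure.
\<close>

definition jacobian_moment_bound :: "nat \<Rightarrow> real \<Rightarrow> real \<Rightarrow> real" where
  "jacobian_moment_bound d b b' = (2 * real d) ^ (2 * (d - 1)) *
     (real d * (\<bar>b\<bar> powr (2 * (real d - 1)) + \<bar>b'\<bar> powr (2 * (real d - 1)))) + 1"

lemma jacobian_moment_bound_ge_1: "1 \<le> jacobian_moment_bound d b b'"
  by (simp add: jacobian_moment_bound_def)

lemma nn_integral_jacobian_moment:
  fixes F G :: "real^'n \<Rightarrow> real^'n"
  defines "e \<equiv> \<lambda>b i. if i = b then (1::nat) else 0"
  assumes F: "sobolev_space std_gaussian 1 (2 * (real CARD('n) - 1)) F"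
    and G: "sobolev_space std_gaussian 1 (2 * (real CARD('n) - 1)) G"
  shows "(\<integral>\<^sup>+x. ennreal (((\<Sum>b\<in>UNIV. norm (weak_deriv (e b) F x) + norm (weak_deriv (e b) G x)) ^ (CARD('n) - 1))\<^sup>2) \<partial>std_gaussian)
    \<le> ennreal (jacobian_moment_bound (CARD('n))
        (sobolev_norm std_gaussian 1 (2 * (real CARD('n) - 1)) F) (sobolev_norm std_gaussian 1 (2 * (real CARD('n) - 1)) G))"
proof (cases "CARD('n) = 1")
  case True
  have "emeasure (std_gaussian :: (real^'n) measure) UNIV = 1"
    using prob_space.emeasure_space_1[OF prob_space_std_gaussian[where 'n = 'n]] by simp
  with True show ?thesis
    by (simp add: jacobian_moment_bound_ge_1)
next
  case False
  then have d: "2 \<le> CARD('n)" using zero_less_card_finite[where 'a = 'n] by linarith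
  let ?d = "real CARD('n)" and ?p = "2 * (real CARD('n) - 1)"
  define n where "n = 2 * (CARD('n) - 1)"
  have n: "n \<noteq> 0" "?p = real n" using d by (auto simp: n_def of_nat_diff)
  have p0: "?p \<noteq> 0" using d by simp
  let ?f = "\<lambda>b x. norm (weak_deriv (e b) F x)" and ?g = "\<lambda>b x. norm (weak_deriv (e b) G x)"
  have e1: "(\<Sum>i\<in>UNIV. e b i) \<le> 1" for b by (simp add: e_def)
  have [measurable]: "weak_deriv (e b) F \<in> borel_measurable borel" "weak_deriv (e b) G \<in> borel_measurable borel" for b
    using sobolev_space_weak_deriv[OF F e1] sobolev_space_weak_deriv[OF G e1]
    by (auto simp: has_weak_deriv_def locally_integrable_def)
  have two: "(x + y) ^ n \<le> 2 ^ n * (x ^ n + y ^ n)" if "0 \<le> x" "0 \<le> y" for x y :: real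
    using sum_power_le[of "UNIV :: bool set" "\<lambda>b. if b then x else y" n] that
    by (simp add: UNIV_bool add.commute)
  have ptw: "((\<Sum>b\<in>UNIV. ?f b x + ?g b x) ^ (CARD('n) - 1))\<^sup>2
      \<le> (2 * ?d) ^ n * (\<Sum>b\<in>UNIV. ?f b x powr ?p + ?g b x powr ?p)" for x
  proof -
    have "((\<Sum>b\<in>UNIV. ?f b x + ?g b x) ^ (CARD('n) - 1))\<^sup>2 = (\<Sum>b\<in>UNIV. ?f b x + ?g b x) ^ n"
      by (simp add: n_def mult.commute flip: power_mult)
    also have "\<dots> \<le> ?d ^ n * (\<Sum>b\<in>UNIV. (?f b x + ?g b x) ^ n)"
      by (rule sum_power_le) auto
    also have "\<dots> \<le> ?d ^ n * (\<Sum>b\<in>UNIV. 2 ^ n * (?f b x ^ n + ?g b x ^ n))"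
      by (intro mult_left_mono sum_mono two) auto
    also have "\<dots> = (2 * ?d) ^ n * (\<Sum>b\<in>UNIV. ?f b x powr ?p + ?g b x powr ?p)"
      unfolding n(2) by (simp add: powr_realpow' n(1) power_mult_distrib flip: sum_distrib_left)
    finally show ?thesis .
  qed
  let ?bF = "sobolev_norm std_gaussian 1 ?p F powr ?p" and ?bG = "sobolev_norm std_gaussian 1 ?p G powr ?p"
  have "(\<integral>\<^sup>+x. ennreal (((\<Sum>b\<in>UNIV. ?f b x + ?g b x) ^ (CARD('n) - 1))\<^sup>2) \<partial>std_gaussian)
      \<le> (\<integral>\<^sup>+x. ennreal ((2 * ?d) ^ n) * (\<Sum>b\<in>UNIV. ennreal (?f b x powr ?p) + ennreal (?g b x powr ?p)) \<partial>std_gaussian)"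
    by (intro nn_integral_mono order_trans[OF ennreal_leI[OF ptw]])
       (simp add: ennreal_mult sum_nonneg flip: sum_ennreal ennreal_plus)
  also have "\<dots> = ennreal ((2 * ?d) ^ n) * (\<Sum>b\<in>UNIV. (\<integral>\<^sup>+x. ennreal (?f b x powr ?p) \<partial>std_gaussian) + (\<integral>\<^sup>+x. ennreal (?g b x powr ?p) \<partial>std_gaussian))"
    by (subst nn_integral_cmult, measurable) (subst nn_integral_sum, measurable, subst nn_integral_add, measurable)
  also have "\<dots> \<le> ennreal ((2 * ?d) ^ n) * (\<Sum>b\<in>(UNIV :: 'n set). ennreal ?bF + ennreal ?bG)"
    by (intro mult_left_mono sum_mono add_mono nn_integral_weak_deriv_le_sobolev_norm F G p0 e1) auto
  also have "\<dots> = ennreal ((2 * ?d) ^ n * (?d * (?bF + ?bG)))"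
    by (simp add: ennreal_of_nat_eq_real_of_nat ennreal_mult flip: ennreal_plus)
  also have "\<dots> \<le> ennreal (jacobian_moment_bound (CARD('n)) (sobolev_norm std_gaussian 1 ?p F) (sobolev_norm std_gaussian 1 ?p G))"
    by (intro ennreal_leI) (simp add: jacobian_moment_bound_def n_def sobolev_norm_def)
  finally show ?thesis .
qed

text \<open>
  The absolute values and the summand \<open>1\<close> make the constant positive for all real arguments, including
  those that do not occur as norms.
\<close>

definition KL_constant :: "nat \<Rightarrow> real \<Rightarrow> real \<Rightarrow> real \<Rightarrow> real \<Rightarrow> real \<Rightarrow> real" where
  "KL_constant d c c\<^sub>F a b b' = 1 + \<bar>c\<^sub>F\<bar> * (\<bar>a\<bar> / 2 + fact d * (real d * (real d * sqrt (jacobian_moment_bound d b b'))) / \<bar>c\<bar>)"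

lemma KL_constant_pos: "0 < KL_constant d c c\<^sub>F a b b'"
  unfolding KL_constant_def using jacobian_moment_bound_ge_1[of d b b']
  by (intro add_pos_nonneg mult_nonneg_nonneg add_nonneg_nonneg divide_nonneg_nonneg) auto

text \<open>
  The logarithm of the quotient of the densities is bounded pointwise by a function \<open>W\<close>, whose Gaussian
  integral is estimated by the Cauchy--Schwarz inequality, applied once to \<open>\<parallel>F - G\<parallel> \<parallel>F + G\<parallel>\<close> and once
  for each partial derivative to its difference times the \<open>(d - 1)\<close>-st power of the size \<open>K\<close> of the Jacobians.
\<close>

theorem KL_pullback_std_gaussian_le:
  fixes F G :: "real^'n \<Rightarrow> real^'n"
  assumes F2: "sobolev_space std_gaussian 1 2 F" and G2: "sobolev_space std_gaussian 1 2 G"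
    and Fp: "sobolev_space std_gaussian 1 (2 * (real CARD('n) - 1)) F"
    and Gp: "sobolev_space std_gaussian 1 (2 * (real CARD('n) - 1)) G"
    and bij: "bij F" "bij G" and inv: "inv F \<in> borel_measurable borel" "inv G \<in> borel_measurable borel"
    and c: "0 < c"
    and det: "AE x in std_gaussian. c \<le> \<bar>det (weak_jacobian F x)\<bar> \<and> c \<le> \<bar>det (weak_jacobian G x)\<bar>"
    and ac: "absolutely_continuous lborel (pullback F std_gaussian)"
        "absolutely_continuous lborel (pullback G std_gaussian)"
    and cF: "AE x in lborel. lebesgue_density (pullback F std_gaussian) x \<le> c\<^sub>F * std_gaussian_density x"
  shows "KL (pullback F std_gaussian) (pullback G std_gaussian)
    \<le> ereal (KL_constant (CARD('n)) c c\<^sub>F (Lp_norm std_gaussian 2 (\<lambda>x. F x + G x))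
        (sobolev_norm std_gaussian 1 (2 * (real CARD('n) - 1)) F)
        (sobolev_norm std_gaussian 1 (2 * (real CARD('n) - 1)) G)
      * sobolev_norm std_gaussian 1 2 (\<lambda>x. F x - G x))"
proof -
  let ?\<eta> = "std_gaussian :: (real^'n) measure"
  define e where "e = (\<lambda>(b :: 'n) i. if i = b then (1::nat) else 0)"
  define a where "a = Lp_norm ?\<eta> 2 (\<lambda>x. F x + G x)"
  define h where "h = sobolev_norm ?\<eta> 1 2 (\<lambda>x. F x - G x)"
  define Q where "Q = jacobian_moment_bound (CARD('n)) (sobolev_norm ?\<eta> 1 (2 * (real CARD('n) - 1)) F)
      (sobolev_norm ?\<eta> 1 (2 * (real CARD('n) - 1)) G)"
  have a0: "0 \<le> a" and h0: "0 \<le> h" and Q1: "1 \<le> Q"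
    by (auto simp: a_def h_def Q_def Lp_norm_def sobolev_norm_def jacobian_moment_bound_ge_1)
  have Q0: "0 \<le> sqrt Q" using Q1 by simp
  let ?f = "\<lambda>b. weak_deriv (e b) F" and ?g = "\<lambda>b. weak_deriv (e b) G"
  have e1: "(\<Sum>i\<in>UNIV. e b i) \<le> 1" for b by (simp add: e_def)
  have wF: "has_weak_deriv (e b) F (?f b)" and wG: "has_weak_deriv (e b) G (?g b)" for b
    using sobolev_space_weak_deriv[OF F2 e1] sobolev_space_weak_deriv[OF G2 e1] by auto
  have lF: "locally_integrable F" and lG: "locally_integrable G"
    using wF wG by (auto simp: has_weak_deriv_def)
  have [measurable]: "F \<in> borel_measurable borel" "G \<in> borel_measurable borel"
    "\<And>b. ?f b \<in> borel_measurable borel" "\<And>b. ?g b \<in> borel_measurable borel"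
    using wF wG by (auto simp: has_weak_deriv_def locally_integrable_def)
  note H2 = sobolev_space_2_diff[OF F2 G2]

  have diff0: "(\<integral>\<^sup>+x. ennreal ((norm (F x - G x))\<^sup>2) \<partial>?\<eta>) \<le> ennreal (h\<^sup>2)"
  proof -
    have "AE x in ?\<eta>. weak_deriv (\<lambda>_. 0) (\<lambda>x. F x - G x) x = F x - G x"
      unfolding AE_std_gaussian_iff by (rule weak_deriv_AE_eq[OF has_weak_deriv_0[OF locally_integrable_diff[OF lF lG]]])
    then have "(\<integral>\<^sup>+x. ennreal ((norm (F x - G x))\<^sup>2) \<partial>?\<eta>)
        = (\<integral>\<^sup>+x. ennreal (norm (weak_deriv (\<lambda>_. 0) (\<lambda>x. F x - G x) x) powr 2) \<partial>?\<eta>)"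
      by (intro nn_integral_cong_AE) (elim eventually_mono, simp)
    also have "\<dots> \<le> ennreal (h powr 2)"
      unfolding h_def by (rule nn_integral_weak_deriv_le_sobolev_norm[OF H2]) auto
    finally show ?thesis using h0 by simp
  qed
  have diff1: "(\<integral>\<^sup>+x. ennreal ((norm (?f b x - ?g b x))\<^sup>2) \<partial>?\<eta>) \<le> ennreal (h\<^sup>2)" for b
  proof -
    have "AE x in ?\<eta>. weak_deriv (e b) (\<lambda>x. F x - G x) x = ?f b x - ?g b x"
      unfolding AE_std_gaussian_iff by (rule weak_deriv_AE_eq[OF has_weak_deriv_diff[OF wF wG]])
    then have "(\<integral>\<^sup>+x. ennreal ((norm (?f b x - ?g b x))\<^sup>2) \<partial>?\<eta>)
        = (\<integral>\<^sup>+x. ennreal (norm (weak_deriv (e b) (\<lambda>x. F x - G x) x) powr 2) \<partial>?\<eta>)"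
      by (intro nn_integral_cong_AE) (elim eventually_mono, simp)
    also have "\<dots> \<le> ennreal (h powr 2)"
      unfolding h_def by (rule nn_integral_weak_deriv_le_sobolev_norm[OF H2 _ e1]) auto
    finally show ?thesis using h0 by simp
  qed
  have sum2: "(\<integral>\<^sup>+x. ennreal ((norm (F x + G x))\<^sup>2) \<partial>?\<eta>) \<le> ennreal (a\<^sup>2)"
  proof -
    have L2: "Lp_space ?\<eta> 2 f" if f: "sobolev_space ?\<eta> 1 2 f" and l: "locally_integrable f" for f :: "real^'n \<Rightarrow> real^'n"
    proof -
      have "\<exists>g. has_weak_deriv (\<lambda>_. 0) f g \<and> Lp_space ?\<eta> 2 g"
        using f unfolding sobolev_space_def by (elim allE[of _ "\<lambda>_. 0"]) simp
      then obtain g where g: "has_weak_deriv (\<lambda>_. 0) f g" "Lp_space ?\<eta> 2 g" by blast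
      have "AE x in ?\<eta>. norm (g x) powr 2 = norm (f x) powr 2"
        unfolding AE_std_gaussian_iff
        using has_weak_deriv_unique[OF g(1) has_weak_deriv_0[OF l]] by eventually_elim simp
      moreover have [measurable]: "f \<in> borel_measurable borel" using l by (simp add: locally_integrable_def)
      ultimately have "integrable ?\<eta> (\<lambda>x. norm (f x) powr 2)"
        using g(2) by (subst integrable_cong_AE[symmetric]) (auto simp: Lp_space_def)
      then show ?thesis unfolding Lp_space_def by simp
    qed
    have "Lp_space ?\<eta> 2 (\<lambda>x. F x + 1 *\<^sub>R G x)"
      by (rule Lp_space_2_add_scaled[OF L2[OF F2 lF] L2[OF G2 lG]]) simp
    then have "Lp_space ?\<eta> 2 (\<lambda>x. F x + G x)" by simp
    from nn_integral_Lp_norm_2[OF this] show ?thesis by (simp add: a_def)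
  qed

  define K where "K x = (\<Sum>b\<in>UNIV. norm (?f b x) + norm (?g b x))" for x
  define \<Delta> where "\<Delta> x = (\<Sum>b\<in>UNIV. norm (?f b x - ?g b x))" for x
  have [measurable]: "K \<in> borel_measurable borel" unfolding K_def[abs_def] by measurable
  have K0: "0 \<le> K x" for x by (simp add: K_def sum_nonneg)
  have KQ: "(\<integral>\<^sup>+x. ennreal ((K x ^ (CARD('n) - 1))\<^sup>2) \<partial>?\<eta>) \<le> ennreal ((sqrt Q)\<^sup>2)"
    using nn_integral_jacobian_moment[OF Fp Gp] Q1 by (simp add: K_def e_def Q_def)
  have detdiff: "\<bar>\<bar>det (weak_jacobian F x)\<bar> - \<bar>det (weak_jacobian G x)\<bar>\<bar>
      \<le> fact CARD('n) * (real CARD('n) * \<Delta> x * K x ^ (CARD('n) - 1))" for x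
  proof -
    have "\<bar>\<bar>det (weak_jacobian F x)\<bar> - \<bar>det (weak_jacobian G x)\<bar>\<bar> \<le> \<bar>det (weak_jacobian F x) - det (weak_jacobian G x)\<bar>"
      by (rule abs_triangle_ineq3)
    also have "\<dots> \<le> fact CARD('n) * (real CARD('n) * \<Delta> x * K x ^ (CARD('n) - 1))"
    proof (rule abs_det_diff_le)
      fix i j
      have J: "weak_jacobian F x $ i $ j = ?f j x $ i" "weak_jacobian G x $ i $ j = ?g j x $ i"
        by (simp_all add: weak_jacobian_def e_def)
      have "norm (?f j x) + norm (?g j x) \<le> K x"
        unfolding K_def by (rule member_le_sum[of j UNIV "\<lambda>b. norm (?f b x) + norm (?g b x)"]) auto
      then show "\<bar>weak_jacobian F x $ i $ j\<bar> \<le> K x" "\<bar>weak_jacobian G x $ i $ j\<bar> \<le> K x"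
        using component_le_norm_cart[of "?f j x" i] component_le_norm_cart[of "?g j x" i]
          norm_ge_zero[of "?f j x"] norm_ge_zero[of "?g j x"] unfolding J by linarith+
      have "norm (?f j x - ?g j x) \<le> \<Delta> x"
        unfolding \<Delta>_def by (rule member_le_sum[of j UNIV "\<lambda>b. norm (?f b x - ?g b x)"]) auto
      then show "\<bar>weak_jacobian F x $ i $ j - weak_jacobian G x $ i $ j\<bar> \<le> \<Delta> x"
        using component_le_norm_cart[of "?f j x - ?g j x" i] unfolding J by simp
    qed
    finally show ?thesis .
  qed

  define k where "k = fact CARD('n) * real CARD('n) / c"
  have k0: "0 \<le> k" using c by (simp add: k_def)
  define W where "W x = norm (F x - G x) * norm (F x + G x) / 2 + k * (\<Delta> x * K x ^ (CARD('n) - 1))" for x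
  have \<Delta>0: "0 \<le> \<Delta> x" for x by (simp add: \<Delta>_def sum_nonneg)
  have W0: "0 \<le> W x" for x using k0 K0 \<Delta>0 by (auto simp: W_def)
  have [measurable]: "\<Delta> \<in> borel_measurable borel" unfolding \<Delta>_def[abs_def] by measurable
  have [measurable]: "W \<in> borel_measurable borel" unfolding W_def[abs_def] by measurable

  define B where "B = h * (a / 2 + k * (real CARD('n) * sqrt Q))"
  have intW: "(\<integral>\<^sup>+x. ennreal (W x) \<partial>?\<eta>) \<le> ennreal B"
  proof -
    have 1: "(\<integral>\<^sup>+x. ennreal (norm (F x - G x) * norm (F x + G x)) \<partial>?\<eta>) \<le> ennreal (h * a)"
      by (rule Cauchy_Schwarz_nn_integral_real) (use diff0 sum2 h0 a0 in auto)
    have 2: "(\<integral>\<^sup>+x. ennreal (norm (?f b x - ?g b x) * K x ^ (CARD('n) - 1)) \<partial>?\<eta>) \<le> ennreal (h * sqrt Q)" for b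
      by (rule Cauchy_Schwarz_nn_integral_real[OF _ _ _ _ h0 _ diff1 KQ]) (use Q1 K0 in auto)
    have "(\<integral>\<^sup>+x. ennreal (W x) \<partial>?\<eta>) = (\<integral>\<^sup>+x. ennreal (1/2) * ennreal (norm (F x - G x) * norm (F x + G x))
        + ennreal k * (\<Sum>b\<in>UNIV. ennreal (norm (?f b x - ?g b x) * K x ^ (CARD('n) - 1))) \<partial>?\<eta>)"
    proof (rule nn_integral_cong)
      fix x
      have "(\<Sum>b\<in>UNIV. ennreal (norm (?f b x - ?g b x) * K x ^ (CARD('n) - 1))) = ennreal (\<Delta> x * K x ^ (CARD('n) - 1))"
        using K0 by (simp add: \<Delta>_def sum_distrib_right)
      moreover have "ennreal k * ennreal (\<Delta> x * K x ^ (CARD('n) - 1)) = ennreal (k * (\<Delta> x * K x ^ (CARD('n) - 1)))"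
        using k0 \<Delta>0 K0 by (intro ennreal_mult[symmetric]) auto
      moreover have "ennreal (1/2) * ennreal (norm (F x - G x) * norm (F x + G x)) = ennreal (norm (F x - G x) * norm (F x + G x) / 2)"
        by (subst ennreal_mult[symmetric]) auto
      moreover have "0 \<le> k * (\<Delta> x * K x ^ (CARD('n) - 1))" using k0 \<Delta>0 K0 by simp
      ultimately show "ennreal (W x) = ennreal (1/2) * ennreal (norm (F x - G x) * norm (F x + G x))
        + ennreal k * (\<Sum>b\<in>UNIV. ennreal (norm (?f b x - ?g b x) * K x ^ (CARD('n) - 1)))"
        unfolding W_def by (simp only:) (rule ennreal_plus, auto)
    qed
    also have "\<dots> = ennreal (1/2) * (\<integral>\<^sup>+x. ennreal (norm (F x - G x) * norm (F x + G x)) \<partial>?\<eta>)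
        + ennreal k * (\<Sum>b\<in>UNIV. \<integral>\<^sup>+x. ennreal (norm (?f b x - ?g b x) * K x ^ (CARD('n) - 1)) \<partial>?\<eta>)"
      by (subst nn_integral_add, measurable, subst nn_integral_cmult, measurable)
         (subst nn_integral_cmult, measurable, subst nn_integral_sum, measurable)
    also have "\<dots> \<le> ennreal (1/2) * ennreal (h * a) + ennreal k * (\<Sum>b\<in>(UNIV :: 'n set). ennreal (h * sqrt Q))"
      by (intro add_mono mult_left_mono sum_mono 1 2) auto
    also have "(\<Sum>b\<in>(UNIV :: 'n set). ennreal (h * sqrt Q)) = ennreal (real CARD('n) * (h * sqrt Q))"
      using h0 Q0 by (simp add: ennreal_mult ennreal_of_nat_eq_real_of_nat)
    also have "ennreal (1/2) * ennreal (h * a) + ennreal k * ennreal (real CARD('n) * (h * sqrt Q))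
        = ennreal (1/2 * (h * a) + k * (real CARD('n) * (h * sqrt Q)))"
      using h0 a0 k0 Q0 by (simp only: ennreal_mult[symmetric] ennreal_plus[symmetric]
          mult_nonneg_nonneg of_nat_0_le_iff zero_le_divide_1_iff zero_le_numeral)
    also have "1/2 * (h * a) + k * (real CARD('n) * (h * sqrt Q)) = B"
      by (simp add: B_def algebra_simps)
    finally show ?thesis .
  qed
  have B0: "0 \<le> B" using h0 a0 k0 Q1 by (simp add: B_def)

  have "AE x in lborel. KL_integrand (lebesgue_density (pullback F ?\<eta>) x) (lebesgue_density (pullback G ?\<eta>) x)
      \<le> ereal (\<bar>c\<^sub>F\<bar> * std_gaussian_density x * W x)"
    using lebesgue_density_pullback_std_gaussian[OF wF[unfolded e_def] bij(1) inv(1) ac(1)]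
      lebesgue_density_pullback_std_gaussian[OF wG[unfolded e_def] bij(2) inv(2) ac(2)]
      cF det[unfolded AE_std_gaussian_iff]
  proof eventually_elim
    case (elim x)
    have "lebesgue_density (pullback F ?\<eta>) x \<le> \<bar>c\<^sub>F\<bar> * std_gaussian_density x"
      using elim(3) mult_right_mono[OF abs_ge_self[of c\<^sub>F], of "std_gaussian_density x"] std_gaussian_density_pos[of x]
      by linarith
    from KL_integrand_le[OF c conjunct1[OF elim(4)] conjunct2[OF elim(4)] elim(1) elim(2) this]
    have "KL_integrand (lebesgue_density (pullback F ?\<eta>) x) (lebesgue_density (pullback G ?\<eta>) x)
        \<le> ereal (\<bar>c\<^sub>F\<bar> * std_gaussian_density x * (norm (F x - G x) * norm (F x + G x) / 2
          + \<bar>\<bar>det (weak_jacobian F x)\<bar> - \<bar>det (weak_jacobian G x)\<bar>\<bar> / c))" .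
    also have "\<dots> \<le> ereal (\<bar>c\<^sub>F\<bar> * std_gaussian_density x * W x)"
    proof -
      have "\<bar>\<bar>det (weak_jacobian F x)\<bar> - \<bar>det (weak_jacobian G x)\<bar>\<bar> / c
          \<le> fact CARD('n) * (real CARD('n) * \<Delta> x * K x ^ (CARD('n) - 1)) / c"
        using c detdiff by (intro divide_right_mono) auto
      then show ?thesis
        using std_gaussian_density_pos[of x] unfolding W_def
        by (intro ereal_less_eq(3)[THEN iffD2] mult_left_mono) (auto simp: mult.assoc k_def)
    qed
    finally show ?case .
  qed
  then have "KL (pullback F ?\<eta>) (pullback G ?\<eta>)
      \<le> enn2ereal (\<integral>\<^sup>+x. ennreal (\<bar>c\<^sub>F\<bar> * std_gaussian_density x * W x) \<partial>lborel)"
    by (rule KL_le_nn_integral)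
  also have "(\<integral>\<^sup>+x. ennreal (\<bar>c\<^sub>F\<bar> * std_gaussian_density x * W x) \<partial>lborel)
      = (\<integral>\<^sup>+x. ennreal \<bar>c\<^sub>F\<bar> * (ennreal (std_gaussian_density x) * ennreal (W x)) \<partial>lborel)"
    by (intro nn_integral_cong)
       (simp add: mult.assoc ennreal_mult mult_nonneg_nonneg less_imp_le[OF std_gaussian_density_pos] W0)
  also have "\<dots> = ennreal \<bar>c\<^sub>F\<bar> * (\<integral>\<^sup>+x. ennreal (W x) \<partial>?\<eta>)"
    unfolding std_gaussian_def by (subst nn_integral_cmult, measurable) (subst nn_integral_density, measurable)
  also have "\<dots> \<le> ennreal \<bar>c\<^sub>F\<bar> * ennreal B" by (intro mult_left_mono intW) auto
  also have "\<dots> = ennreal (\<bar>c\<^sub>F\<bar> * B)" using B0 by (simp add: ennreal_mult)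
  also have "enn2ereal (ennreal (\<bar>c\<^sub>F\<bar> * B)) = ereal (\<bar>c\<^sub>F\<bar> * B)" using B0 by simp
  also have "\<dots> \<le> ereal (KL_constant (CARD('n)) c c\<^sub>F a (sobolev_norm ?\<eta> 1 (2 * (real CARD('n) - 1)) F)
      (sobolev_norm ?\<eta> 1 (2 * (real CARD('n) - 1)) G) * h)"
    using c a0 h0 by (simp add: KL_constant_def B_def Q_def k_def algebra_simps)
  finally show ?thesis by (simp add: a_def h_def less_eq_ennreal.rep_eq)
qed

theorem theorem3p7:
  "\<exists>C :: real \<Rightarrow> real \<Rightarrow> real \<Rightarrow> real \<Rightarrow> real \<Rightarrow> real.
     (\<forall>c c\<^sub>F a b b'. 0 < C c c\<^sub>F a b b') \<and>
     (\<forall>(F :: real^'n \<Rightarrow> real^'n) (G :: real^'n \<Rightarrow> real^'n) (c :: real) (c\<^sub>F :: real).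
        sobolev_space std_gaussian 1 2 F \<and>
        sobolev_space std_gaussian 1 2 G \<and>
        sobolev_space std_gaussian 1 (2 * (real CARD('n) - 1)) F \<and>
        sobolev_space std_gaussian 1 (2 * (real CARD('n) - 1)) G \<and>
        bij F \<and> bij G \<and>
        inv F \<in> borel_measurable borel \<and> inv G \<in> borel_measurable borel \<and>
        0 < c \<and>
        (AE x in std_gaussian. c \<le> \<bar>det (weak_jacobian F x)\<bar> \<and> c \<le> \<bar>det (weak_jacobian G x)\<bar>) \<and>
        absolutely_continuous lborel (pullback F std_gaussian) \<and>
        absolutely_continuous lborel (pullback G std_gaussian) \<and>
        (AE x in lborel. lebesgue_density (pullback F std_gaussian) x
           \<le> c\<^sub>F * std_gaussian_density x)
        \<longrightarrow>
        KL (pullback F std_gaussian) (pullback G std_gaussian)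
          \<le> ereal (C c c\<^sub>F
                     (Lp_norm std_gaussian 2 (\<lambda>x. F x + G x))
                     (sobolev_norm std_gaussian 1 (2 * (real CARD('n) - 1)) F)
                     (sobolev_norm std_gaussian 1 (2 * (real CARD('n) - 1)) G)
                   * sobolev_norm std_gaussian 1 2 (\<lambda>x. F x - G x)))"
  by (rule exI[of _ "KL_constant (CARD('n))"])
     (intro conjI allI impI KL_constant_pos, elim conjE, rule KL_pullback_std_gaussian_le; assumption)

end
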